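(* Fix an integer $p\geq 2$, a unit vector $\theta_1^0\in\mathbb{R}^p$, $v>0$ and a bounded positive real sequence $(r_n)$. Let $Z$ be a $p\times p$ random matrix such that ${\rm vec}(Z)\sim\mathcal N(0,I_{p^2}+K_p)$. Then, under $\mathrm{P}_{\theta_1^0,r_n,v}$, the following hold as $n\to\infty$: (i)–(ii) if $r_n\equiv1$, or if $r_n=o(1)$ with $\sqrt n\,r_n\to\infty$, then $Q_{\rm A}\stackrel{\mathcal D}{\to}\chi^2_{p-1}$, so that the test $\phi_{\rm A}$ has asymptotic size $\alpha$ under the null hypothesis; (iii) if $r_n=1/\sqrt n$, then $$Q_{\rm A}\stackrel{\mathcal D}{\to}\sum_{j=2}^p(\ell_1(v)-\ell_j(v))^2(w_{j1}(v))^2,$$ where $\ell_1(v)\geq\cdots\geq\ell_p(v)$ are the eigenvalues of $Z+{\rm diag}(v,0,\ldots,0)$ and $w_j(v)=(w_{j1}(v),\ldots,w_{jp}(v))'$ is an arbitrary unit eigenvector associated with $\ell_j(v)$ (with probability one, the only freedom in the choice of $w_j(v)$ is in its sign, which is irrelevant here); (iv) if $r_n=o(1/\sqrt n)$, then $$Q_{\rm A}\stackrel{\mathcal D}{\to}\sum_{j=2}^p(\ell_1-\ell_j)^2w_{j1}^2,$$ where $\ell_1\geq\cdots\geq\ell_p$ are the eigenvalues of $Z$ and $w_j=(w_{j1},\ldots,w_{jp})'$ is an arbitrary unit eigenvector associated with $\ell_j$.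
   Context: Model: for a unit vector $\theta_1\in\mathbb{R}^p$, $v>0$ and a positive sequence $(r_n)$, $\mathrm{P}_{\theta_1,r_n,v}$ denotes the (sequence of) hypotheses under which, for each $n$, $X_{n1},\ldots,X_{nn}$ are i.i.d. $p$-variate normal with mean $0$ and covariance matrix $\Sigma_n=I_p+r_nv\,\theta_1\theta_1'$ (a triangular array; the dimension $p$ is fixed). Prime denotes transpose. Let $\bar X_n=\frac1n\sum_{i=1}^nX_{ni}$ and $S_n=\frac1n\sum_{i=1}^n(X_{ni}-\bar X_n)(X_{ni}-\bar X_n)'$, and let $\hat\lambda_{n1}\geq\cdots\geq\hat\lambda_{np}$ be the eigenvalues of $S_n$. Test: for the null hypothesis $\mathcal{H}_0^{(n)}:\theta_1=\theta_1^0$, the Anderson likelihood ratio test $\phi_{\rm A}$ rejects at asymptotic level $\alpha$ when $Q_{\rm A}>\chi^2_{p-1,1-\alpha}$, where $$Q_{\rm A}=Q_{\rm A}^{(n)}=n\big(\hat\lambda_{n1}\theta_1^{0\prime}S_n^{-1}\theta_1^0+\hat\lambda_{n1}^{-1}\theta_1^{0\prime}S_n\theta_1^0-2\big)$$ and $\chi^2_{\ell,1-\alpha}$ is the $\alpha$-upper quantile of the chi-square distribution with $\ell$ degrees of freedom. Asymptotic size $\alpha$ under the null hypothesis means that the rejection probability under $\mathrm{P}_{\theta_1^0,r_n,v}$ converges to $\alpha$. ${\rm vec}(A)$ stacks the columns of $A$ on top of each other; $K_p$ is the $p^2\times p^2$ commutation matrix, i.e. $K_p\,{\rm vec}(A)={\rm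 vec}(A')$ for every $p\times p$ matrix $A$. $\stackrel{\mathcal D}{\to}$ denotes weak convergence. *)

theory Defs
  imports
    "HOL-Probability.Probability"
    "HOL-Computational_Algebra.Polynomial"
    "HOL-Library.Multiset"
    "HOL-Library.Landau_Symbols"
begin

section \<open>Matrices\<close>

text \<open>The coordinates of $\mathbb{R}^p$ are indexed by a finite linearly ordered type, so
  that there is a first coordinate.\<close>

definition first_index :: "'p::{finite,linorder}" where
  "first_index = Min UNIV"

definition diag_first :: "real \<Rightarrow> (real^'p::{finite,linorder})^'p::{finite,linorder}" where
  "diag_first v = (\<chi> i j. if i = first_index \<and> j = first_index then v else 0)"

definition outer_prod :: "real^'p \<Rightarrow> real^'p \<Rightarrow> real^'p^'p" where
  "outer_prod x y = (\<chi> i j. x $ i * y $ j)"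

text \<open>The entries of $\mathrm{vec}(A)$ are indexed by pairs (column, row) instead of
  $1,\dots,p^2$.\<close>

definition vec_of :: "real^'p^'p \<Rightarrow> real^('p::finite \<times> 'p::finite)" where
  "vec_of A = (\<chi> k. A $ snd k $ fst k)"

definition commutation_matrix :: "real^('p::finite \<times> 'p::finite)^('p \<times> 'p)" where
  "commutation_matrix = (\<chi> k l. if l = prod.swap k then 1 else 0)"

lemma commutation_matrix_vec_of: "commutation_matrix *v vec_of A = vec_of (transpose A)"
  by (simp add: vec_eq_iff commutation_matrix_def vec_of_def matrix_vector_mult_def
      transpose_def if_distrib[where f = "\<lambda>x. x * _"] cong: if_cong)

definition charpoly :: "real^'p^'p \<Rightarrow> real poly" where
  "charpoly A = det (\<chi> i j. (if i = j then [:0, 1:] else 0) - [:A $ i $ j:])"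

lemma poly_charpoly: "poly (charpoly A) x = det (mat x - A)"
  by (auto simp: charpoly_def det_def poly_sum poly_prod mat_def sign_def
      intro!: sum.cong prod.cong)

text \<open>The \<open>j\<close>-th largest eigenvalue, counted from 1 and with multiplicity. It is meant for
  matrices with only real eigenvalues, such as symmetric ones.\<close>

definition eigval :: "real^'p^'p \<Rightarrow> nat \<Rightarrow> real" where
  "eigval A j = rev (sorted_list_of_multiset (proots (charpoly A))) ! (j - 1)"

definition unit_eigenvector :: "real^'p^'p \<Rightarrow> real \<Rightarrow> real^'p \<Rightarrow> bool" where
  "unit_eigenvector A l w \<longleftrightarrow> norm w = 1 \<and> A *v w = l *\<^sub>R w"


section \<open>Distributions\<close>

definition normal_measure :: "real \<Rightarrow> real \<Rightarrow> real measure" where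
  "normal_measure m s2 =
     (if s2 = 0 then return borel m else density lborel (normal_density m (sqrt s2)))"

text \<open>Possibly singular multivariate normal distributions: all linear combinations are
  univariate normal with the mean and variance prescribed by \<open>\<mu>\<close> and \<open>\<Sigma>\<close>.\<close>

definition multivariate_normal ::
    "'a measure \<Rightarrow> ('a \<Rightarrow> real^'k) \<Rightarrow> real^'k \<Rightarrow> real^'k^'k \<Rightarrow> bool" where
  "multivariate_normal M X \<mu> \<Sigma> \<longleftrightarrow>
     X \<in> borel_measurable M \<and> transpose \<Sigma> = \<Sigma> \<and>
     (\<forall>a. distr M borel (\<lambda>\<omega>. a \<bullet> X \<omega>) = normal_measure (a \<bullet> \<mu>) (a \<bullet> (\<Sigma> *v a)))"

definition chi_square :: "nat \<Rightarrow> real measure" where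
  "chi_square l =
     distr (PiM {..<l} (\<lambda>_. density lborel std_normal_density)) borel (\<lambda>x. \<Sum>i<l. (x i)\<^sup>2)"

definition chi_square_upper_quantile :: "nat \<Rightarrow> real \<Rightarrow> real" where
  "chi_square_upper_quantile l \<alpha> = Inf {x. cdf (chi_square l) x \<ge> 1 - \<alpha>}"


section \<open>The model and the test\<close>

text \<open>For each sample size \<open>n \<ge> 1\<close>, the observations are \<open>X n 1, \<dots>, X n n\<close>, defined on a
  probability space \<open>M n\<close>.\<close>

definition spiked_model ::
    "(nat \<Rightarrow> 'a measure) \<Rightarrow> (nat \<Rightarrow> nat \<Rightarrow> 'a \<Rightarrow> real^'p) \<Rightarrow>
     real^'p \<Rightarrow> (nat \<Rightarrow> real) \<Rightarrow> real \<Rightarrow> bool" where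
  "spiked_model M X \<theta> r v \<longleftrightarrow>
     (\<forall>n\<ge>1. prob_space (M n) \<and>
            prob_space.indep_vars (M n) (\<lambda>_. borel) (X n) {1..n} \<and>
            (\<forall>i\<in>{1..n}. multivariate_normal (M n) (X n i) 0
                           (mat 1 + (r n * v) *\<^sub>R outer_prod \<theta> \<theta>)))"

definition sample_mean :: "nat \<Rightarrow> (nat \<Rightarrow> real^'p) \<Rightarrow> real^'p" where
  "sample_mean n x = (1 / real n) *\<^sub>R (\<Sum>i=1..n. x i)"

definition sample_cov :: "nat \<Rightarrow> (nat \<Rightarrow> real^'p) \<Rightarrow> real^'p^'p" where
  "sample_cov n x =
     (1 / real n) *\<^sub>R (\<Sum>i=1..n. outer_prod (x i - sample_mean n x) (x i - sample_mean n x))"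

text \<open>The sample covariance matrix is almost surely invertible once \<open>n > p\<close>; where it is
  singular, \<^const>\<open>matrix_inv\<close> is an arbitrary matrix.\<close>

definition anderson_stat :: "nat \<Rightarrow> real^'p \<Rightarrow> (nat \<Rightarrow> real^'p) \<Rightarrow> real" where
  "anderson_stat n \<theta> x =
     (let S = sample_cov n x; l1 = eigval S 1
      in real n * (l1 * (\<theta> \<bullet> (matrix_inv S *v \<theta>)) + inverse l1 * (\<theta> \<bullet> (S *v \<theta>)) - 2))"

definition anderson_rejects :: "real \<Rightarrow> nat \<Rightarrow> real^'p \<Rightarrow> (nat \<Rightarrow> real^'p) \<Rightarrow> bool" where
  "anderson_rejects \<alpha> n \<theta> x \<longleftrightarrow>
     anderson_stat n \<theta> x > chi_square_upper_quantile (CARD('p) - 1) \<alpha>"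

text \<open>Weak convergence of \<open>Q n\<close> (on \<open>M n\<close>) to \<open>T\<close> (on \<open>N\<close>). The law of \<open>T\<close> is taken on the
  completion of \<open>N\<close>, so that \<open>T\<close> may be specified arbitrarily on a null set, even in a
  non-measurable way.\<close>

definition converges_in_distribution ::
    "(nat \<Rightarrow> 'a measure) \<Rightarrow> (nat \<Rightarrow> 'a \<Rightarrow> real) \<Rightarrow> 'b measure \<Rightarrow> ('b \<Rightarrow> real) \<Rightarrow> bool" where
  "converges_in_distribution M Q N T \<longleftrightarrow>
     T \<in> borel_measurable (completion N) \<and>
     weak_conv_m (\<lambda>n. distr (M n) borel (Q n)) (distr (completion N) borel T)"

end

theory Submission
  imports Defs
begin

text \<open>Let \<open>\<Sigma> = I + r v \<theta> \<theta>'\<close> be the covariance matrix of the observations for sample size \<open>n\<close>. Multiplied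
  by \<open>\<Sigma>\<^sup>-\<^sup>1\<^sup>/\<^sup>2\<close>, the observations become independent standard Gaussian vectors, whose sample covariance matrix
  is \<open>I + G / \<surd>n\<close>. The central limit theorem for their quadratic forms shows that \<open>G\<close> converges in law to
  the symmetric Gaussian matrix \<open>Z\<close> (\<open>normalized_sample_cov_cf_limit\<close>), and this does not involve the
  sequence \<open>r\<close>. The statistic is a function of \<open>G\<close> alone, because
  \<open>S = \<Sigma>\<^sup>1\<^sup>/\<^sup>2 (I + G / \<surd>n) \<Sigma>\<^sup>1\<^sup>/\<^sup>2\<close>, so the theorem reduces to a limit of deterministic functions and a continuous
  mapping argument.

  The deterministic part rests on the identity \<open>Q = (n / l) u' S\<^sup>-\<^sup>1 u\<close> with \<open>u = (S - l) \<theta>\<close> and \<open>l\<close> the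
  largest eigenvalue of \<open>S\<close> (\<open>anderson_of_quadratic\<close>), which removes all eigenvectors except through \<open>l\<close>.
  If \<open>\<surd>n r v\<close> tends to a finite \<open>c\<close>, then \<open>\<surd>n (S - I)\<close> converges to \<open>W = Z + c \<theta> \<theta>'\<close>, and \<open>Q\<close> to the squared
  length of \<open>(W - l(W)) \<theta>\<close>, where \<open>l(W)\<close> is the largest eigenvalue of \<open>W\<close>. If \<open>\<surd>n r\<close> tends to infinity, the
  leading eigenvalue separates from the others, \<open>\<surd>n u\<close> is asymptotically orthogonal to \<open>\<theta>\<close>, and \<open>Q\<close>
  converges to the squared length of the component of \<open>Z \<theta>\<close> orthogonal to \<open>\<theta>\<close>, which is a sum of
  \<open>p - 1\<close> squares of independent standard normal variables (\<open>goe_chi_square\<close>).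

  The law of \<open>Z\<close> is invariant under rotations, so \<open>\<theta>\<close> may be moved to the first axis. Almost surely
  the matrix \<open>Z + c e e'\<close>, with \<open>e\<close> the first axis, has simple spectrum (\<open>goe_simple_spectrum\<close>): \<open>Z\<close> contains an
  independent normal multiple of a fixed diagonal matrix with distinct entries, and on a line in that direction
  only finitely many matrices can have a repeated eigenvalue. Then the unit eigenvectors are
  unique up to sign and form an orthonormal basis, and expanding \<open>(W - l(W)) e\<close> in it gives
  the sums of the theorem (\<open>sum_eigenvectors_eq\<close>).

  The probabilistic tools are Levy's continuity theorem for random vectors
  (\<open>bounded_continuous_limit\<close>), a continuous mapping theorem for maps that vary with \<open>n\<close>
  (\<open>continuous_mapping\<close>), and the uniqueness of laws with given characteristic function
  (\<open>cf_uniqueness\<close>).\<close>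

section \<open>The spectral theorem and the largest eigenvalue\<close>

lemma symmetric_inner:
  fixes A :: "real^'n^'n"
  assumes "transpose A = A"
  shows "x \<bullet> (A *v y) = (A *v x) \<bullet> y"
  by (metis assms dot_lmul_matrix vector_transpose_matrix)

text \<open>A minimiser of a quadratic form that is nonnegative on \<open>S\<close> lies in its kernel: a step \<open>t\<close> from
  \<open>x\<close> along \<open>z = A x\<close> changes the form by \<open>2 t \<bar>z\<bar>\<^sup>2\<close> to first order, so that it would become negative
  for some \<open>t < 0\<close> unless \<open>z = 0\<close>.\<close>

lemma psd_kernel:
  fixes A :: "real^'n^'n"
  assumes sym: "transpose A = A" and S: "subspace S"
    and inv: "\<And>y. y \<in> S \<Longrightarrow> A *v y \<in> S"
    and psd: "\<And>y. y \<in> S \<Longrightarrow> 0 \<le> y \<bullet> (A *v y)"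
    and x: "x \<in> S" "x \<bullet> (A *v x) = 0"
  shows "A *v x = 0"
proof -
  define z where "z = A *v x"
  define m where "m = z \<bullet> (A *v z)"
  have zS: "z \<in> S" using inv x z_def by auto
  have m: "0 \<le> m" using psd zS m_def by auto
  \<comment> \<open>The denominator \<open>m + 1\<close> instead of \<open>m\<close> covers the case \<open>m = 0\<close>.\<close>
  define t where "t = - (z \<bullet> z) / (m + 1)"
  have "x + t *\<^sub>R z \<in> S" using x zS S by (simp add: subspace_add subspace_scale)
  from psd[OF this] have "0 \<le> 2 * t * (z \<bullet> z) + t\<^sup>2 * m"
    using x(2) symmetric_inner[OF sym, of x z]
    by (simp add: matrix_vector_right_distrib scaleR_matrix_vector_assoc[symmetric] inner_add_left
        inner_add_right m_def z_def[symmetric] power2_eq_square algebra_simps vec.scale inner_commute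
        matrix_vector_mult_scaleR)
  also have "\<dots> = (z \<bullet> z)\<^sup>2 * (m / (m+1)\<^sup>2 - 2 / (m + 1))"
    using m by (simp add: t_def power2_eq_square field_simps)
  finally have "0 \<le> (z \<bullet> z)\<^sup>2 * (m / (m+1)\<^sup>2 - 2 / (m + 1))" .
  moreover have "m / (m+1)\<^sup>2 - 2 / (m + 1) < 0"
    using m by (simp add: divide_simps power2_eq_square)
  ultimately have "(z \<bullet> z)\<^sup>2 \<le> 0" 
    by (simp only: zero_le_mult_iff) auto
  then show ?thesis by (simp add: z_def)
qed

text \<open>Eigenvectors are collected one at a time. The orthogonal complement \<open>S\<close> of those already
  found is invariant. If \<open>x\<close> maximises the quadratic form of \<open>A\<close> on the unit sphere of \<open>S\<close> and \<open>l\<close> is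
  the maximum, then \<open>l I - A\<close> is nonnegative on \<open>S\<close> and its form vanishes at \<open>x\<close>, so \<open>A x = l x\<close>.\<close>

theorem symmetric_orthonormal_eigenbasis:
  fixes A :: "real^'n^'n"
  assumes sym: "transpose A = A"
  obtains u :: "'n \<Rightarrow> real^'n" and \<mu> :: "'n \<Rightarrow> real"
  where "\<And>i j. u i \<bullet> u j = (if i = j then 1 else 0)" "\<And>i. A *v u i = \<mu> i *\<^sub>R u i"
proof -
  have step: "k \<le> CARD('n) \<Longrightarrow> \<exists>B. card B = k \<and> finite B \<and> pairwise orthogonal B \<and>
      (\<forall>b\<in>B. norm b = 1 \<and> (\<exists>m. A *v b = m *\<^sub>R b))" for k
  proof (induction k)
    case 0
    show ?case by (rule exI[of _ "{}"]) auto
  next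
    case (Suc k)
    then obtain B where B: "card B = k" "finite B" "pairwise orthogonal B"
      "\<And>b. b \<in> B \<Longrightarrow> norm b = 1" "\<And>b. b \<in> B \<Longrightarrow> \<exists>m. A *v b = m *\<^sub>R b"
      by auto
    define S where "S = {x. \<forall>b\<in>B. b \<bullet> x = 0}"
    have S: "subspace S" by (auto simp: S_def subspace_def inner_right_distrib)
    have "span B \<noteq> UNIV"
    proof
      assume "span B = UNIV"
      then have "dim (UNIV :: (real^'n) set) \<le> card B"
        using dim_le_card[of UNIV B] B(2) by simp
      then show False using Suc.prems B(1) by simp
    qed
    then obtain a where a: "a \<noteq> 0" "\<And>x. x \<in> span B \<Longrightarrow> a \<bullet> x = 0"
      using span_not_UNIV_orthogonal by blast
    have aS: "a \<in> S" using a by (auto simp: S_def inner_commute span_base)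
    let ?K = "S \<inter> sphere 0 1"
    have "compact ?K" using closed_subspace[OF S] by (simp add: closed_Int_compact)
    moreover have "a /\<^sub>R norm a \<in> ?K" using a aS S by (auto simp: subspace_scale)
    moreover have "continuous_on ?K (\<lambda>x. x \<bullet> (A *v x))"
      by (intro continuous_intros linear_continuous_on) auto
    ultimately obtain x where x: "x \<in> ?K" "\<And>y. y \<in> ?K \<Longrightarrow> y \<bullet> (A *v y) \<le> x \<bullet> (A *v x)"
      using continuous_attains_sup[of ?K "\<lambda>x. x \<bullet> (A *v x)"] by (metis empty_iff)
    define l where "l = x \<bullet> (A *v x)"
    let ?C = "l *\<^sub>R mat 1 - A"
    have C: "?C *v y = l *\<^sub>R y - A *v y" for y
      by (simp add: matrix_vector_mult_diff_rdistrib scaleR_matrix_vector_assoc[symmetric])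
    have "?C *v x = 0"
    proof (rule psd_kernel[OF _ S])
      show "transpose ?C = ?C" 
        using sym by (simp add: vec_eq_iff transpose_def mat_def)
      show "?C *v y \<in> S" if "y \<in> S" for y
      proof -
        have "b \<bullet> (A *v y) = 0" if b: "b \<in> B" for b
          using B(5)[OF b] \<open>y \<in> S\<close> b by (auto simp: symmetric_inner[OF sym] S_def)
        then show ?thesis using \<open>y \<in> S\<close> S by (auto simp: C S_def inner_diff_right)
      qed
      show "0 \<le> y \<bullet> (?C *v y)" if "y \<in> S" for y
      proof (cases "y = 0")
        case False
        then have "y /\<^sub>R norm y \<in> ?K" using that S by (auto simp: subspace_scale)
        from x(2)[OF this] have "(y \<bullet> (A *v y)) / (norm y)\<^sup>2 \<le> l"
          by (simp add: l_def matrix_vector_mult_scaleR power2_eq_square divide_inverse mult_ac)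
        with False have "y \<bullet> (A *v y) \<le> l * (norm y)\<^sup>2" by (simp add: divide_le_eq)
        then show ?thesis by (simp add: C inner_diff_right power2_norm_eq_inner)
      qed auto
      show "x \<in> S" using x by simp
      show "x \<bullet> (?C *v x) = 0" unfolding C using x by (simp add: inner_diff_right l_def norm_eq_1)
    qed
    then have ev: "A *v x = l *\<^sub>R x" by (simp add: C)
    have "x \<notin> B" using x by (auto simp: S_def)
    then show ?case using B x ev
      by (intro exI[of _ "insert x B"])
         (auto simp: pairwise_insert S_def orthogonal_def[of _ x] orthogonal_def[of x] inner_commute)
  qed
  from step[of "CARD('n)"] obtain B where B: "card B = CARD('n)" "finite B" "pairwise orthogonal B"
      "\<And>b. b \<in> B \<Longrightarrow> norm b = 1" "\<And>b. b \<in> B \<Longrightarrow> \<exists>m. A *v b = m *\<^sub>R b" by auto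
  obtain u where u: "bij_betw u (UNIV::'n set) B"
    using B finite_same_card_bij[of "UNIV::'n set" B] by auto
  have uB: "u i \<in> B" for i using u by (auto simp: bij_betw_def)
  obtain \<mu> where \<mu>: "\<And>i. A *v u i = \<mu> i *\<^sub>R u i" using B(5)[OF uB] by metis
  have "u i \<bullet> u j = (if i = j then 1 else 0)" for i j
  proof (cases "i = j")
    case True then show ?thesis using B(4)[OF uB, of i] by (simp add: norm_eq_1)
  next
    case False
    then have "u i \<noteq> u j" using u by (auto simp: bij_betw_def inj_on_def)
    then show ?thesis using B(3) uB False by (auto simp: pairwise_def orthogonal_def)
  qed
  then show ?thesis using \<mu> that by blast
qed

lemma onb_expansion:
  fixes u :: "'n::finite \<Rightarrow> real^'n"
  assumes u: "\<And>i j. u i \<bullet> u j = (if i = j then 1 else 0)"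
  shows "x = (\<Sum>i\<in>UNIV. (u i \<bullet> x) *\<^sub>R u i)" and "x \<bullet> x = (\<Sum>i\<in>UNIV. (u i \<bullet> x)\<^sup>2)"
proof -
  have inj: "inj u" using u by (metis (full_types) injI zero_neq_one)
  have nz: "0 \<notin> range u" using u by (metis imageE inner_zero_left zero_neq_one)
  have orth: "pairwise orthogonal (range u)" using u by (auto simp: pairwise_def orthogonal_def)
  have "independent (range u)" using orth nz by (rule pairwise_orthogonal_independent)
  then have "span (range u) = UNIV"
    using inj card_ge_dim_independent[of "range u" UNIV] by (auto simp: card_image)
  define y where "y = x - (\<Sum>i\<in>UNIV. (u i \<bullet> x) *\<^sub>R u i)"
  have "u j \<bullet> y = 0" for j
    by (simp add: y_def inner_diff_right inner_sum_right u if_distrib cong: if_cong)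
  then have "orthogonal y z" if "z \<in> span (range u)" for z
    using that by (intro orthogonal_to_span[OF that]) (auto simp: orthogonal_def inner_commute)
  then have "orthogonal y y" using \<open>span (range u) = UNIV\<close> by auto
  then show 1: "x = (\<Sum>i\<in>UNIV. (u i \<bullet> x) *\<^sub>R u i)"
    by (simp add: orthogonal_self y_def)
  have "x \<bullet> x = x \<bullet> (\<Sum>i\<in>UNIV. (u i \<bullet> x) *\<^sub>R u i)" using 1 by simp
  also have "\<dots> = (\<Sum>i\<in>UNIV. (u i \<bullet> x)\<^sup>2)"
    by (simp add: inner_sum_right power2_eq_square inner_commute)
  finally show "x \<bullet> x = (\<Sum>i\<in>UNIV. (u i \<bullet> x)\<^sup>2)" .
qed

text \<open>The matrix \<open>P\<close> with columns \<open>u i\<close> is orthogonal and satisfies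
  \<open>(x I - A) P = P diag (x - \<mu> i)\<close>; take determinants.\<close>

lemma charpoly_eigenbasis:
  fixes A :: "real^'n^'n" and u :: "'n \<Rightarrow> real^'n" and \<mu> :: "'n \<Rightarrow> real"
  assumes u: "\<And>i j. u i \<bullet> u j = (if i = j then 1 else 0)"
    and ev: "\<And>i. A *v u i = \<mu> i *\<^sub>R u i"
  shows "charpoly A = (\<Prod>i\<in>UNIV. [:- \<mu> i, 1:])"
proof -
  define P :: "real^'n^'n" where "P = (\<chi> i j. u j $ i)"
  have PP: "transpose P ** P = mat 1"
    using u by (simp add: vec_eq_iff matrix_matrix_mult_def transpose_def P_def mat_def inner_vec_def)
  have detP: "det P * det P = 1"
    using arg_cong[OF PP, of det] by (simp add: det_mul det_transpose)
  have "poly (charpoly A) x = poly (\<Prod>i\<in>UNIV. [:- \<mu> i, 1:]) x" for x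
  proof -
    define D :: "real^'n^'n" where "D = (\<chi> i j. if i = j then x - \<mu> i else 0)"
    have "(mat x - A) ** P = P ** D"
    proof -
      have "((mat x - A) ** P) $ i $ j = (P ** D) $ i $ j" for i j
      proof -
        have "((mat x - A) ** P) $ i $ j = ((mat x - A) *v u j) $ i"
          by (simp add: matrix_matrix_mult_def matrix_vector_mult_def P_def)
        also have "\<dots> = (x *\<^sub>R u j - \<mu> j *\<^sub>R u j) $ i"
          using ev[of j] by (simp add: matrix_vector_mult_diff_rdistrib)
             (simp add: matrix_vector_mult_def mat_def if_distrib[of "\<lambda>a. a * _"] cong: if_cong)
        also have "\<dots> = (P ** D) $ i $ j"
          by (simp add: matrix_matrix_mult_def P_def D_def if_distrib[of "\<lambda>a. _ * a"] algebra_simps cong: if_cong)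
        finally show ?thesis .
      qed
      then show ?thesis by (simp add: vec_eq_iff)
    qed
    from arg_cong[OF this, of det] have "det (mat x - A) = det D"
      using detP by (simp add: det_mul) (auto simp: mult.commute)
    also have "det D = (\<Prod>i\<in>UNIV. x - \<mu> i)"
      by (subst det_diagonal) (auto simp: D_def)
    finally show ?thesis by (simp add: poly_charpoly poly_prod)
  qed
  then show ?thesis by (simp add: poly_eq_poly_eq_iff[symmetric] fun_eq_iff)
qed

lemma proots_charpoly_eigenbasis:
  fixes A :: "real^'n^'n" and u :: "'n \<Rightarrow> real^'n" and \<mu> :: "'n \<Rightarrow> real"
  assumes u: "\<And>i j. u i \<bullet> u j = (if i = j then 1 else 0)"
    and ev: "\<And>i. A *v u i = \<mu> i *\<^sub>R u i"
  shows "proots (charpoly A) = image_mset \<mu> (mset_set UNIV)"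
proof -
  have "proots (\<Prod>i\<in>I. [:- \<mu> i, 1:]) = image_mset \<mu> (mset_set I)" if "finite I" for I
    using that
  proof (induction I)
    case (insert i I)
    have "(\<Prod>i\<in>I. [:- \<mu> i, 1:]) \<noteq> 0" using insert by (simp add: prod_zero_iff)
    then have "proots ([:- \<mu> i, 1:] * (\<Prod>i\<in>I. [:- \<mu> i, 1:]))
        = proots [:- \<mu> i, 1:] + proots (\<Prod>i\<in>I. [:- \<mu> i, 1:])"
      by (intro proots_mult) auto
    moreover have "proots [:- \<mu> i, 1:] = {#\<mu> i#}" using proots_linear_factor[of "\<mu> i"] by simp
    ultimately show ?case using insert by simp
  qed auto
  then show ?thesis using charpoly_eigenbasis[OF u ev] by simp
qed

definition sorted_eigvals :: "real^'n^'n \<Rightarrow> real list" where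
  "sorted_eigvals A = rev (sorted_list_of_multiset (proots (charpoly A)))"

lemma sorted_eigvals_eigenbasis:
  fixes A :: "real^'n^'n" and u :: "'n \<Rightarrow> real^'n" and \<mu> :: "'n \<Rightarrow> real"
  assumes u: "\<And>i j. u i \<bullet> u j = (if i = j then 1 else 0)"
    and ev: "\<And>i. A *v u i = \<mu> i *\<^sub>R u i"
  shows "length (sorted_eigvals A) = CARD('n)" "set (sorted_eigvals A) = range \<mu>"
    "distinct (sorted_eigvals A) \<longleftrightarrow> inj \<mu>" "sorted_wrt (\<ge>) (sorted_eigvals A)"
proof -
  have m: "mset (sorted_eigvals A) = image_mset \<mu> (mset_set UNIV)"
    using proots_charpoly_eigenbasis[OF u ev] by (simp add: sorted_eigvals_def)
  show len: "length (sorted_eigvals A) = CARD('n)" using arg_cong[OF m, of size] by simp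
  show set: "set (sorted_eigvals A) = range \<mu>" using arg_cong[OF m, of set_mset] by simp
  show "distinct (sorted_eigvals A) \<longleftrightarrow> inj \<mu>"
    using len set by (metis card_distinct distinct_card eq_card_imp_inj_on card_image finite)
  show "sorted_wrt (\<ge>) (sorted_eigvals A)"
    by (simp add: sorted_eigvals_def sorted_wrt_rev)
qed

lemma eigval_nth: "eigval A j = sorted_eigvals A ! (j - 1)"
  by (simp add: eigval_def sorted_eigvals_def)

text \<open>The largest eigenvalue of a symmetric matrix. As a supremum of linear functions of \<open>A\<close> it is
  Lipschitz on all square matrices, which gives continuity and measurability without
  restricting to symmetric arguments.\<close>

definition rayleigh_max :: "real^'n^'n \<Rightarrow> real" where
  "rayleigh_max A = (SUP x\<in>sphere 0 1. x \<bullet> (A *v x))"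

lemma norm_matrix_vector_le:
  fixes A :: "real^'n^'m"
  shows "norm (A *v x) \<le> norm A * norm x"
proof -
  have "norm (A *v x) = L2_set (\<lambda>i. norm ((A *v x) $ i)) UNIV" by (simp add: norm_vec_def)
  also have "\<dots> \<le> L2_set (\<lambda>i. norm (A $ i) * norm x) UNIV"
    by (intro L2_set_mono) (auto simp: matrix_mult_dot Cauchy_Schwarz_ineq2)
  also have "\<dots> = norm A * norm x" by (simp add: L2_set_left_distrib[symmetric] norm_vec_def)
  finally show ?thesis .
qed

lemma rayleigh_bound: "\<bar>x \<bullet> ((A::real^'n^'n) *v x)\<bar> \<le> norm A * (norm x)\<^sup>2"
proof -
  have "\<bar>x \<bullet> (A *v x)\<bar> \<le> norm x * norm (A *v x)" by (rule Cauchy_Schwarz_ineq2)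
  also have "\<dots> \<le> norm x * (norm A * norm x)" by (intro mult_left_mono norm_matrix_vector_le) auto
  finally show ?thesis by (simp add: power2_eq_square algebra_simps)
qed

lemma unit_sphere_nonempty: "sphere (0::'a::euclidean_space) 1 \<noteq> {}"
  by (metis SOME_Basis norm_Basis mem_sphere_0 empty_iff)

lemma rayleigh_le: 
  assumes "norm x = 1"
  shows "x \<bullet> ((A::real^'n^'n) *v x) \<le> rayleigh_max A"
  unfolding rayleigh_max_def
proof (rule cSUP_upper)
  show "bdd_above ((\<lambda>x. x \<bullet> (A *v x)) ` sphere 0 1)"
  proof (intro bdd_aboveI2)
    fix x :: "real^'n" assume "x \<in> sphere 0 1"
    then show "x \<bullet> (A *v x) \<le> norm A" using rayleigh_bound[of x A] by auto
  qed
qed (use assms in auto)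

lemma rayleigh_max_least:
  assumes "\<And>x. norm x = 1 \<Longrightarrow> x \<bullet> ((A::real^'n^'n) *v x) \<le> c"
  shows "rayleigh_max A \<le> c"
  unfolding rayleigh_max_def
  using assms unit_sphere_nonempty by (intro cSUP_least) auto

lemma rayleigh_max_diff_le: "rayleigh_max (A::real^'n^'n) \<le> rayleigh_max B + norm (A - B)"
proof (rule rayleigh_max_least)
  fix x :: "real^'n" assume x: "norm x = 1"
  have "x \<bullet> (A *v x) = x \<bullet> (B *v x) + x \<bullet> ((A - B) *v x)"
    by (simp add: matrix_vector_mult_diff_rdistrib inner_diff_right)
  then show "x \<bullet> (A *v x) \<le> rayleigh_max B + norm (A - B)"
    using rayleigh_bound[of x "A - B"] rayleigh_le[OF x, of B] x by simp
qed

lemma rayleigh_max_Lipschitz: "\<bar>rayleigh_max (A::real^'n^'n) - rayleigh_max B\<bar> \<le> norm (A - B)"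
  using rayleigh_max_diff_le[of A B] rayleigh_max_diff_le[of B A] by (simp add: norm_minus_commute)

lemma continuous_rayleigh_max [continuous_intros]: "continuous_on S (rayleigh_max :: real^'n^'n \<Rightarrow> real)"
  unfolding continuous_on_iff dist_norm real_norm_def
  by (meson le_less_trans rayleigh_max_Lipschitz)

lemma tendsto_rayleigh_max:
  fixes A :: "'b \<Rightarrow> real^'n^'n"
  assumes "(A \<longlongrightarrow> B) F" shows "((\<lambda>n. rayleigh_max (A n)) \<longlongrightarrow> rayleigh_max B) F"
  using continuous_on_tendsto_compose[OF continuous_rayleigh_max[of UNIV] assms] by simp

lemma rayleigh_max_affine:
  assumes "0 \<le> c"
  shows "rayleigh_max (c *\<^sub>R A + d *\<^sub>R mat 1 :: real^'n^'n) = c * rayleigh_max A + d"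
proof -
  have q: "x \<bullet> ((c *\<^sub>R A + d *\<^sub>R mat 1) *v x) = c * (x \<bullet> (A *v x)) + d" if "norm x = 1" for x
    using that by (simp add: matrix_vector_mult_add_rdistrib scaleR_matrix_vector_assoc[symmetric]
       inner_add_right norm_eq_1)
  show ?thesis
  proof (rule antisym)
    show "rayleigh_max (c *\<^sub>R A + d *\<^sub>R mat 1) \<le> c * rayleigh_max A + d"
      by (rule rayleigh_max_least) (simp add: q assms mult_left_mono rayleigh_le)
    have "c * rayleigh_max A \<le> rayleigh_max (c *\<^sub>R A + d *\<^sub>R mat 1) - d"
    proof (cases "c = 0")
      case True
      obtain x :: "real^'n" where "norm x = 1" using unit_sphere_nonempty[where 'a="real^'n"] by fastforce
      from rayleigh_le[OF this, of "c *\<^sub>R A + d *\<^sub>R mat 1"] q[OF this] True show ?thesis by simp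
    next
      case False
      with assms have c: "c > 0" by simp
      have "rayleigh_max A \<le> (rayleigh_max (c *\<^sub>R A + d *\<^sub>R mat 1) - d) / c"
      proof (rule rayleigh_max_least)
        fix x :: "real^'n" assume "norm x = 1"
        from rayleigh_le[OF this, of "c *\<^sub>R A + d *\<^sub>R mat 1"] q[OF this] c 
        show "x \<bullet> (A *v x) \<le> (rayleigh_max (c *\<^sub>R A + d *\<^sub>R mat 1) - d) / c"
          by (simp add: pos_le_divide_eq mult.commute)
      qed
      then show ?thesis using c by (simp add: pos_le_divide_eq mult.commute)
    qed
    then show "c * rayleigh_max A + d \<le> rayleigh_max (c *\<^sub>R A + d *\<^sub>R mat 1)" by simp
  qed
qed

lemma eigval_1_eq_rayleigh_max:
  fixes A :: "real^'n^'n"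
  assumes sym: "transpose A = A"
  shows "eigval A 1 = rayleigh_max A"
proof -
  obtain u \<mu> where u: "\<And>i j. u i \<bullet> u j = (if i = j then 1 else (0::real))"
    and ev: "\<And>i::'n. A *v u i = \<mu> i *\<^sub>R u i"
    using symmetric_orthonormal_eigenbasis[OF sym] by metis
  note s = sorted_eigvals_eigenbasis[OF u ev]
  have hd: "eigval A 1 \<in> range \<mu>" using s(1,2) by (metis eigval_nth diff_self_eq_0 nth_mem zero_less_card_finite)
  have le: "\<mu> i \<le> eigval A 1" for i
  proof -
    have "\<mu> i \<in> set (sorted_eigvals A)" using s(2) by auto
    then obtain k where k: "k < length (sorted_eigvals A)" "\<mu> i = sorted_eigvals A ! k"
      by (metis in_set_conv_nth)
    then show ?thesis using s(4) by (cases k) (auto simp: eigval_nth sorted_wrt_iff_nth_less)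
  qed
  show ?thesis
  proof (rule antisym)
    obtain i where i: "eigval A 1 = \<mu> i" using hd by auto
    have "norm (u i) = 1" using u[of i i] by (simp add: norm_eq_1)
    from rayleigh_le[OF this, of A] show "eigval A 1 \<le> rayleigh_max A" using ev[of i] u[of i i] i by simp
    show "rayleigh_max A \<le> eigval A 1"
    proof (rule rayleigh_max_least)
      fix x :: "real^'n" assume x: "norm x = 1"
      have "u i \<bullet> (A *v x) = \<mu> i * (u i \<bullet> x)" for i
        using symmetric_inner[OF sym, of "u i" x] ev[of i] by simp
      then have "A *v x = (\<Sum>i\<in>UNIV. (\<mu> i * (u i \<bullet> x)) *\<^sub>R u i)"
        using onb_expansion(1)[OF u, of "A *v x"] by simp
      then have "x \<bullet> (A *v x) = (\<Sum>i\<in>UNIV. \<mu> i * (u i \<bullet> x)\<^sup>2)"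
        by (simp add: inner_sum_right power2_eq_square inner_commute mult.assoc)
      also have "\<dots> \<le> (\<Sum>i\<in>UNIV. eigval A 1 * (u i \<bullet> x)\<^sup>2)"
        by (intro sum_mono mult_right_mono le) auto
      also have "\<dots> = eigval A 1" using x onb_expansion(2)[OF u, of x]
        by (simp add: sum_distrib_left[symmetric] norm_eq_1)
      finally show "x \<bullet> (A *v x) \<le> eigval A 1" .
    qed
  qed
qed

section \<open>Symmetric matrices with simple spectrum\<close>

text \<open>An enumeration of the index type, so that the powers \<open>0, \<dots>, n - 1\<close> of a matrix can label the
  columns of a square matrix.\<close>

definition idx :: "'n::finite \<Rightarrow> nat" where
  "idx = (SOME f. bij_betw f (UNIV::'n set) {0..<CARD('n)})"

lemma bij_idx: "bij_betw idx (UNIV::'n::finite set) {0..<CARD('n)}"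
  unfolding idx_def by (rule someI_ex[OF ex_bij_betw_finite_nat[OF finite]])

lemma inj_idx: "inj idx" using bij_idx by (auto simp: bij_betw_def)
lemma idx_eq_iff [simp]: "idx i = idx j \<longleftrightarrow> i = j" using inj_idx by (rule inj_eq)
lemma idx_less: "idx (i::'n::finite) < CARD('n)" using bij_idx by (auto simp: bij_betw_def)

text \<open>Its columns are the powers of \<open>A\<close> applied to the all-ones vector. The determinant vanishes
  unless the all-ones vector is cyclic for \<open>A\<close>; it is a polynomial in the entries of \<open>A\<close> and serves in
  place of the discriminant of the characteristic polynomial.\<close>

definition krylov :: "real^'n^'n \<Rightarrow> real^'n^'n" where
  "krylov A = (\<chi> i k. (((*v) A ^^ idx k) 1) $ i)"

text \<open>An eigenvector orthogonal to the all-ones vector \<open>1\<close> is orthogonal to every \<open>A\<^sup>k 1\<close>, that is,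
  to all columns of an invertible matrix.\<close>

lemma krylov_orthogonal_eigenvector:
  fixes A :: "real^'n^'n"
  assumes sym: "transpose A = A" and K: "det (krylov A) \<noteq> 0"
    and w: "A *v w = l *\<^sub>R w" "w \<bullet> 1 = 0"
  shows "w = 0"
proof -
  have "w \<bullet> (((*v) A ^^ k) 1) = 0" for k
  proof (induction k)
    case (Suc k)
    then show ?case using symmetric_inner[OF sym, of w] w(1) by simp
  qed (use w in simp)
  then have "transpose (krylov A) *v w = 0"
    by (simp add: vec_eq_iff matrix_vector_mult_def transpose_def krylov_def inner_vec_def mult.commute)
  moreover have "invertible (transpose (krylov A))"
    using K by (simp add: invertible_det_nz det_transpose)
  ultimately show ?thesis
    by (metis invertible_left_inverse matrix_left_invertible_ker)
qed

text \<open>Two eigenvectors with the same eigenvalue have a linear combination that is orthogonal to the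
  all-ones vector, so they are proportional.\<close>

lemma simple_unit_eigenvector:
  fixes A :: "real^'n^'n"
  assumes sym: "transpose A = A" and K: "det (krylov A) \<noteq> 0"
    and "unit_eigenvector A l x" "unit_eigenvector A l y"
  shows "x = y \<or> x = - y"
proof -
  have x: "norm x = 1" "A *v x = l *\<^sub>R x" and y: "norm y = 1" "A *v y = l *\<^sub>R y"
    using assms by (auto simp: unit_eigenvector_def)
  have "(y \<bullet> 1) *\<^sub>R x - (x \<bullet> 1) *\<^sub>R y = 0"
    by (rule krylov_orthogonal_eigenvector[OF sym K, of _ l])
       (simp_all add: matrix_vector_mult_diff_distrib matrix_vector_mult_scaleR x y inner_diff_left algebra_simps)
  then have eq: "(y \<bullet> 1) *\<^sub>R x = (x \<bullet> 1) *\<^sub>R y" by simp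
  have ne: "x \<bullet> 1 \<noteq> 0" using krylov_orthogonal_eigenvector[OF sym K x(2)] x(1) by auto
  have "\<bar>y \<bullet> 1\<bar> = \<bar>x \<bullet> 1\<bar>" using arg_cong[OF eq, of norm] x(1) y(1) by simp
  then consider "y \<bullet> 1 = x \<bullet> 1" | "y \<bullet> 1 = - (x \<bullet> 1)" by linarith
  then show ?thesis
  proof cases
    case 1
    then have "(x \<bullet> 1) *\<^sub>R x = (x \<bullet> 1) *\<^sub>R y" using eq by (simp only:)
    then show ?thesis using ne scaleR_cancel_left by blast
  next
    case 2
    then have "(x \<bullet> 1) *\<^sub>R (- x) = (x \<bullet> 1) *\<^sub>R y"
      using eq by (simp only: scaleR_minus_left scaleR_minus_right)
    then have "- x = y" using ne scaleR_cancel_left by blast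
    then show ?thesis by auto
  qed
qed

text \<open>When the spectrum is simple, the vectors \<open>w j\<close> form an orthonormal eigenbasis, and the identity
  is Parseval's for the vector \<open>(A - l\<^sub>1) x\<close>, whose component along \<open>w 1\<close> is zero. The right-hand side
  does not mention eigenvectors any more and is continuous in \<open>A\<close>.\<close>

lemma sum_eigenvectors_eq:
  fixes A :: "real^'n^'n"
  assumes sym: "transpose A = A" and K: "det (krylov A) \<noteq> 0"
    and w: "\<forall>j\<in>{1..CARD('n)}. unit_eigenvector A (eigval A j) (w j)"
  shows "(\<Sum>j=2..CARD('n). (eigval A 1 - eigval A j)\<^sup>2 * (w j \<bullet> x)\<^sup>2)
     = (norm (A *v x - rayleigh_max A *\<^sub>R x))\<^sup>2"
proof -
  obtain u \<mu> where u: "\<And>i j. u i \<bullet> u j = (if i = j then 1 else (0::real))"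
    and ev: "\<And>i::'n. A *v u i = \<mu> i *\<^sub>R u i"
    using symmetric_orthonormal_eigenbasis[OF sym] by metis
  note s = sorted_eigvals_eigenbasis[OF u ev]
  have "inj \<mu>"
  proof
    fix i j assume "\<mu> i = \<mu> j"
    then have "u i = u j \<or> u i = - u j"
      using simple_unit_eigenvector[OF sym K, of "\<mu> i" "u i" "u j"] u ev
      by (auto simp: unit_eigenvector_def norm_eq_1)
    then have "u i \<bullet> u j \<noteq> 0" using u[of j j] by auto
    then show "i = j" using u[of i j] by presburger
  qed
  then have dist: "distinct (sorted_eigvals A)" using s by simp
  have eq_iff: "eigval A (Suc k) = eigval A (Suc m) \<longleftrightarrow> k = m" if "k < CARD('n)" "m < CARD('n)" for k m
    using dist that s(1) by (simp add: eigval_nth nth_eq_iff_index_eq)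
  define v :: "'n \<Rightarrow> real^'n" where "v i = w (Suc (idx i))" for i
  define l where "l i = eigval A (Suc (idx i))" for i :: 'n
  have v: "norm (v i) = 1" "A *v v i = l i *\<^sub>R v i" for i
    using w idx_less[of i] by (auto simp: unit_eigenvector_def v_def l_def)
  have "v i \<bullet> v j = (if i = j then 1 else 0)" for i j
  proof (cases "i = j")
    case False
    then have "l i \<noteq> l j" by (simp add: l_def eq_iff idx_less)
    moreover have "l i * (v i \<bullet> v j) = l j * (v i \<bullet> v j)"
      using symmetric_inner[OF sym, of "v i" "v j"] v by auto
    ultimately show ?thesis using False by (metis mult_right_cancel)
  qed (use v in \<open>simp add: norm_eq_1\<close>)
  note on = onb_expansion(2)[OF this]
  have l1: "rayleigh_max A = eigval A 1" using eigval_1_eq_rayleigh_max[OF sym] by simp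
  have "(norm (A *v x - rayleigh_max A *\<^sub>R x))\<^sup>2 = (\<Sum>i\<in>UNIV. (v i \<bullet> (A *v x - rayleigh_max A *\<^sub>R x))\<^sup>2)"
    by (simp add: power2_norm_eq_inner on)
  also have "\<dots> = (\<Sum>i\<in>UNIV. (\<lambda>k. (eigval A 1 - eigval A (Suc k))\<^sup>2 * (w (Suc k) \<bullet> x)\<^sup>2) (idx (i::'n)))"
  proof (rule sum.cong)
    fix i
    have "v i \<bullet> (A *v x - rayleigh_max A *\<^sub>R x) = (l i - rayleigh_max A) * (v i \<bullet> x)"
      using symmetric_inner[OF sym, of "v i" x] v by (simp add: inner_diff_right algebra_simps)
    then show "(v i \<bullet> (A *v x - rayleigh_max A *\<^sub>R x))\<^sup>2
        = (eigval A 1 - eigval A (Suc (idx i)))\<^sup>2 * (w (Suc (idx i)) \<bullet> x)\<^sup>2"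
      by (simp add: l1 l_def v_def power_mult_distrib power2_commute)
  qed simp
  also have "\<dots> = (\<Sum>k\<in>{0..<CARD('n)}. (eigval A 1 - eigval A (Suc k))\<^sup>2 * (w (Suc k) \<bullet> x)\<^sup>2)"
    by (rule sum.reindex_bij_betw[OF bij_idx])
  also have "\<dots> = (\<Sum>j\<in>{1..CARD('n)}. (eigval A 1 - eigval A j)\<^sup>2 * (w j \<bullet> x)\<^sup>2)"
    by (rule sum.reindex_bij_witness[of _ "\<lambda>j. j - 1" Suc]) auto
  also have "\<dots> = (\<Sum>j=2..CARD('n). (eigval A 1 - eigval A j)\<^sup>2 * (w j \<bullet> x)\<^sup>2)"
    by (rule sum.mono_neutral_right) (auto simp: not_le numeral_2_eq_2 less_Suc_eq_le)
  finally show ?thesis by simp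
qed

definition idx_diag :: "real^'n^'n" where
  "idx_diag = (\<chi> i j. if i = j then real (idx i) else 0)"

text \<open>The Krylov matrix of a diagonal matrix is the Vandermonde matrix of the diagonal entries: a
  vector in its kernel lists the coefficients of a polynomial of degree less than \<open>n\<close> with \<open>n\<close>
  distinct roots.\<close>

lemma det_krylov_idx_diag: "det (krylov (idx_diag :: real^'n^'n)) \<noteq> 0"
proof -
  have it: "(((*v) idx_diag ^^ k) 1) $ i = real (idx i) ^ k" for k and i :: 'n
    by (induction k) (auto simp: idx_diag_def matrix_vector_mult_def if_distrib[of "\<lambda>a. a * _"] cong: if_cong)
  have "c = 0" if c: "krylov idx_diag *v c = 0" for c :: "real^'n"
  proof -
    define q where "q = (\<Sum>k\<in>UNIV. monom (c $ k) (idx (k::'n)))"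
    have co: "coeff q (idx k) = c $ k" for k
      by (simp add: q_def coeff_sum)
    have "coeff q m = 0" if "m \<ge> CARD('n)" for m
    proof -
      have "idx (k::'n) \<noteq> m" for k using that idx_less[of k] by simp
      then show ?thesis by (simp add: q_def coeff_sum)
    qed
    then have deg: "q \<noteq> 0 \<Longrightarrow> degree q < CARD('n)"
      by (metis leading_coeff_0_iff not_le)
    have root: "poly q (real (idx i)) = 0" for i :: 'n
      using arg_cong[OF c, of "\<lambda>x. x $ i"]
      by (simp add: q_def poly_sum poly_monom matrix_vector_mult_def krylov_def it mult.commute)
    have "q = 0"
    proof (rule ccontr)
      assume "q \<noteq> 0"
      then have fin: "finite {x. poly q x = 0}" by (rule poly_roots_finite)
      have "CARD('n) = card (range (\<lambda>i::'n. real (idx i)))"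
        using inj_idx by (subst card_image) (auto simp: inj_def)
      also have "\<dots> \<le> card {x. poly q x = 0}" using root by (intro card_mono fin) auto
      also have "\<dots> \<le> degree q" by (rule card_poly_roots_bound[OF \<open>q \<noteq> 0\<close>])
      finally show False using deg \<open>q \<noteq> 0\<close> by simp
    qed
    then show ?thesis using co by (simp add: vec_eq_iff)
  qed
  then have "invertible (krylov (idx_diag :: real^'n^'n))"
    using invertible_left_inverse matrix_left_invertible_ker by blast
  then show ?thesis by (simp add: invertible_det_nz)
qed

lemma det_krylov_scaleR:
  "det (krylov (c *\<^sub>R A :: real^'n^'n)) = (\<Prod>k\<in>UNIV. c ^ idx (k::'n)) * det (krylov A)"
proof -
  have it: "((*v) (c *\<^sub>R A) ^^ k) 1 = c ^ k *\<^sub>R ((*v) A ^^ k) 1" for k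
    by (induction k) (simp_all add: matrix_vector_mult_scaleR scaleR_matrix_vector_assoc[symmetric])
  have "transpose (krylov (c *\<^sub>R A)) = (\<chi> k. c ^ idx k *s transpose (krylov A) $ k)"
    by (simp add: vec_eq_iff krylov_def transpose_def it)
  then have "det (transpose (krylov (c *\<^sub>R A))) = (\<Prod>k\<in>UNIV. c ^ idx (k::'n)) * det (transpose (krylov A))"
    by (simp add: det_rows_mul)
  then show ?thesis by (simp add: det_transpose)
qed

lemma matrix_vector_mult_nth: "(A *v x) $ i = (\<Sum>j\<in>UNIV. A $ i $ j * x $ j)"
  by (simp add: matrix_vector_mult_def)

lemma det_krylov_pencil_poly:
  fixes B D :: "real^'n^'n"
  shows "\<exists>q. \<forall>t. det (krylov (D + t *\<^sub>R B)) = poly q t"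
proof -
  have "\<exists>q. \<forall>t i. (((*v) (D + t *\<^sub>R B) ^^ k) 1) $ i = poly (q i) t" for k
  proof (induction k)
    case 0 show ?case by (rule exI[of _ "\<lambda>_. 1"]) simp
  next
    case (Suc k)
    then obtain q where q: "\<And>t i. (((*v) (D + t *\<^sub>R B) ^^ k) 1) $ i = poly (q i) t" by auto
    show ?case
      by (rule exI[of _ "\<lambda>i. \<Sum>j\<in>UNIV. [:D $ i $ j, B $ i $ j:] * q j"])
         (simp add: matrix_vector_mult_nth[where A="D + _ *\<^sub>R B"] poly_sum q
           algebra_simps sum.distrib sum_distrib_left del: matrix_vector_mult_add_rdistrib)
  qed
  then obtain q where q: "\<And>k t i. (((*v) (D + t *\<^sub>R B) ^^ k) 1) $ i = poly (q k i) t" by metis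
  have "det (krylov (D + t *\<^sub>R B)) = poly (det (\<chi> i k. q (idx k) i)) t" for t
    by (auto simp: krylov_def q det_def poly_sum poly_prod sign_def intro!: sum.cong)
  then show ?thesis by blast
qed

text \<open>On the line \<open>D + t B\<close>, with \<open>D\<close> diagonal with distinct entries, the determinant is a polynomial
  in \<open>t\<close> that is nonzero at \<open>0\<close>. Homogeneity of the columns carries this over to \<open>B + t D\<close> by
  \<open>t \<mapsto> 1 / t\<close>.\<close>

lemma finite_non_cyclic_line:
  fixes B :: "real^'n^'n"
  shows "finite {t. det (krylov (B + t *\<^sub>R idx_diag)) = 0}"
proof -
  obtain q where q: "\<And>t. det (krylov (idx_diag + t *\<^sub>R B)) = poly q t"
    using det_krylov_pencil_poly[of idx_diag B] by auto
  have "poly q 0 \<noteq> 0" using q[of 0] det_krylov_idx_diag[where 'n='n] by simp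
  then have fin: "finite {t. poly q t = 0}" by (intro poly_roots_finite) auto
  have "{t. det (krylov (B + t *\<^sub>R idx_diag)) = 0} \<subseteq> insert 0 (inverse ` {t. poly q t = 0})"
  proof
    fix t assume t: "t \<in> {t. det (krylov (B + t *\<^sub>R idx_diag)) = 0}"
    show "t \<in> insert 0 (inverse ` {t. poly q t = 0})"
    proof (cases "t = 0")
      case False
      then have "B + t *\<^sub>R idx_diag = t *\<^sub>R (idx_diag + inverse t *\<^sub>R B)" by (simp add: scaleR_add_right)
      then have "poly q (inverse t) = 0" using t False by (simp add: det_krylov_scaleR q)
      then show ?thesis by (intro insertI2 image_eqI[of _ _ "inverse t"]) auto
    qed simp
  qed
  then show ?thesis using fin by (meson finite_imageI finite_insert finite_subset)
qed

section \<open>Deterministic limits of the statistic\<close>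

lemma tendsto_matrix_vector_mult [tendsto_intros]:
  fixes A :: "'b \<Rightarrow> real^'n^'m"
  assumes "(A \<longlongrightarrow> A') F" "(x \<longlongrightarrow> x') F"
  shows "((\<lambda>k. A k *v x k) \<longlongrightarrow> A' *v x') F"
  unfolding matrix_vector_mult_def
  by (intro vec_tendstoI) (auto intro!: tendsto_sum tendsto_mult tendsto_vec_nth assms)

lemma tendsto_matrix_mult [tendsto_intros]:
  fixes A :: "'b \<Rightarrow> real^'n^'m" and B :: "'b \<Rightarrow> real^'k^'n"
  assumes "(A \<longlongrightarrow> A') F" "(B \<longlongrightarrow> B') F"
  shows "((\<lambda>k. A k ** B k) \<longlongrightarrow> A' ** B') F"
  unfolding matrix_matrix_mult_def
  by (intro vec_tendstoI) (auto intro!: tendsto_sum tendsto_mult tendsto_vec_nth assms)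

lemma tendsto_det:
  fixes A :: "'b \<Rightarrow> real^'n^'n"
  assumes "(A \<longlongrightarrow> A') F"
  shows "((\<lambda>k. det (A k)) \<longlongrightarrow> det A') F"
  unfolding det_def by (intro tendsto_sum tendsto_mult tendsto_prod tendsto_vec_nth tendsto_const assms)

lemma matrix_inv_mult:
  fixes A :: "real^'n^'n"
  assumes "det A \<noteq> 0" shows "A ** matrix_inv A = mat 1" "matrix_inv A ** A = mat 1"
  using assms unfolding invertible_det_nz[symmetric] matrix_inv_def invertible_def
  by (metis (mono_tags, lifting) someI_ex)+

lemma matrix_inv_mult_vec:
  fixes A :: "real^'n^'n"
  assumes "det A \<noteq> 0" shows "A *v (matrix_inv A *v x) = x" "matrix_inv A *v (A *v x) = x"
  using matrix_inv_mult[OF assms] by (simp_all add: matrix_vector_mul_assoc)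

lemma matrix_inv_cramer:
  fixes A :: "real^'n^'n"
  assumes "det A \<noteq> 0"
  shows "matrix_inv A *v b = (\<chi> k. det (\<chi> i j. if j = k then b $ i else A $ i $ j) / det A)"
  using cramer[OF assms, of "matrix_inv A *v b" b] matrix_inv_mult_vec[OF assms] by simp

text \<open>By Cramer's rule the solution of a linear system is a quotient of two determinants, which are
  polynomials in the data.\<close>

lemma tendsto_matrix_inv_vec:
  fixes A :: "nat \<Rightarrow> real^'n^'n"
  assumes A: "A \<longlonglongrightarrow> A'" and b: "b \<longlonglongrightarrow> b'" and d: "det A' \<noteq> 0"
  shows "(\<lambda>n. matrix_inv (A n) *v b n) \<longlonglongrightarrow> matrix_inv A' *v b'" "eventually (\<lambda>n. det (A n) \<noteq> 0) sequentially"
proof -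
  show ev: "eventually (\<lambda>n. det (A n) \<noteq> 0) sequentially"
    using tendsto_det[OF A] d by (rule tendsto_imp_eventually_ne)
  have "(\<lambda>n. \<chi> k. det (\<chi> i j. if j = k then b n $ i else A n $ i $ j) / det (A n)) \<longlonglongrightarrow> matrix_inv A' *v b'"
    unfolding matrix_inv_cramer[OF d]
  proof (intro vec_tendstoI, simp, intro tendsto_divide tendsto_det d vec_tendstoI A)
    fix k i j
    show "(\<lambda>n. (\<chi> i j. if j = k then b n $ i else A n $ i $ j) $ i $ j)
       \<longlonglongrightarrow> (\<chi> i j. if j = k then b' $ i else A' $ i $ j) $ i $ j"
      by (cases "j = k") (auto intro!: tendsto_vec_nth A b)
  qed (intro tendsto_vec_nth A)
  then show "(\<lambda>n. matrix_inv (A n) *v b n) \<longlonglongrightarrow> matrix_inv A' *v b'"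
    by (rule Lim_transform_eventually) (use ev in eventually_elim, simp add: matrix_inv_cramer)
qed

lemma outer_prod_vec: "outer_prod x y *v z = (y \<bullet> z) *\<^sub>R x"
  by (simp add: vec_eq_iff outer_prod_def matrix_vector_mult_def inner_vec_def sum_distrib_left mult_ac)

lemma transpose_outer_prod: "transpose (outer_prod x y) = outer_prod y x"
  by (simp add: vec_eq_iff outer_prod_def transpose_def mult.commute)

lemma matrix_eq_vecI: "(\<And>x. (A::real^'n^'m) *v x = B *v x) \<Longrightarrow> A = B"
  by (simp add: matrix_eq)

text \<open>For suitable \<open>a\<close> this is the spiked covariance matrix, its square root, or the inverse of its
  square root.\<close>

definition spike :: "real^'n \<Rightarrow> real \<Rightarrow> real^'n^'n" where
  "spike \<theta> a = mat 1 + a *\<^sub>R outer_prod \<theta> \<theta>"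

lemma spike_vec: "spike \<theta> a *v x = x + (a * (\<theta> \<bullet> x)) *\<^sub>R \<theta>"
  by (simp add: spike_def matrix_vector_mult_add_rdistrib scaleR_matrix_vector_assoc[symmetric] outer_prod_vec)

lemma transpose_add: "transpose (A + B) = transpose A + transpose B"
  by (simp add: transpose_def vec_eq_iff)
lemma transpose_diff: "transpose (A - B) = transpose A - transpose (B :: real^'n^'m)"
  by (simp add: transpose_def vec_eq_iff)
lemma transpose_scaleR: "transpose (c *\<^sub>R A) = c *\<^sub>R transpose (A :: real^'n^'m)"
  by (simp add: transpose_def vec_eq_iff)

lemma transpose_spike: "transpose (spike \<theta> a) = spike \<theta> a"
  by (simp add: spike_def transpose_add transpose_scaleR transpose_outer_prod)

lemma spike_mult:
  assumes "norm \<theta> = 1"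
  shows "spike \<theta> a ** spike \<theta> b = spike \<theta> (a + b + a * b)"
  using assms by (intro matrix_eq_vecI) (simp add: matrix_vector_mul_assoc[symmetric] spike_vec
     norm_eq_1 inner_add_right algebra_simps)

lemma det_spike:
  assumes "norm \<theta> = 1" "0 \<le> a"
  shows "det (spike \<theta> a) \<noteq> 0"
proof -
  have "a + (- a / (1 + a)) + a * (- a / (1 + a)) = 0" using assms(2) by (simp add: field_simps)
  then have "spike \<theta> a ** spike \<theta> (- a / (1 + a)) = mat 1"
    by (simp only: spike_mult[OF assms(1)]) (simp add: spike_def)
  from arg_cong[OF this, of det] show ?thesis by (auto simp: det_mul)
qed

lemma rayleigh_max_spike:
  assumes "norm \<theta> = 1" "0 \<le> a"
  shows "rayleigh_max (spike \<theta> a) = 1 + a"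
proof (rule antisym)
  show "rayleigh_max (spike \<theta> a) \<le> 1 + a"
  proof (rule rayleigh_max_least)
    fix x :: "real^'a" assume x: "norm x = 1"
    have "\<bar>\<theta> \<bullet> x\<bar> \<le> 1" using Cauchy_Schwarz_ineq2[of \<theta> x] x assms by simp
    then have "(\<theta> \<bullet> x)\<^sup>2 \<le> 1" by (simp add: abs_square_le_1)
    then have "a * (\<theta> \<bullet> x)\<^sup>2 \<le> a" using assms by (simp add: mult_left_le)
    then show "x \<bullet> (spike \<theta> a *v x) \<le> 1 + a" using x
      by (simp add: spike_vec inner_add_right norm_eq_1 power2_eq_square inner_commute mult.assoc)
  qed
  show "1 + a \<le> rayleigh_max (spike \<theta> a)"
    using rayleigh_le[OF assms(1), of "spike \<theta> a"] assms by (simp add: spike_vec inner_add_right norm_eq_1)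
qed

definition anderson_of :: "real \<Rightarrow> real^'n \<Rightarrow> real^'n^'n \<Rightarrow> real" where
  "anderson_of m \<theta> S = m * (eigval S 1 * (\<theta> \<bullet> (matrix_inv S *v \<theta>))
      + inverse (eigval S 1) * (\<theta> \<bullet> (S *v \<theta>)) - 2)"

text \<open>As \<open>S\<close> commutes with \<open>S - l\<close>, where \<open>l\<close> is the largest eigenvalue,
  \<open>l S\<^sup>-\<^sup>1 + l\<^sup>-\<^sup>1 S - 2 = l\<^sup>-\<^sup>1 (S - l) S\<^sup>-\<^sup>1 (S - l)\<close>. All limits below are read off from the vector
  \<open>(S - l) \<theta>\<close>, which measures how far \<open>\<theta>\<close> is from being a leading eigenvector.\<close>

lemma anderson_of_quadratic:
  assumes sym: "transpose S = S" and "norm \<theta> = 1" and d: "det S \<noteq> 0" and l: "eigval S 1 \<noteq> 0"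
  defines "u \<equiv> S *v \<theta> - eigval S 1 *\<^sub>R \<theta>"
  shows "anderson_of m \<theta> S = m / eigval S 1 * (u \<bullet> (matrix_inv S *v u))"
proof -
  let ?l = "eigval S 1"
  have "matrix_inv S *v u = \<theta> - ?l *\<^sub>R (matrix_inv S *v \<theta>)"
    by (simp add: u_def matrix_vector_mult_diff_distrib matrix_vector_mult_scaleR matrix_inv_mult_vec[OF d])
  moreover have "(S *v \<theta>) \<bullet> (matrix_inv S *v \<theta>) = 1"
    using symmetric_inner[OF sym, of \<theta> "matrix_inv S *v \<theta>"] assms(2)
    by (simp add: matrix_inv_mult_vec[OF d] norm_eq_1)
  ultimately have e: "u \<bullet> (matrix_inv S *v u) =
      \<theta> \<bullet> (S *v \<theta>) - 2 * ?l + ?l * ?l * (\<theta> \<bullet> (matrix_inv S *v \<theta>))"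
    using assms(2) by (simp add: u_def inner_diff_left inner_diff_right norm_eq_1 inner_commute algebra_simps)
  show ?thesis unfolding anderson_of_def e using l by (simp add: field_simps del: One_nat_def)
qed

lemma anderson_of_tendsto:
  fixes S :: "nat \<Rightarrow> real^'n^'n"
  assumes \<theta>: "norm \<theta> = 1" and a: "0 \<le> a"
    and sym: "\<And>k. transpose (S k) = S k"
    and S: "S \<longlonglongrightarrow> spike \<theta> a"
    and U: "(\<lambda>k. s k *\<^sub>R (S k *v \<theta> - rayleigh_max (S k) *\<^sub>R \<theta>)) \<longlonglongrightarrow> U"
  shows "(\<lambda>k. anderson_of ((s k)\<^sup>2) \<theta> (S k)) \<longlonglongrightarrow> (U \<bullet> (matrix_inv (spike \<theta> a) *v U)) / (1 + a)"
proof -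
  note l = eigval_1_eq_rayleigh_max[OF sym]
  have lam: "(\<lambda>k. eigval (S k) 1) \<longlonglongrightarrow> 1 + a"
    using tendsto_rayleigh_max[OF S] rayleigh_max_spike[OF \<theta> a] unfolding l by simp
  let ?u = "\<lambda>k. s k *\<^sub>R (S k *v \<theta> - eigval (S k) 1 *\<^sub>R \<theta>)"
  have U': "?u \<longlonglongrightarrow> U" using U unfolding l .
  note inv = tendsto_matrix_inv_vec[OF S U' det_spike[OF \<theta> a]]
  have "eventually (\<lambda>k. eigval (S k) 1 \<noteq> 0) sequentially"
    using lam a by (intro tendsto_imp_eventually_ne) auto
  then have ev: "eventually (\<lambda>k. (?u k \<bullet> (matrix_inv (S k) *v ?u k)) / eigval (S k) 1
      = anderson_of ((s k)\<^sup>2) \<theta> (S k)) sequentially"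
    using inv(2)
  proof eventually_elim
    case (elim k)
    then show ?case using anderson_of_quadratic[OF sym \<theta>, of k "(s k)\<^sup>2"]
      by (simp add: matrix_vector_mult_scaleR power2_eq_square)
  qed
  have "(\<lambda>k. (?u k \<bullet> (matrix_inv (S k) *v ?u k)) / eigval (S k) 1) \<longlonglongrightarrow>
     (U \<bullet> (matrix_inv (spike \<theta> a) *v U)) / (1 + a)"
    using a by (intro tendsto_divide tendsto_inner U' inv lam) auto
  then show ?thesis by (rule Lim_transform_eventually[OF _ ev])
qed

definition perp_comp :: "real^'n \<Rightarrow> real^'n \<Rightarrow> real^'n" where
  "perp_comp \<theta> x = x - (\<theta> \<bullet> x) *\<^sub>R \<theta>"

text \<open>If \<open>C\<close> is the sample covariance matrix of whitened observations, this is the one of the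
  observations themselves, whose covariance matrix is \<open>I + \<rho> \<theta> \<theta>'\<close>.\<close>

definition spiked_cov :: "real^'n \<Rightarrow> real \<Rightarrow> real^'n^'n \<Rightarrow> real^'n^'n" where
  "spiked_cov \<theta> \<rho> C = spike \<theta> (sqrt (1 + \<rho>) - 1) ** C ** spike \<theta> (sqrt (1 + \<rho>) - 1)"

lemma transpose_spiked_cov: "transpose C = C \<Longrightarrow> transpose (spiked_cov \<theta> \<rho> C) = spiked_cov \<theta> \<rho> C"
  by (simp add: spiked_cov_def matrix_transpose_mul transpose_spike matrix_mul_assoc)

lemma spike_sqrt_square:
  assumes "norm \<theta> = 1" "0 \<le> \<rho>"
  shows "spike \<theta> (sqrt (1 + \<rho>) - 1) ** spike \<theta> (sqrt (1 + \<rho>) - 1) = spike \<theta> \<rho>"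
  using assms by (simp add: spike_mult algebra_simps)

lemma tendsto_spike: "(a \<longlongrightarrow> a') F \<Longrightarrow> ((\<lambda>k. spike \<theta> (a k)) \<longlongrightarrow> spike \<theta> a') F"
  unfolding spike_def by (intro tendsto_intros)

lemma spiked_cov_split:
  assumes "norm \<theta> = 1" "0 \<le> \<rho>"
  shows "spiked_cov \<theta> \<rho> (mat 1 + c *\<^sub>R G) = spike \<theta> \<rho> + c *\<^sub>R spiked_cov \<theta> \<rho> G"
proof -
  let ?T = "spike \<theta> (sqrt (1 + \<rho>) - 1)"
  have "?T ** (mat 1 + c *\<^sub>R G) ** ?T = ?T ** ?T + c *\<^sub>R (?T ** G ** ?T)"
    by (intro matrix_eq_vecI) (simp add: matrix_vector_mul_assoc[symmetric] matrix_vector_mult_add_rdistrib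
      matrix_vector_right_distrib scaleR_matrix_vector_assoc[symmetric] matrix_vector_mult_scaleR)
  then show ?thesis by (simp add: spiked_cov_def spike_sqrt_square assms)
qed

text \<open>The statistic for sample size \<open>s\<^sup>2\<close>, as a function of the normalised error \<open>g = s (C - I)\<close> of the
  sample covariance matrix \<open>C\<close> of the whitened observations.\<close>

definition rescaled_stat :: "real^'n \<Rightarrow> real \<Rightarrow> real \<Rightarrow> real^'n^'n \<Rightarrow> real" where
  "rescaled_stat \<theta> \<rho> s g = anderson_of (s\<^sup>2) \<theta> (spiked_cov \<theta> \<rho> (mat 1 + (1 / s) *\<^sub>R g))"

text \<open>When \<open>s \<rho>\<close> stays bounded, spike and sampling error are of the same order: \<open>s (S - I)\<close> converges
  to \<open>W\<close>. The largest eigenvalue is compatible with the affine map \<open>W \<mapsto> I + W / s\<close>, so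
  \<open>s (S - l) \<theta>\<close> converges to \<open>W \<theta>\<close> minus \<open>\<theta>\<close> times the largest eigenvalue of \<open>W\<close>, while \<open>S\<close> and \<open>l\<close>
  tend to \<open>I\<close> and \<open>1\<close>.\<close>

theorem anderson_limit_weak_spike:
  assumes \<theta>: "norm \<theta> = 1" and \<rho>: "\<And>k. 0 \<le> \<rho> k"
    and s: "\<And>k. 0 < s k" "filterlim s at_top sequentially"
    and c: "(\<lambda>k. s k * \<rho> k) \<longlonglongrightarrow> c"
    and sym: "\<And>k. transpose (g k) = g k" and g: "g \<longlonglongrightarrow> g'"
  defines "W \<equiv> g' + c *\<^sub>R outer_prod \<theta> \<theta>"
  shows "(\<lambda>k. rescaled_stat \<theta> (\<rho> k) (s k) (g k)) \<longlonglongrightarrow> (norm (W *v \<theta> - rayleigh_max W *\<^sub>R \<theta>))\<^sup>2"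
proof -
  let ?S = "\<lambda>k. spiked_cov \<theta> (\<rho> k) (mat 1 + (1 / s k) *\<^sub>R g k)"
  let ?W = "\<lambda>k. spiked_cov \<theta> (\<rho> k) (g k) + (s k * \<rho> k) *\<^sub>R outer_prod \<theta> \<theta>"
  have is0: "(\<lambda>k. 1 / s k) \<longlonglongrightarrow> 0"
    using s(2) by (intro tendsto_divide_0[OF tendsto_const] filterlim_at_top_imp_at_infinity)
  have "(\<lambda>k. (1 / s k) * (s k * \<rho> k)) \<longlonglongrightarrow> 0 * c" by (intro tendsto_mult is0 c)
  moreover have "(1 / s k) * (s k * \<rho> k) = \<rho> k" for k using s(1)[of k] by simp
  ultimately have \<rho>0: "\<rho> \<longlonglongrightarrow> 0" by simp
  have "(\<lambda>k. sqrt (1 + \<rho> k) - 1) \<longlonglongrightarrow> sqrt (1 + 0) - 1" by (intro tendsto_intros \<rho>0)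
  then have T: "(\<lambda>k. spike \<theta> (sqrt (1 + \<rho> k) - 1)) \<longlonglongrightarrow> spike \<theta> 0" by (intro tendsto_spike) simp
  have "(\<lambda>k. spiked_cov \<theta> (\<rho> k) (g k)) \<longlonglongrightarrow> spike \<theta> 0 ** g' ** spike \<theta> 0"
    unfolding spiked_cov_def by (intro tendsto_intros T g)
  then have Tg: "(\<lambda>k. spiked_cov \<theta> (\<rho> k) (g k)) \<longlonglongrightarrow> g'" by (simp add: spike_def)
  have W: "?W \<longlonglongrightarrow> W" unfolding W_def by (intro tendsto_intros Tg c)
  have SW: "?S k = (1 / s k) *\<^sub>R ?W k + 1 *\<^sub>R mat 1" for k
    using s(1)[of k] by (simp add: spiked_cov_split \<theta> \<rho> scaleR_add_right) (simp add: spike_def)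
  have "(\<lambda>k. (1 / s k) *\<^sub>R ?W k + 1 *\<^sub>R mat 1) \<longlonglongrightarrow> 0 *\<^sub>R W + 1 *\<^sub>R mat 1"
    by (intro tendsto_intros is0 W)
  then have S: "?S \<longlonglongrightarrow> spike \<theta> 0" by (simp add: SW spike_def)
  have lam: "rayleigh_max (?S k) = (1 / s k) * rayleigh_max (?W k) + 1" for k
    unfolding SW using s(1)[of k] by (intro rayleigh_max_affine) auto
  have u: "s k *\<^sub>R (?S k *v \<theta> - rayleigh_max (?S k) *\<^sub>R \<theta>) = ?W k *v \<theta> - rayleigh_max (?W k) *\<^sub>R \<theta>" for k
    unfolding lam unfolding SW using s(1)[of k]
    by (simp add: matrix_vector_mult_add_rdistrib scaleR_matrix_vector_assoc[symmetric] algebra_simps)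
  have "(\<lambda>k. s k *\<^sub>R (?S k *v \<theta> - rayleigh_max (?S k) *\<^sub>R \<theta>)) \<longlonglongrightarrow> W *v \<theta> - rayleigh_max W *\<^sub>R \<theta>"
    unfolding u by (intro tendsto_intros W tendsto_rayleigh_max)
  from anderson_of_tendsto[OF \<theta> order.refl _ S this]
  have "(\<lambda>k. anderson_of ((s k)\<^sup>2) \<theta> (?S k)) \<longlonglongrightarrow>
    ((W *v \<theta> - rayleigh_max W *\<^sub>R \<theta>) \<bullet> (matrix_inv (spike \<theta> 0) *v (W *v \<theta> - rayleigh_max W *\<^sub>R \<theta>))) / (1 + 0)"
    by (auto simp: transpose_spiked_cov transpose_add transpose_scaleR sym)
  moreover have "matrix_inv (spike \<theta> 0) *v x = x" for x
    using matrix_inv_mult_vec(2)[OF det_spike[OF \<theta> order.refl], of x] by (simp add: spike_def)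
  ultimately show ?thesis by (simp add: power2_norm_eq_inner rescaled_stat_def)
qed

lemma parabola_bound: "0 < d \<Longrightarrow> 2 * y * b - y\<^sup>2 * d \<le> b\<^sup>2 / (d::real)"
proof -
  assume d: "0 < d"
  have "0 \<le> (y * d - b)\<^sup>2 / d" using d by simp
  also have "\<dots> = y\<^sup>2 * d - 2 * y * b + b\<^sup>2 / d" using d by (simp add: power2_eq_square field_simps)
  finally show ?thesis by simp
qed

text \<open>Write a unit vector as \<open>c \<theta> + y\<close> with \<open>y\<close> orthogonal to \<open>\<theta>\<close>. The quadratic form is \<open>a c\<^sup>2\<close>, plus
  a cross term of order \<open>\<bar>y\<bar> / s\<close>, plus at most \<open>(1 + \<bar>g\<bar> / s) \<bar>y\<bar>\<^sup>2\<close>. Since \<open>c\<^sup>2 = 1 - \<bar>y\<bar>\<^sup>2\<close>, this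
  is bounded by a downward parabola in \<open>\<bar>y\<bar>\<close>, whose maximum exceeds \<open>a\<close> by a quantity of order
  \<open>1 / s\<^sup>2\<close> divided by the gap.\<close>

lemma rayleigh_max_spiked_cov_le:
  fixes g :: "real^'n^'n"
  assumes \<theta>: "norm \<theta> = 1" and \<rho>: "0 \<le> \<rho>" and s: "0 < s" and sym: "transpose g = g"
  defines "a \<equiv> (1 + \<rho>) * (1 + (\<theta> \<bullet> (g *v \<theta>)) / s)"
  assumes gap: "0 < a - 1 - norm g / s"
  shows "rayleigh_max (spiked_cov \<theta> \<rho> (mat 1 + (1 / s) *\<^sub>R g))
     \<le> a + (sqrt (1 + \<rho>) * norm g / s)\<^sup>2 / (a - 1 - norm g / s)"
proof (rule rayleigh_max_least)
  fix x :: "real^'n" assume x: "norm x = 1"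
  let ?T = "spike \<theta> (sqrt (1 + \<rho>) - 1)" and ?q = "sqrt (1 + \<rho>)"
  have tt: "\<theta> \<bullet> \<theta> = 1" using \<theta> by (simp add: norm_eq_1)
  have q0: "0 \<le> ?q" using \<rho> by simp
  have qq: "?q * ?q = 1 + \<rho>" using \<rho> by simp
  define c where "c = \<theta> \<bullet> x"
  define y where "y = x - c *\<^sub>R \<theta>"
  have xy: "x = c *\<^sub>R \<theta> + y" by (simp add: y_def)
  have ty: "\<theta> \<bullet> y = 0" by (simp add: y_def inner_diff_right c_def tt)
  have Tx: "?T *v x = (?q * c) *\<^sub>R \<theta> + y"
    by (simp add: spike_vec c_def[symmetric]) (simp add: xy algebra_simps)
  have "c * c + y \<bullet> y = 1"
    using x ty tt by (simp add: norm_eq_1 xy inner_add_left inner_add_right inner_commute)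
  then have c2: "c\<^sup>2 = 1 - (norm y)\<^sup>2"
    by (simp add: power2_norm_eq_inner power2_eq_square[of c])
  have c1: "\<bar>c\<bar> \<le> 1"
    using c2 by (simp add: abs_square_le_1[symmetric])
  have gy: "y \<bullet> (g *v y) \<le> norm g * (norm y)\<^sup>2" using rayleigh_bound[of y g] by simp
  have "\<bar>y \<bullet> (g *v \<theta>)\<bar> \<le> norm y * norm (g *v \<theta>)" by (rule Cauchy_Schwarz_ineq2)
  also have "\<dots> \<le> norm y * (norm g * 1)"
    using norm_matrix_vector_le[of g \<theta>] \<theta> by (intro mult_left_mono) auto
  finally have gyt: "\<bar>y \<bullet> (g *v \<theta>)\<bar> \<le> norm y * norm g" by simp
  have "c * (y \<bullet> (g *v \<theta>)) \<le> \<bar>c\<bar> * \<bar>y \<bullet> (g *v \<theta>)\<bar>" by (simp add: abs_mult[symmetric])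
  also have "\<dots> \<le> 1 * (norm y * norm g)" by (intro mult_mono c1 gyt) auto
  finally have cross: "c * (y \<bullet> (g *v \<theta>)) \<le> norm y * norm g" by simp
  have "x \<bullet> (spiked_cov \<theta> \<rho> (mat 1 + (1 / s) *\<^sub>R g) *v x)
     = (?T *v x) \<bullet> ((mat 1 + (1 / s) *\<^sub>R g) *v (?T *v x))"
    unfolding spiked_cov_def matrix_vector_mul_assoc[symmetric]
    by (rule symmetric_inner[OF transpose_spike])
  also have "\<dots> = (?T *v x) \<bullet> (?T *v x) + (1 / s) * ((?T *v x) \<bullet> (g *v (?T *v x)))"
    by (simp add: matrix_vector_mult_add_rdistrib scaleR_matrix_vector_assoc[symmetric] inner_add_right)
  also have "(?T *v x) \<bullet> (?T *v x) = (1 + \<rho>) * c\<^sup>2 + (norm y)\<^sup>2"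
    unfolding Tx using ty tt qq by (simp add: inner_add_left inner_add_right inner_commute
        power2_norm_eq_inner power2_eq_square[of c] algebra_simps)
  also have "(?T *v x) \<bullet> (g *v (?T *v x)) = (1 + \<rho>) * c\<^sup>2 * (\<theta> \<bullet> (g *v \<theta>))
      + 2 * ?q * (c * (y \<bullet> (g *v \<theta>))) + y \<bullet> (g *v y)"
  proof -
    have "\<theta> \<bullet> (g *v y) = y \<bullet> (g *v \<theta>)" using symmetric_inner[OF sym, of \<theta> y] by (simp add: inner_commute)
    then have "((r * c) *\<^sub>R \<theta> + y) \<bullet> (g *v ((r * c) *\<^sub>R \<theta> + y)) = r * r * c\<^sup>2 * (\<theta> \<bullet> (g *v \<theta>))
      + 2 * r * (c * (y \<bullet> (g *v \<theta>))) + y \<bullet> (g *v y)" for r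
      by (simp add: matrix_vector_right_distrib matrix_vector_mult_scaleR
         inner_add_left inner_add_right power2_eq_square algebra_simps)
    then show ?thesis unfolding Tx by (simp only: qq)
  qed
  also have "(1 + \<rho>) * c\<^sup>2 + (norm y)\<^sup>2 + (1 / s) * ((1 + \<rho>) * c\<^sup>2 * (\<theta> \<bullet> (g *v \<theta>))
      + 2 * ?q * (c * (y \<bullet> (g *v \<theta>))) + y \<bullet> (g *v y))
    \<le> (1 + \<rho>) * c\<^sup>2 + (norm y)\<^sup>2 + (1 / s) * ((1 + \<rho>) * c\<^sup>2 * (\<theta> \<bullet> (g *v \<theta>))
      + 2 * ?q * (norm y * norm g) + norm g * (norm y)\<^sup>2)"
    using s q0 by (intro add_left_mono mult_left_mono add_mono cross gy order.refl) auto
  also have "\<dots> = a + (2 * norm y * (?q * norm g / s) - (norm y)\<^sup>2 * (a - 1 - norm g / s))"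
    unfolding c2 a_def using s by (simp add: field_simps)
  also have "\<dots> \<le> a + (?q * norm g / s)\<^sup>2 / (a - 1 - norm g / s)"
    by (intro add_left_mono parabola_bound gap)
  finally show "x \<bullet> (spiked_cov \<theta> \<rho> (mat 1 + (1 / s) *\<^sub>R g) *v x)
     \<le> a + (?q * norm g / s)\<^sup>2 / (a - 1 - norm g / s)" .
qed

text \<open>When \<open>s \<rho>\<close> tends to infinity, the spike stands out from the sampling error. The largest
  eigenvalue \<open>l\<close> then differs from \<open>a = \<theta>' S \<theta>\<close> by \<open>o(1 / s)\<close>, because the gap times \<open>s\<close> tends to
  infinity, and \<open>s (S - l) \<theta>\<close> is asymptotically the component of \<open>s S \<theta>\<close> orthogonal to \<open>\<theta>\<close>. On
  that component the limit of \<open>S\<close> acts as the identity, and the factors \<open>1 + \<rho>\<close> cancel.\<close>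

theorem anderson_limit_strong_spike:
  fixes g :: "nat \<Rightarrow> real^'n^'n"
  assumes \<theta>: "norm \<theta> = 1" and \<rho>: "\<And>k. 0 \<le> \<rho> k" "\<rho> \<longlonglongrightarrow> \<rho>'"
    and s: "\<And>k. 0 < s k" "filterlim s at_top sequentially"
    and c: "filterlim (\<lambda>k. s k * \<rho> k) at_top sequentially"
    and sym: "\<And>k. transpose (g k) = g k" and g: "g \<longlonglongrightarrow> g'"
  shows "(\<lambda>k. rescaled_stat \<theta> (\<rho> k) (s k) (g k)) \<longlonglongrightarrow> (norm (perp_comp \<theta> (g' *v \<theta>)))\<^sup>2"
proof -
  let ?S = "\<lambda>k. spiked_cov \<theta> (\<rho> k) (mat 1 + (1 / s k) *\<^sub>R g k)"
  let ?q = "\<lambda>k. sqrt (1 + \<rho> k)"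
  have tt: "\<theta> \<bullet> \<theta> = 1" using \<theta> by (simp add: norm_eq_1)
  have \<rho>': "0 \<le> \<rho>'" using \<rho> by (simp add: LIMSEQ_le_const)
  have qq: "?q k * ?q k = 1 + \<rho> k" for k using \<rho>(1)[of k] by simp
  have is0: "(\<lambda>k. 1 / s k) \<longlonglongrightarrow> 0"
    using s(2) by (intro tendsto_divide_0[OF tendsto_const] filterlim_at_top_imp_at_infinity)
  define a where "a k = (1 + \<rho> k) * (1 + (\<theta> \<bullet> (g k *v \<theta>)) / s k)" for k
  have q: "?q \<longlonglongrightarrow> sqrt (1 + \<rho>')" by (intro tendsto_intros \<rho>)
  have "(\<lambda>k. spike \<theta> (\<rho> k) + (1 / s k) *\<^sub>R spiked_cov \<theta> (\<rho> k) (g k))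
     \<longlonglongrightarrow> spike \<theta> \<rho>' + 0 *\<^sub>R spiked_cov \<theta> \<rho>' g'"
    unfolding spiked_cov_def by (intro tendsto_intros tendsto_spike \<rho> is0 g)
  then have S: "?S \<longlonglongrightarrow> spike \<theta> \<rho>'" by (simp add: spiked_cov_split \<theta> \<rho>)
  have T\<theta>: "spike \<theta> (?q k - 1) *v \<theta> = ?q k *\<^sub>R \<theta>" for k
    by (simp add: spike_vec tt algebra_simps)
  have S\<theta>: "?S k *v \<theta> = (1 + \<rho> k) *\<^sub>R \<theta> + (?q k / s k) *\<^sub>R (spike \<theta> (?q k - 1) *v (g k *v \<theta>))" for k
    by (simp add: spiked_cov_split \<theta> \<rho> matrix_vector_mult_add_rdistrib scaleR_matrix_vector_assoc[symmetric])
       (simp add: spiked_cov_def matrix_vector_mul_assoc[symmetric] T\<theta> matrix_vector_mult_scaleR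
          spike_vec[of _ "\<rho> k"] tt algebra_simps)
  have S\<theta>a: "?S k *v \<theta> - a k *\<^sub>R \<theta> = (?q k / s k) *\<^sub>R perp_comp \<theta> (g k *v \<theta>)" for k
  proof -
    have "a k = 1 + \<rho> k + ?q k * ?q k * (\<theta> \<bullet> (g k *v \<theta>)) / s k"
      unfolding a_def qq by (simp add: algebra_simps add_divide_distrib)
    then show ?thesis unfolding S\<theta> by (simp add: perp_comp_def spike_vec algebra_simps)
  qed
  have S\<theta>\<theta>: "\<theta> \<bullet> (?S k *v \<theta>) = a k" for k
  proof -
    have "\<theta> \<bullet> (?S k *v \<theta> - a k *\<^sub>R \<theta>) = 0"
      unfolding S\<theta>a by (simp add: perp_comp_def inner_diff_right tt)
    then show ?thesis by (simp add: inner_diff_right tt)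
  qed
  have lower: "a k \<le> rayleigh_max (?S k)" for k using rayleigh_le[OF \<theta>, of "?S k"] S\<theta>\<theta> by simp
  let ?e = "\<lambda>k. s k * (a k - 1 - norm (g k) / s k)"
  have e: "filterlim ?e at_top sequentially"
  proof -
    have eq: "?e = (\<lambda>k. ((1 + \<rho> k) * (\<theta> \<bullet> (g k *v \<theta>)) - norm (g k)) + s k * \<rho> k)"
      using s(1) by (auto simp: a_def field_simps fun_eq_iff less_imp_neq[symmetric])
    have "(\<lambda>k. (1 + \<rho> k) * (\<theta> \<bullet> (g k *v \<theta>)) - norm (g k)) \<longlonglongrightarrow> (1 + \<rho>') * (\<theta> \<bullet> (g' *v \<theta>)) - norm g'"
      by (intro tendsto_intros \<rho> g)
    then show ?thesis unfolding eq by (rule filterlim_tendsto_add_at_top[OF _ c])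
  qed
  have upper: "eventually (\<lambda>k. s k * (rayleigh_max (?S k) - a k) \<le> (?q k * norm (g k))\<^sup>2 / ?e k) sequentially"
    using e[unfolded filterlim_at_top_dense, rule_format, of 0]
  proof eventually_elim
    case (elim k)
    then have gap: "0 < a k - 1 - norm (g k) / s k" using s(1)[of k] by (simp add: zero_less_mult_iff)
    from rayleigh_max_spiked_cov_le[OF \<theta> \<rho>(1) s(1) sym, of k k k, folded a_def, OF gap]
    have "s k * (rayleigh_max (?S k) - a k) \<le> s k * ((?q k * norm (g k) / s k)\<^sup>2 / (a k - 1 - norm (g k) / s k))"
      using s(1)[of k] by (intro mult_left_mono) auto
    also have "\<dots> = (?q k * norm (g k))\<^sup>2 / ?e k"
      using s(1)[of k] gap by (simp add: power2_eq_square)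
    finally show ?case .
  qed
  have e0: "(\<lambda>k. (?q k * norm (g k))\<^sup>2 / ?e k) \<longlonglongrightarrow> 0"
    by (rule tendsto_divide_0[OF tendsto_power[OF tendsto_mult[OF q tendsto_norm[OF g]]]
          filterlim_at_top_imp_at_infinity[OF e]])
  have d0: "(\<lambda>k. s k * (rayleigh_max (?S k) - a k)) \<longlonglongrightarrow> 0"
    by (rule tendsto_sandwich[OF _ upper tendsto_const e0])
       (use lower less_imp_le[OF s(1)] in \<open>auto intro!: always_eventually mult_nonneg_nonneg\<close>)
  have u: "s k *\<^sub>R (?S k *v \<theta> - rayleigh_max (?S k) *\<^sub>R \<theta>)
      = ?q k *\<^sub>R perp_comp \<theta> (g k *v \<theta>) - (s k * (rayleigh_max (?S k) - a k)) *\<^sub>R \<theta>" for k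
  proof -
    have "s k *\<^sub>R (?S k *v \<theta> - rayleigh_max (?S k) *\<^sub>R \<theta>)
       = s k *\<^sub>R (?S k *v \<theta> - a k *\<^sub>R \<theta>) - (s k * (rayleigh_max (?S k) - a k)) *\<^sub>R \<theta>"
      by (simp add: algebra_simps)
    then show ?thesis unfolding S\<theta>a using s(1)[of k] by simp
  qed
  define U where "U = sqrt (1 + \<rho>') *\<^sub>R perp_comp \<theta> (g' *v \<theta>)"
  have "(\<lambda>k. s k *\<^sub>R (?S k *v \<theta> - rayleigh_max (?S k) *\<^sub>R \<theta>)) \<longlonglongrightarrow> U - 0 *\<^sub>R \<theta>"
    unfolding u U_def perp_comp_def by (intro tendsto_intros q g d0)
  then have "(\<lambda>k. anderson_of ((s k)\<^sup>2) \<theta> (?S k)) \<longlonglongrightarrow> (U \<bullet> (matrix_inv (spike \<theta> \<rho>') *v U)) / (1 + \<rho>')"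
    by (intro anderson_of_tendsto[OF \<theta> \<rho>' _ S])
       (auto simp: transpose_spiked_cov transpose_add transpose_scaleR sym)
  moreover have "matrix_inv (spike \<theta> \<rho>') *v U = U"
  proof -
    have "\<theta> \<bullet> U = 0" by (simp add: U_def perp_comp_def inner_diff_right tt)
    then have "spike \<theta> \<rho>' *v U = U" by (simp add: spike_vec)
    then show ?thesis using matrix_inv_mult_vec(2)[OF det_spike[OF \<theta> \<rho>'], of U] by simp
  qed
  moreover have "U \<bullet> U / (1 + \<rho>') = (norm (perp_comp \<theta> (g' *v \<theta>)))\<^sup>2"
    using \<rho>' by (simp add: U_def power2_norm_eq_inner mult.assoc[symmetric])
  ultimately show ?thesis by (simp add: rescaled_stat_def)
qed

section \<open>Levy's continuity theorem in Euclidean space\<close>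

text \<open>The characteristic function of the random vector \<open>W\<close>.\<close>

definition cf :: "'a measure \<Rightarrow> ('a \<Rightarrow> 'e::euclidean_space) \<Rightarrow> 'e \<Rightarrow> complex" where
  "cf M W t = (CLINT \<omega>|M. iexp (t \<bullet> W \<omega>))"

lemma char_distr_inner:
  assumes [measurable]: "W \<in> borel_measurable M"
  shows "char (distr M borel (\<lambda>\<omega>. t \<bullet> W \<omega>)) s = cf M W (s *\<^sub>R t)"
  by (simp add: char_def integral_distr cf_def)

inductive trig_poly :: "('e::euclidean_space \<Rightarrow> complex) \<Rightarrow> bool" where
  exp: "trig_poly (\<lambda>x. c * iexp (t \<bullet> x))"
| add: "trig_poly f \<Longrightarrow> trig_poly g \<Longrightarrow> trig_poly (\<lambda>x. f x + g x)"

lemma trig_poly_const: "trig_poly (\<lambda>x. c)"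
  using trig_poly.exp[of c 0] by simp

lemma trig_poly_sum: "finite I \<Longrightarrow> (\<And>i. i \<in> I \<Longrightarrow> trig_poly (f i)) \<Longrightarrow> trig_poly (\<lambda>x. \<Sum>i\<in>I. f i x)"
  by (induction I rule: finite_induct) (auto intro: trig_poly_const trig_poly.add)

lemma trig_poly_exp_mult: "trig_poly g \<Longrightarrow> trig_poly (\<lambda>x. c * iexp (t \<bullet> x) * g x)"
proof (induction rule: trig_poly.induct)
  case (exp d u)
  have "(\<lambda>x. c * iexp (t \<bullet> x) * (d * iexp (u \<bullet> x))) = (\<lambda>x. c * d * iexp ((t + u) \<bullet> x))"
    by (simp add: fun_eq_iff inner_add_left distrib_left exp_add)
  then show ?case by (simp only: trig_poly.exp)
next
  case (add f g)
  then show ?case by (simp only: distrib_left trig_poly.add)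
qed

lemma trig_poly_mult: "trig_poly f \<Longrightarrow> trig_poly g \<Longrightarrow> trig_poly (\<lambda>x. f x * g x)"
  by (induction rule: trig_poly.induct) (simp_all only: trig_poly_exp_mult distrib_right trig_poly.add)

lemma trig_poly_sin: "trig_poly (\<lambda>x. complex_of_real (sin (t \<bullet> x)))"
proof -
  have "complex_of_real (sin (t \<bullet> x)) = (- \<i> / 2) * iexp (t \<bullet> x) + (\<i> / 2) * iexp ((- t) \<bullet> x)" for x
    by (simp add: sin_of_real[symmetric] sin_exp_eq field_simps)
  then show ?thesis using trig_poly.add[OF trig_poly.exp[of "- \<i> / 2" t] trig_poly.exp[of "\<i> / 2" "- t"]]
    by simp
qed

lemma trig_poly_continuous: "trig_poly f \<Longrightarrow> continuous_on UNIV f"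
  by (induction rule: trig_poly.induct) (auto intro!: continuous_intros)

lemma trig_poly_of_polynomial:
  fixes q :: "'e::euclidean_space \<Rightarrow> real"
  assumes "real_polynomial_function q"
  shows "trig_poly (\<lambda>x. complex_of_real (q (\<Sum>b\<in>Basis. sin (c * (x \<bullet> b)) *\<^sub>R b)))"
  using assms
proof (induction rule: real_polynomial_function.induct)
  case (linear q)
  then interpret bounded_linear q .
  have "(\<lambda>x. complex_of_real (q (\<Sum>b\<in>Basis. sin (c * (x \<bullet> b)) *\<^sub>R b)))
      = (\<lambda>x. \<Sum>b\<in>Basis. complex_of_real (sin ((c *\<^sub>R b) \<bullet> x)) * complex_of_real (q b))"
    by (simp add: sum scaleR inner_commute)
  then show ?case
    by (simp only:) (intro trig_poly_sum trig_poly_mult trig_poly_sin trig_poly_const finite_Basis)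
next
  case (const c) show ?case by (rule trig_poly_const)
next
  case (add f g) then show ?case by (simp add: trig_poly.add)
next
  case (mult f g) then show ?case by (simp add: trig_poly_mult)
qed

abbreviation cube :: "real \<Rightarrow> 'e::euclidean_space set" where
  "cube R \<equiv> cbox (- (R *\<^sub>R One)) (R *\<^sub>R One)"

text \<open>A bounded continuous majorant of the indicator of the complement of a cube. It is a sum over
  coordinates, so that one-dimensional limit theorems apply to its expectation.\<close>

definition tail_fn :: "real \<Rightarrow> 'e::euclidean_space \<Rightarrow> real" where
  "tail_fn R x = (\<Sum>b\<in>Basis. min 1 (max 0 (\<bar>x \<bullet> b\<bar> - R)))"

lemma tail_fn_nonneg: "0 \<le> tail_fn R x" by (simp add: tail_fn_def sum_nonneg)

lemma tail_fn_ge_1: "x \<notin> cube (R + 1) \<Longrightarrow> 1 \<le> tail_fn R x"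
proof -
  assume "x \<notin> cube (R + 1)"
  then obtain b where b: "b \<in> Basis" "\<bar>x \<bullet> b\<bar> > R + 1" by (auto simp: mem_box abs_le_iff not_le)
  have "min 1 (max 0 (\<bar>x \<bullet> b\<bar> - R)) \<le> tail_fn R x"
    unfolding tail_fn_def using b by (intro member_le_sum) auto
  then show ?thesis using b by simp
qed

lemma tail_fn_le: "\<bar>tail_fn R (x::'e::euclidean_space)\<bar> \<le> DIM('e)"
  using sum_bounded_above[of "Basis::'e set" "\<lambda>b. min 1 (max 0 (\<bar>x \<bullet> b\<bar> - R))" 1] tail_fn_nonneg[of R x]
  by (simp add: tail_fn_def)

lemma tail_fn_measurable [measurable]: "tail_fn R \<in> borel_measurable borel"
  unfolding tail_fn_def by measurable

text \<open>The map that sends each coordinate \<open>x\<close> to \<open>sin (c x)\<close> is a homeomorphism of a cube onto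
  \<open>[-1, 1]\<^sup>d\<close>, so by Stone and Weierstrass some polynomial \<open>T\<close> in the sines is close to \<open>f\<close> on that
  cube. The sines take no other values outside the cube, so \<open>T\<close> obeys the same bound everywhere and
  the error off the cube is controlled by the tail function alone.\<close>

lemma sine_approximation:
  fixes f :: "'e::euclidean_space \<Rightarrow> real"
  assumes f: "continuous_on UNIV f" "\<And>x. \<bar>f x\<bar> \<le> B" and R: "0 \<le> R" and \<epsilon>: "0 < \<epsilon>"
  obtains T where "trig_poly (\<lambda>x. complex_of_real (T x))" "\<And>x. \<bar>f x - T x\<bar> \<le> \<epsilon> + (2 * B + \<epsilon>) * tail_fn R x"
    "\<And>x. \<bar>T x\<bar> \<le> B + \<epsilon>"
proof -
  \<comment> \<open>With this \<open>c\<close> the cube of radius \<open>R + 1\<close> is mapped to \<open>[-pi/2, pi/2]\<close>, where \<open>arcsin\<close> inverts \<open>sin\<close>.\<close>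
  define c where "c = pi / (2 * (R + 1))"
  have c: "0 < c" "c * (R + 1) = pi / 2" using R by (auto simp: c_def field_simps)
  define S where "S x = (\<Sum>b\<in>Basis. sin (c * (x \<bullet> b)) *\<^sub>R b)" for x :: 'e
  define A where "A y = (\<Sum>b\<in>Basis. (arcsin (y \<bullet> b) / c) *\<^sub>R b)" for y :: 'e
  let ?K = "cbox (- One) One :: 'e set"
  have SK: "S x \<in> ?K" for x by (auto simp: mem_box S_def)
  have AS: "A (S x) = x" if "x \<in> cube (R + 1)" for x
  proof (rule euclidean_eqI)
    fix b :: 'e assume b: "b \<in> Basis"
    have "\<bar>x \<bullet> b\<bar> \<le> R + 1" using that b by (auto simp: mem_box abs_le_iff)
    then have "c * \<bar>x \<bullet> b\<bar> \<le> c * (R + 1)" using c by (intro mult_left_mono) auto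
    then have "\<bar>c * (x \<bullet> b)\<bar> \<le> pi / 2" by (simp only: c(2) abs_mult abs_of_pos[OF c(1)])
    then have "arcsin (sin (c * (x \<bullet> b))) = c * (x \<bullet> b)" by (intro arcsin_sin) auto
    then show "A (S x) \<bullet> b = x \<bullet> b" using b c by (simp add: A_def S_def)
  qed
  have "continuous_on ?K A"
    unfolding A_def by (intro continuous_intros) (use c in \<open>auto simp: mem_box\<close>)
  then have "continuous_on ?K (\<lambda>y. f (A y))"
    by (rule continuous_on_compose2[OF f(1)]) auto
  then obtain q where q: "real_polynomial_function q" "\<And>y. y \<in> ?K \<Longrightarrow> \<bar>f (A y) - q y\<bar> < \<epsilon>"
    using Stone_Weierstrass_real_polynomial_function[OF compact_cbox _ \<epsilon>] by blast
  have bd: "\<bar>q (S x)\<bar> \<le> B + \<epsilon>" for x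
    using q(2)[OF SK, of x] f(2)[of "A (S x)"] by linarith
  show ?thesis
  proof (rule that[of "\<lambda>x. q (S x)"])
    show "trig_poly (\<lambda>x. complex_of_real (q (S x)))"
      unfolding S_def by (rule trig_poly_of_polynomial[OF q(1)])
    show "\<bar>f x - q (S x)\<bar> \<le> \<epsilon> + (2 * B + \<epsilon>) * tail_fn R x" for x
    proof (cases "x \<in> cube (R + 1)")
      case True
      then have "\<bar>f x - q (S x)\<bar> < \<epsilon>" using q(2)[OF SK, of x] AS by simp
      moreover have "0 \<le> (2 * B + \<epsilon>) * tail_fn R x"
        using f(2)[of x] \<epsilon> by (intro mult_nonneg_nonneg tail_fn_nonneg) auto
      ultimately show ?thesis by simp
    next
      case False
      have "\<bar>f x - q (S x)\<bar> \<le> 2 * B + \<epsilon>" using f(2)[of x] bd[of x] by linarith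
      also have "\<dots> \<le> (2 * B + \<epsilon>) * tail_fn R x"
        using tail_fn_ge_1[OF False] f(2)[of x] \<epsilon> by (simp add: mult_le_cancel_left1)
      finally show ?thesis using \<epsilon> by simp
    qed
  qed (rule bd)
qed

locale cf_limit =
  fixes M :: "nat \<Rightarrow> 'a measure" and W :: "nat \<Rightarrow> 'a \<Rightarrow> 'e::euclidean_space"
    and N :: "'b measure" and V :: "'b \<Rightarrow> 'e"
  assumes prob_M: "\<And>n. prob_space (M n)" and prob_N: "prob_space N"
    and W_meas [measurable]: "\<And>n. W n \<in> borel_measurable (M n)"
    and V_meas [measurable]: "V \<in> borel_measurable N"
    and cf_conv: "\<And>t. (\<lambda>n. cf (M n) (W n) t) \<longlonglongrightarrow> cf N V t"
begin

sublocale M: prob_space "M n" for n by (rule prob_M)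
sublocale N: prob_space N by (rule prob_N)

lemma integrable_bounded:
  fixes f :: "'e \<Rightarrow> 'c::{banach, second_countable_topology}"
  assumes [measurable]: "f \<in> borel_measurable borel" and "\<And>x. norm (f x) \<le> B"
  shows "integrable (M n) (\<lambda>\<omega>. f (W n \<omega>))"
    "integrable N (\<lambda>\<omega>. f (V \<omega>))"
  using assms(2) by (auto intro!: M.integrable_const_bound[where B=B] N.integrable_const_bound[where B=B])

lemma trig_poly_limit:
  assumes "trig_poly f"
  shows "(\<lambda>n. CLINT \<omega>|M n. f (W n \<omega>)) \<longlonglongrightarrow> (CLINT \<omega>|N. f (V \<omega>))"
    and "integrable (M n) (\<lambda>\<omega>. f (W n \<omega>))" "integrable N (\<lambda>\<omega>. f (V \<omega>))"
proof -
  have "((\<lambda>n. CLINT \<omega>|M n. f (W n \<omega>)) \<longlonglongrightarrow> (CLINT \<omega>|N. f (V \<omega>))) \<and>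
     (\<forall>n. integrable (M n) (\<lambda>\<omega>. f (W n \<omega>))) \<and> integrable N (\<lambda>\<omega>. f (V \<omega>))"
    using assms
  proof (induction rule: trig_poly.induct)
    case (exp c t)
    have "integrable (M n) (\<lambda>\<omega>. iexp (t \<bullet> W n \<omega>))" for n
      by (rule integrable_bounded(1)[of "\<lambda>x. iexp (t \<bullet> x)" 1]) auto
    moreover have "integrable N (\<lambda>\<omega>. iexp (t \<bullet> V \<omega>))"
      by (rule integrable_bounded(2)[of "\<lambda>x. iexp (t \<bullet> x)" 1]) auto
    ultimately show ?case using cf_conv[of t] by (auto intro!: tendsto_mult simp: cf_def)
  next
    case (add f g)
    then show ?case by (auto intro!: tendsto_add)
  qed
  then show "(\<lambda>n. CLINT \<omega>|M n. f (W n \<omega>)) \<longlonglongrightarrow> (CLINT \<omega>|N. f (V \<omega>))"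
    "integrable (M n) (\<lambda>\<omega>. f (W n \<omega>))" "integrable N (\<lambda>\<omega>. f (V \<omega>))" by auto
qed

lemma tail_fn_limit:
  "(\<lambda>n. \<integral>\<omega>. tail_fn R (W n \<omega>) \<partial>M n) \<longlonglongrightarrow> (\<integral>\<omega>. tail_fn R (V \<omega>) \<partial>N)"
proof -
  let ?\<psi> = "\<lambda>x::real. min 1 (max 0 (\<bar>x\<bar> - R))"
  have b: "(\<lambda>n. \<integral>\<omega>. ?\<psi> (W n \<omega> \<bullet> b) \<partial>M n) \<longlonglongrightarrow> (\<integral>\<omega>. ?\<psi> (V \<omega> \<bullet> b) \<partial>N)" for b
  proof -
    have wc: "weak_conv_m (\<lambda>n. distr (M n) borel (\<lambda>\<omega>. b \<bullet> W n \<omega>)) (distr N borel (\<lambda>\<omega>. b \<bullet> V \<omega>))"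
      by (rule levy_continuity) (auto simp: char_distr_inner cf_conv intro!: M.real_distribution_distr N.real_distribution_distr)
    have "(\<lambda>n. integral\<^sup>L (distr (M n) borel (\<lambda>\<omega>. b \<bullet> W n \<omega>)) ?\<psi>) \<longlonglongrightarrow> integral\<^sup>L (distr N borel (\<lambda>\<omega>. b \<bullet> V \<omega>)) ?\<psi>"
      by (rule weak_conv_imp_integral_bdd_continuous_conv[OF _ _ wc, where B=1])
         (auto intro!: continuous_intros M.real_distribution_distr N.real_distribution_distr)
    then show ?thesis by (simp add: integral_distr inner_commute)
  qed
  have i: "integrable (M n) (\<lambda>\<omega>. ?\<psi> (W n \<omega> \<bullet> b))" "integrable N (\<lambda>\<omega>. ?\<psi> (V \<omega> \<bullet> b))" for n b
    by (auto intro!: integrable_bounded[of "\<lambda>x. ?\<psi> (x \<bullet> b)" 1])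
  show ?thesis unfolding tail_fn_def using b by (simp add: i tendsto_sum)
qed

text \<open>Tightness of the sequence \<open>W\<close>, obtained from that of the single limit \<open>V\<close>.\<close>

lemma tail_fn_small:
  assumes "0 < \<epsilon>"
  obtains R where "0 \<le> R" "eventually (\<lambda>n. (\<integral>\<omega>. tail_fn R (W n \<omega>) \<partial>M n) < \<epsilon>) sequentially"
    "(\<integral>\<omega>. tail_fn R (V \<omega>) \<partial>N) < \<epsilon>"
proof -
  have "(\<lambda>k. \<integral>\<omega>. tail_fn (real k) (V \<omega>) \<partial>N) \<longlonglongrightarrow> (\<integral>\<omega>. 0 \<partial>N)"
  proof (rule integral_dominated_convergence[where w = "\<lambda>_. DIM('e)"])
    show "AE \<omega> in N. (\<lambda>k. tail_fn (real k) (V \<omega>)) \<longlonglongrightarrow> 0"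
    proof (rule AE_I2, rule tendsto_eventually)
      fix \<omega>
      obtain K :: nat where "norm (V \<omega>) \<le> real K" using real_arch_simple by blast
      then have "\<bar>V \<omega> \<bullet> b\<bar> \<le> real k" if "b \<in> Basis" "k \<ge> K" for b k
        using Basis_le_norm[OF that(1), of "V \<omega>"] that(2) by linarith
      then show "eventually (\<lambda>k. tail_fn (real k) (V \<omega>) = 0) sequentially"
        by (auto simp: eventually_sequentially tail_fn_def intro!: exI[of _ K] sum.neutral)
    qed
  qed (auto simp: tail_fn_le)
  then have "eventually (\<lambda>k. (\<integral>\<omega>. tail_fn (real k) (V \<omega>) \<partial>N) < \<epsilon>) sequentially"
    using assms by (intro order_tendstoD(2)) auto
  then obtain k :: nat where k: "(\<integral>\<omega>. tail_fn (real k) (V \<omega>) \<partial>N) < \<epsilon>"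
    by (auto simp: eventually_sequentially)
  show ?thesis using that[of "real k"] k order_tendstoD(2)[OF tail_fn_limit k] by auto
qed

text \<open>Convergence of characteristic functions means convergence of the expectations of trigonometric
  polynomials, and by tightness every bounded continuous function can be replaced by one of those,
  uniformly in \<open>n\<close>.\<close>

theorem bounded_continuous_limit:
  fixes f :: "'e \<Rightarrow> real"
  assumes f: "continuous_on UNIV f" "\<And>x. \<bar>f x\<bar> \<le> B"
  shows "(\<lambda>n. \<integral>\<omega>. f (W n \<omega>) \<partial>M n) \<longlonglongrightarrow> (\<integral>\<omega>. f (V \<omega>) \<partial>N)"
proof (rule LIMSEQ_I)
  fix e :: real assume e: "0 < e"
  have B: "0 \<le> B" using f(2)[of 0] by simp
  \<comment> \<open>Replacing \<open>f\<close> by \<open>T\<close> costs at most \<open>2 \<epsilon>\<close> on each side, and the limit for \<open>T\<close> costs another \<open>\<epsilon>\<close>.\<close>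
  define \<epsilon> where "\<epsilon> = min 1 (e / 5)"
  have \<epsilon>: "0 < \<epsilon>" "\<epsilon> \<le> e / 5" "\<epsilon> \<le> 1" using e by (auto simp: \<epsilon>_def)
  define \<delta> where "\<delta> = \<epsilon> / (2 * B + \<epsilon>)"
  have \<delta>: "0 < \<delta>" "(2 * B + \<epsilon>) * \<delta> = \<epsilon>" using B \<epsilon> by (auto simp: \<delta>_def)
  obtain R where R: "0 \<le> R" "eventually (\<lambda>n. (\<integral>\<omega>. tail_fn R (W n \<omega>) \<partial>M n) < \<delta>) sequentially"
    "(\<integral>\<omega>. tail_fn R (V \<omega>) \<partial>N) < \<delta>" using tail_fn_small[OF \<delta>(1)] by blast
  obtain T where T: "trig_poly (\<lambda>x. complex_of_real (T x))"
      "\<And>x. \<bar>f x - T x\<bar> \<le> \<epsilon> + (2 * B + \<epsilon>) * tail_fn R x" "\<And>x. \<bar>T x\<bar> \<le> B + \<epsilon>"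
    using sine_approximation[OF f R(1) \<epsilon>(1)] by blast
  have fm [measurable]: "f \<in> borel_measurable borel" using f(1) by (rule borel_measurable_continuous_onI)
  have "continuous_on UNIV (\<lambda>x. Re (complex_of_real (T x)))"
    by (intro continuous_intros trig_poly_continuous T)
  then have "continuous_on UNIV T" by simp
  then have Tm [measurable]: "T \<in> borel_measurable borel" by (rule borel_measurable_continuous_onI)
  have close: "\<bar>(\<integral>\<omega>. f (U \<omega>) \<partial>P) - (\<integral>\<omega>. T (U \<omega>) \<partial>P)\<bar> \<le> 2 * \<epsilon>"
    if P: "prob_space P" and [measurable]: "U \<in> borel_measurable P"
      and s: "(\<integral>\<omega>. tail_fn R (U \<omega>) \<partial>P) < \<delta>" for P :: "'c measure" and U
  proof -
    interpret P: prob_space P by fact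
    have if': "integrable P (\<lambda>\<omega>. f (U \<omega>))" by (rule P.integrable_const_bound[of _ B]) (auto simp: f)
    have iT: "integrable P (\<lambda>\<omega>. T (U \<omega>))" by (rule P.integrable_const_bound[of _ "B + \<epsilon>"]) (auto simp: T)
    have it: "integrable P (\<lambda>\<omega>. tail_fn R (U \<omega>))"
      by (rule P.integrable_const_bound[of _ "DIM('e)"]) (auto simp: tail_fn_le)
    have "\<bar>(\<integral>\<omega>. f (U \<omega>) \<partial>P) - (\<integral>\<omega>. T (U \<omega>) \<partial>P)\<bar> = \<bar>\<integral>\<omega>. f (U \<omega>) - T (U \<omega>) \<partial>P\<bar>"
      by (simp add: if' iT)
    also have "\<dots> \<le> (\<integral>\<omega>. \<bar>f (U \<omega>) - T (U \<omega>)\<bar> \<partial>P)" by (rule integral_abs_bound)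
    also have "\<dots> \<le> (\<integral>\<omega>. \<epsilon> + (2 * B + \<epsilon>) * tail_fn R (U \<omega>) \<partial>P)"
      by (intro integral_mono T Bochner_Integration.integrable_add integrable_mult_right it) (auto simp: if' iT)
    also have "\<dots> = \<epsilon> + (2 * B + \<epsilon>) * (\<integral>\<omega>. tail_fn R (U \<omega>) \<partial>P)"
      by (simp add: it P.prob_space)
    also have "\<dots> \<le> \<epsilon> + (2 * B + \<epsilon>) * \<delta>" using B \<epsilon> s by (intro add_left_mono mult_left_mono) auto
    finally show ?thesis using \<delta> by simp
  qed
  have "(\<lambda>n. \<integral>\<omega>. T (W n \<omega>) \<partial>M n) \<longlonglongrightarrow> (\<integral>\<omega>. T (V \<omega>) \<partial>N)"
    using trig_poly_limit(1)[OF T(1)] by (simp add: tendsto_of_real_iff)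
  then have "eventually (\<lambda>n. \<bar>(\<integral>\<omega>. T (W n \<omega>) \<partial>M n) - (\<integral>\<omega>. T (V \<omega>) \<partial>N)\<bar> < \<epsilon>) sequentially"
    using \<epsilon>(1) by (auto dest!: tendstoD simp: dist_real_def)
  with R(2) have "eventually (\<lambda>n. norm ((\<integral>\<omega>. f (W n \<omega>) \<partial>M n) - (\<integral>\<omega>. f (V \<omega>) \<partial>N)) < e) sequentially"
  proof eventually_elim
    case (elim n)
    have "\<bar>(\<integral>\<omega>. f (W n \<omega>) \<partial>M n) - (\<integral>\<omega>. T (W n \<omega>) \<partial>M n)\<bar> \<le> 2 * \<epsilon>"
      using elim by (intro close prob_M) auto
    moreover have "\<bar>(\<integral>\<omega>. f (V \<omega>) \<partial>N) - (\<integral>\<omega>. T (V \<omega>) \<partial>N)\<bar> \<le> 2 * \<epsilon>"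
      using R by (intro close prob_N) auto
    ultimately show ?case using elim \<epsilon> unfolding real_norm_def by linarith
  qed
  then show "\<exists>no. \<forall>n\<ge>no. norm ((\<integral>\<omega>. f (W n \<omega>) \<partial>M n) - (\<integral>\<omega>. f (V \<omega>) \<partial>N)) < e"
    by (simp add: eventually_sequentially)
qed

text \<open>The statistics are images of \<open>W n\<close> under maps \<open>h n\<close> that depend on \<open>n\<close>. The last hypothesis is
  continuous convergence of \<open>h n\<close> to \<open>H\<close> on \<open>C\<close>, along all subsequences; by compactness it is
  uniform on the part of \<open>C\<close> in any cube, and tightness disposes of the remaining mass.\<close>

theorem continuous_mapping:
  fixes H :: "'e \<Rightarrow> real" and h :: "nat \<Rightarrow> 'e \<Rightarrow> real"
  assumes H: "continuous_on UNIV H"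
    and Q: "\<And>n. Q n \<in> borel_measurable (M n)" "\<And>n \<omega>. \<omega> \<in> space (M n) \<Longrightarrow> Q n \<omega> = h n (W n \<omega>)"
    and C: "\<And>n \<omega>. \<omega> \<in> space (M n) \<Longrightarrow> W n \<omega> \<in> C"
    and h: "\<And>\<sigma> g g'. strict_mono (\<sigma> :: nat \<Rightarrow> nat) \<Longrightarrow> (\<And>k. g k \<in> C) \<Longrightarrow> g \<longlonglongrightarrow> g' \<Longrightarrow>
       (\<lambda>k. h (\<sigma> k) (g k)) \<longlonglongrightarrow> H g'"
  shows "weak_conv_m (\<lambda>n. distr (M n) borel (Q n)) (distr N borel (\<lambda>\<omega>. H (V \<omega>)))"
proof (rule integral_cts_step_conv_imp_weak_conv)
  note [measurable] = Q(1)
  have Hm [measurable]: "H \<in> borel_measurable borel" using H by (rule borel_measurable_continuous_onI)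
  show "real_distribution (distr (M n) borel (Q n))" for n by (rule M.real_distribution_distr) simp
  show "real_distribution (distr N borel (\<lambda>\<omega>. H (V \<omega>)))" by (rule N.real_distribution_distr) simp
  fix x y :: real assume xy: "x < y"
  let ?f = "cts_step x y"
  have fu: "uniformly_continuous_on UNIV ?f" using cts_step_uniformly_continuous[OF xy] .
  then have fc: "continuous_on UNIV ?f" by (rule uniformly_continuous_imp_continuous)
  then have [measurable]: "?f \<in> borel_measurable borel" by (rule borel_measurable_continuous_onI)
  have fb: "\<bar>?f z\<bar> \<le> 1" for z using xy by (auto simp: cts_step_def divide_le_eq)
  have fHc: "continuous_on UNIV (\<lambda>z. ?f (H z))" by (rule continuous_on_compose2[OF fc H]) auto
  have "(\<lambda>n. (\<integral>\<omega>. ?f (Q n \<omega>) \<partial>M n) - (\<integral>\<omega>. ?f (H (W n \<omega>)) \<partial>M n)) \<longlonglongrightarrow> 0"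
  proof (rule LIMSEQ_I)
    fix e :: real assume "0 < e"
    then have e: "0 < e / 4" by simp
    obtain R where R: "0 \<le> R" "eventually (\<lambda>n. (\<integral>\<omega>. tail_fn R (W n \<omega>) \<partial>M n) < e / 4) sequentially"
      using tail_fn_small[OF e] by blast
    let ?K = "cube (R + 1) :: 'e set"
    \<comment> \<open>Otherwise there are bad points for infinitely many \<open>n\<close>; along a subsequence they converge in the compact cube, which contradicts the hypothesis on \<open>h\<close>.\<close>
    have "eventually (\<lambda>n. \<forall>g\<in>C \<inter> ?K. \<bar>?f (h n g) - ?f (H g)\<bar> \<le> e / 4) sequentially"
    proof (rule ccontr)
      assume "\<not> ?thesis"
      then have "infinite {n. \<exists>g\<in>C \<inter> ?K. \<bar>?f (h n g) - ?f (H g)\<bar> > e / 4}"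
        by (auto simp: not_eventually frequently_cofinite cofinite_eq_sequentially[symmetric] not_le)
      then obtain \<sigma> :: "nat \<Rightarrow> nat" where \<sigma>: "strict_mono \<sigma>"
        "\<And>k. \<exists>g\<in>C \<inter> ?K. \<bar>?f (h (\<sigma> k) g) - ?f (H g)\<bar> > e / 4"
        by (rule infinite_enumerate[elim_format]) auto
      then obtain g where g: "\<And>k. g k \<in> C" "\<And>k. g k \<in> ?K" "\<And>k. \<bar>?f (h (\<sigma> k) (g k)) - ?f (H (g k))\<bar> > e / 4"
        by (metis IntD1 IntD2)
      obtain g' \<tau> where \<tau>: "strict_mono (\<tau> :: nat \<Rightarrow> nat)" "(g \<circ> \<tau>) \<longlonglongrightarrow> g'"
        using compact_cbox[unfolded compact_def] g(2) by metis
      have "(\<lambda>k. h ((\<sigma> \<circ> \<tau>) k) ((g \<circ> \<tau>) k)) \<longlonglongrightarrow> H g'"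
        using g(1) by (intro h \<tau> strict_mono_o \<sigma>) auto
      then have "(\<lambda>k. ?f (h (\<sigma> (\<tau> k)) (g (\<tau> k)))) \<longlonglongrightarrow> ?f (H g')"
        using continuous_on_tendsto_compose[OF fc] by auto
      moreover have "(\<lambda>k. ?f (H (g (\<tau> k)))) \<longlonglongrightarrow> ?f (H g')"
        using continuous_on_tendsto_compose[OF fHc, of "g \<circ> \<tau>"] \<tau>(2) by (auto simp: comp_def)
      ultimately have "(\<lambda>k. ?f (h (\<sigma> (\<tau> k)) (g (\<tau> k))) - ?f (H (g (\<tau> k)))) \<longlonglongrightarrow> ?f (H g') - ?f (H g')"
        by (rule tendsto_diff)
      then have "eventually (\<lambda>k. \<bar>?f (h (\<sigma> (\<tau> k)) (g (\<tau> k))) - ?f (H (g (\<tau> k)))\<bar> < e / 4) sequentially"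
        using tendstoD[OF _ e] by (fastforce simp: dist_real_def)
      then show False using g(3) by (auto simp: eventually_sequentially) (meson less_asym order_refl)
    qed
    with R(2) have "eventually (\<lambda>n. norm ((\<integral>\<omega>. ?f (Q n \<omega>) \<partial>M n) - (\<integral>\<omega>. ?f (H (W n \<omega>)) \<partial>M n) - 0) < e) sequentially"
    proof eventually_elim
      case (elim n)
      have i1: "integrable (M n) (\<lambda>\<omega>. ?f (Q n \<omega>))" by (rule M.integrable_const_bound[of _ 1]) (auto simp: fb)
      have i2: "integrable (M n) (\<lambda>\<omega>. ?f (H (W n \<omega>)))" by (rule M.integrable_const_bound[of _ 1]) (auto simp: fb)
      have i3: "integrable (M n) (\<lambda>\<omega>. tail_fn R (W n \<omega>))"
        by (rule M.integrable_const_bound[of _ "DIM('e)"]) (auto simp: tail_fn_le)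
      have "\<bar>(\<integral>\<omega>. ?f (Q n \<omega>) \<partial>M n) - (\<integral>\<omega>. ?f (H (W n \<omega>)) \<partial>M n)\<bar>
          = \<bar>\<integral>\<omega>. ?f (Q n \<omega>) - ?f (H (W n \<omega>)) \<partial>M n\<bar>" by (simp add: i1 i2)
      also have "\<dots> \<le> (\<integral>\<omega>. \<bar>?f (Q n \<omega>) - ?f (H (W n \<omega>))\<bar> \<partial>M n)" by (rule integral_abs_bound)
      also have "\<dots> \<le> (\<integral>\<omega>. e / 4 + 2 * tail_fn R (W n \<omega>) \<partial>M n)"
      proof (rule integral_mono)
        fix \<omega> assume \<omega>: "\<omega> \<in> space (M n)"
        show "\<bar>?f (Q n \<omega>) - ?f (H (W n \<omega>))\<bar> \<le> e / 4 + 2 * tail_fn R (W n \<omega>)"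
        proof (cases "W n \<omega> \<in> ?K")
          case True
          then have "\<bar>?f (Q n \<omega>) - ?f (H (W n \<omega>))\<bar> \<le> e / 4" using elim(2) C[OF \<omega>] Q(2)[OF \<omega>] by auto
          then show ?thesis using tail_fn_nonneg[of R "W n \<omega>"] by linarith
        next
          case False
          show ?thesis using tail_fn_ge_1[OF False] fb[of "Q n \<omega>"] fb[of "H (W n \<omega>)"] e by linarith
        qed
      qed (auto simp: i1 i2 i3)
      also have "\<dots> = e / 4 + 2 * (\<integral>\<omega>. tail_fn R (W n \<omega>) \<partial>M n)" by (simp add: i3 M.prob_space)
      finally show ?case using elim(1) e by simp
    qed
    then show "\<exists>no. \<forall>n\<ge>no. norm ((\<integral>\<omega>. ?f (Q n \<omega>) \<partial>M n) - (\<integral>\<omega>. ?f (H (W n \<omega>)) \<partial>M n) - 0) < e"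
      by (simp add: eventually_sequentially)
  qed
  moreover have "(\<lambda>n. \<integral>\<omega>. ?f (H (W n \<omega>)) \<partial>M n) \<longlonglongrightarrow> (\<integral>\<omega>. ?f (H (V \<omega>)) \<partial>N)"
    by (rule bounded_continuous_limit[OF fHc]) (rule fb)
  ultimately have "(\<lambda>n. \<integral>\<omega>. ?f (Q n \<omega>) \<partial>M n) \<longlonglongrightarrow> (\<integral>\<omega>. ?f (H (V \<omega>)) \<partial>N)"
    using tendsto_add by fastforce
  then show "(\<lambda>n. integral\<^sup>L (distr (M n) borel (Q n)) ?f) \<longlonglongrightarrow> integral\<^sup>L (distr N borel (\<lambda>\<omega>. H (V \<omega>))) ?f"
    by (simp add: integral_distr)
qed

end

text \<open>The limit theorem for constant sequences shows that bounded continuous functions have the same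
  expectations. Indicators of closed sets are limits of such functions, and closed sets generate the
  Borel sets.\<close>

theorem cf_uniqueness:
  fixes U :: "'a \<Rightarrow> 'e::euclidean_space" and V :: "'b \<Rightarrow> 'e"
  assumes "prob_space M" "prob_space N"
    and [measurable]: "U \<in> borel_measurable M" "V \<in> borel_measurable N"
    and cf: "\<And>t. cf M U t = cf N V t"
  shows "distr M borel U = distr N borel V"
proof -
  interpret cf_limit "\<lambda>_. M" "\<lambda>_. U" N V
    using assms by (intro cf_limit.intro) auto
  interpret DU: prob_space "distr M borel U" using assms(1) by (rule prob_space.prob_space_distr) simp
  interpret DV: prob_space "distr N borel V" using assms(2) by (rule prob_space.prob_space_distr) simp
  have closed_eq: "measure (distr M borel U) C = measure (distr N borel V) C" if C: "closed C" "C \<noteq> {}" for C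
  proof -
    \<comment> \<open>These functions decrease to the indicator of \<open>C\<close>.\<close>
    let ?f = "\<lambda>k x. max 0 (1 - real k * infdist x C)"
    have fc: "continuous_on UNIV (?f k)" for k by (intro continuous_intros)
    have [measurable]: "?f k \<in> borel_measurable borel" for k by (rule borel_measurable_continuous_onI[OF fc])
    have [measurable]: "C \<in> sets borel" using C by simp
    have fb: "\<bar>?f k x\<bar> \<le> 1" for k x using infdist_nonneg[of x C] by simp
    have lim: "(\<lambda>k. ?f k x) \<longlonglongrightarrow> indicator C x" for x
    proof (cases "x \<in> C")
      case True then show ?thesis by simp
    next
      case False
      then have "0 < infdist x C" using C infdist_pos_not_in_closed by blast
      then obtain K :: nat where "1 < real K * infdist x C" using reals_Archimedean3 by blast
      then have "?f k x = 0" if "k \<ge> K" for k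
        using mult_right_mono[of "real K" "real k" "infdist x C"] that infdist_nonneg[of x C] by simp
      then have "eventually (\<lambda>k. ?f k x = indicator C x) sequentially"
        using False by (auto simp: eventually_sequentially)
      then show ?thesis by (rule tendsto_eventually)
    qed
    have conv: "(\<lambda>k. \<integral>\<omega>. ?f k (X \<omega>) \<partial>P) \<longlonglongrightarrow> measure (distr P borel X) C"
      if "prob_space P" and [measurable]: "X \<in> borel_measurable P" for P :: "'c measure" and X
    proof -
      interpret P: prob_space P by fact
      have "(\<lambda>k. \<integral>\<omega>. ?f k (X \<omega>) \<partial>P) \<longlonglongrightarrow> (\<integral>\<omega>. indicator C (X \<omega>) \<partial>P)"
        by (rule integral_dominated_convergence[where w = "\<lambda>_. 1"]) (use fb lim in auto)
      also have "(\<integral>\<omega>. indicator C (X \<omega>) \<partial>P) = (\<integral>x. indicator C x \<partial>distr P borel X :: real)"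
        by (rule integral_distr[symmetric]) measurable
      also have "\<dots> = measure (distr P borel X) C" by simp
      finally show ?thesis .
    qed
    have "(\<integral>\<omega>. ?f k (U \<omega>) \<partial>M) = (\<integral>\<omega>. ?f k (V \<omega>) \<partial>N)" for k
      using bounded_continuous_limit[OF fc fb, of k] by (simp add: LIMSEQ_const_iff)
    then show ?thesis using conv[OF assms(1), of U] conv[OF assms(2), of V] by (simp add: LIMSEQ_unique)
  qed
  show ?thesis
  proof (rule measure_eqI_generator_eq[where E = "Collect closed" and \<Omega> = UNIV and A = "\<lambda>_. UNIV"])
    show "sets (distr M borel U) = sigma_sets UNIV (Collect closed)"
      "sets (distr N borel V) = sigma_sets UNIV (Collect closed)"
      by (simp_all add: borel_eq_closed)
    fix C :: "'e set" assume "C \<in> Collect closed"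
    then show "emeasure (distr M borel U) C = emeasure (distr N borel V) C"
      using closed_eq[of C] by (cases "C = {}") (auto simp: DU.emeasure_eq_measure DV.emeasure_eq_measure)
  qed (auto simp: Int_stable_def DU.emeasure_eq_measure)
qed

section \<open>Gaussian vectors and their quadratic forms\<close>

text \<open>Including the degenerate law with variance \<open>0\<close>, all centred normal laws are images of the
  standard one.\<close>

lemma normal_measure_scale:
  assumes "0 \<le> s2"
  shows "normal_measure 0 s2 = distr std_normal_distribution borel (\<lambda>x. sqrt s2 * x)"
proof (cases "s2 = 0")
  case True
  interpret real_distribution std_normal_distribution by (rule real_dist_normal_dist)
  show ?thesis using True distr_const[of 0 borel] by (simp add: normal_measure_def)
next
  case False
  interpret real_distribution std_normal_distribution by (rule real_dist_normal_dist)
  have "distributed std_normal_distribution lborel (\<lambda>x. x) (normal_density 0 1)"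
    by (auto simp: distributed_def distr_id2 cong: distr_cong)
  from normal_density_affine[OF this, of "sqrt s2" 0] False assms
  have "distr std_normal_distribution lborel (\<lambda>x. sqrt s2 * x) = density lborel (normal_density 0 (sqrt s2))"
    by (simp add: distributed_def)
  moreover have "distr std_normal_distribution lborel (\<lambda>x. sqrt s2 * x) = distr std_normal_distribution borel (\<lambda>x. sqrt s2 * x)"
    by (intro distr_cong) auto
  ultimately show ?thesis using False by (simp add: normal_measure_def)
qed

lemma prob_space_normal_measure: "0 \<le> s2 \<Longrightarrow> prob_space (normal_measure 0 s2)"
  by (simp add: normal_measure_scale real_distribution.axioms(1)[OF real_dist_normal_dist] prob_space.prob_space_distr)

lemma char_normal_measure:
  assumes "0 \<le> s2"
  shows "char (normal_measure 0 s2) t = complex_of_real (exp (- (s2 * t\<^sup>2) / 2))"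
proof -
  have "char (normal_measure 0 s2) t = char std_normal_distribution (t * sqrt s2)"
    by (simp add: normal_measure_scale[OF assms] char_def integral_distr mult.assoc)
  also have "\<dots> = complex_of_real (exp (- ((t * sqrt s2)\<^sup>2) / 2))"
    by (simp only: char_std_normal_distribution)
  finally show ?thesis using assms by (simp add: power_mult_distrib mult.commute)
qed

lemma normal_measure_moments:
  assumes "0 \<le> s2"
  shows "integrable (normal_measure 0 s2) (\<lambda>x. x ^ k)"
    and "(\<integral>x. x\<^sup>2 \<partial>normal_measure 0 s2) = s2"
    and "(\<integral>x. x ^ 4 \<partial>normal_measure 0 s2) = 3 * s2\<^sup>2"
proof -
  show "integrable (normal_measure 0 s2) (\<lambda>x. x ^ k)"
    by (simp add: normal_measure_scale[OF assms] integrable_distr_eq power_mult_distrib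
        integrable_std_normal_distribution_moment)
  have m2: "(\<integral>x. x\<^sup>2 \<partial>std_normal_distribution) = 1" and m4: "(\<integral>x. x ^ 4 \<partial>std_normal_distribution) = 3"
    using std_normal_distribution_even_moments(1)[of 1] std_normal_distribution_even_moments(1)[of 2]
    by (simp_all add: fact_numeral)
  have "(\<integral>x. x\<^sup>2 \<partial>normal_measure 0 s2) = s2 * (\<integral>x. x\<^sup>2 \<partial>std_normal_distribution)"
    using assms by (simp add: normal_measure_scale integral_distr power_mult_distrib)
  then show "(\<integral>x. x\<^sup>2 \<partial>normal_measure 0 s2) = s2" by (simp add: m2)
  have "(\<integral>x. x ^ 4 \<partial>normal_measure 0 s2) = sqrt s2 ^ 4 * (\<integral>x. x ^ 4 \<partial>std_normal_distribution)"
    using assms by (simp add: normal_measure_scale integral_distr power_mult_distrib)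
  also have "sqrt s2 ^ 4 = (sqrt s2 ^ 2)\<^sup>2" by (simp only: power_mult[symmetric])  simp
  also have "\<dots> = s2\<^sup>2" using assms by simp
  finally show "(\<integral>x. x ^ 4 \<partial>normal_measure 0 s2) = 3 * s2\<^sup>2" by (simp add: m4)
qed

definition std_gaussian :: "'a measure \<Rightarrow> ('a \<Rightarrow> 'e::euclidean_space) \<Rightarrow> bool" where
  "std_gaussian M X \<longleftrightarrow> X \<in> borel_measurable M \<and>
     (\<forall>a. distr M borel (\<lambda>\<omega>. a \<bullet> X \<omega>) = normal_measure 0 (a \<bullet> a))"

lemma std_gaussian_measurable [measurable_dest]: "std_gaussian M X \<Longrightarrow> X \<in> borel_measurable M"
  by (simp add: std_gaussian_def)

lemma std_gaussian_cf:
  assumes "std_gaussian M X"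
  shows "cf M X t = complex_of_real (exp (- (t \<bullet> t) / 2))"
  using char_distr_inner[OF std_gaussian_measurable[OF assms], of t 1] assms
  by (simp add: std_gaussian_def char_normal_measure)

lemma std_gaussian_moments:
  assumes X: "std_gaussian M X"
  shows "integrable M (\<lambda>\<omega>. (a \<bullet> X \<omega>) ^ k)"
    and "(\<integral>\<omega>. (a \<bullet> X \<omega>)\<^sup>2 \<partial>M) = a \<bullet> a"
    and "(\<integral>\<omega>. (a \<bullet> X \<omega>) ^ 4 \<partial>M) = 3 * (a \<bullet> a)\<^sup>2"
proof -
  note [measurable] = std_gaussian_measurable[OF X]
  have d: "distr M borel (\<lambda>\<omega>. a \<bullet> X \<omega>) = normal_measure 0 (a \<bullet> a)" using X by (simp add: std_gaussian_def)
  show "integrable M (\<lambda>\<omega>. (a \<bullet> X \<omega>) ^ k)"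
    using normal_measure_moments(1)[of "a \<bullet> a" k] unfolding d[symmetric] by (simp add: integrable_distr_eq)
  show "(\<integral>\<omega>. (a \<bullet> X \<omega>)\<^sup>2 \<partial>M) = a \<bullet> a" "(\<integral>\<omega>. (a \<bullet> X \<omega>) ^ 4 \<partial>M) = 3 * (a \<bullet> a)\<^sup>2"
    using normal_measure_moments(2,3)[of "a \<bullet> a"] unfolding d[symmetric] by (simp_all add: integral_distr)
qed

text \<open>Polarisation: \<open>12 x\<^sup>2 y\<^sup>2\<close> is a combination of fourth powers of linear forms in \<open>x\<close> and \<open>y\<close>, and
  the fourth moments of linear forms are known from the definition.\<close>

lemma std_gaussian_product_moment:
  assumes X: "std_gaussian M X"
  shows "integrable M (\<lambda>\<omega>. (u \<bullet> X \<omega>)\<^sup>2 * (w \<bullet> X \<omega>)\<^sup>2)" (is "integrable M ?f")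
    and "(\<integral>\<omega>. (u \<bullet> X \<omega>)\<^sup>2 * (w \<bullet> X \<omega>)\<^sup>2 \<partial>M) = (u \<bullet> u) * (w \<bullet> w) + 2 * (u \<bullet> w)\<^sup>2"
proof -
  have eq: "?f = (\<lambda>\<omega>. (((u + w) \<bullet> X \<omega>) ^ 4 + ((u - w) \<bullet> X \<omega>) ^ 4 - 2 * (u \<bullet> X \<omega>) ^ 4 - 2 * (w \<bullet> X \<omega>) ^ 4) / 12)"
    by (simp add: fun_eq_iff inner_add_left inner_diff_left power4_eq_xxxx power2_eq_square algebra_simps)
  note i = std_gaussian_moments(1)[OF X, of _ 4]
  show "integrable M ?f" unfolding eq using i by (intro integrable_divide Bochner_Integration.integrable_diff Bochner_Integration.integrable_add integrable_mult_right)
  show "integral\<^sup>L M ?f = (u \<bullet> u) * (w \<bullet> w) + 2 * (u \<bullet> w)\<^sup>2"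
    unfolding eq by (simp add: i std_gaussian_moments(3)[OF X])
      (simp add: inner_add_left inner_add_right inner_diff_left inner_diff_right inner_commute power2_eq_square algebra_simps)
qed

lemma inner_outer_prod: "outer_prod x y \<bullet> B = x \<bullet> (B *v y)"
  by (simp add: outer_prod_def inner_vec_def matrix_vector_mult_def sum_distrib_left mult_ac)

lemma inner_transpose: "transpose A \<bullet> transpose B = A \<bullet> (B :: real^'n^'m)"
  unfolding inner_vec_def transpose_def by (simp add: sum.swap[of _ "UNIV::'n set"])

lemma inner_matrix_mult_left: "(A :: real^'n^'m) \<bullet> (B ** C) = (transpose B ** A) \<bullet> C"
proof -
  have "A \<bullet> (B ** C) = (\<Sum>i\<in>UNIV. \<Sum>j\<in>UNIV. \<Sum>k\<in>UNIV. A $ i $ j * (B $ i $ k * C $ k $ j))"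
    by (simp add: inner_vec_def matrix_matrix_mult_def sum_distrib_left)
  also have "\<dots> = (\<Sum>k\<in>UNIV. \<Sum>j\<in>UNIV. \<Sum>i\<in>UNIV. A $ i $ j * (B $ i $ k * C $ k $ j))"
    by (subst sum.swap, subst (2) sum.swap, subst sum.swap) simp
  also have "\<dots> = (transpose B ** A) \<bullet> C"
    by (simp add: inner_vec_def matrix_matrix_mult_def transpose_def sum_distrib_left sum_distrib_right mult_ac)
  finally show ?thesis .
qed

lemma inner_matrix_mult_right: "(A :: real^'n^'m) \<bullet> (B ** C) = (A ** transpose C) \<bullet> B"
proof -
  have "A \<bullet> (B ** C) = transpose A \<bullet> (transpose C ** transpose B)"
    by (simp add: inner_transpose matrix_transpose_mul[symmetric])
  also have "\<dots> = transpose (A ** transpose C) \<bullet> transpose B"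
    by (simp add: inner_matrix_mult_left matrix_transpose_mul)
  finally show ?thesis by (simp only: inner_transpose)
qed

text \<open>The quadratic form of the covariance matrix \<open>I + K\<close> evaluated at \<open>vec A\<close>.\<close>

definition goe_var :: "real^'n^'n \<Rightarrow> real" where
  "goe_var A = A \<bullet> A + A \<bullet> transpose A"

lemma goe_var_nonneg: "0 \<le> goe_var A"
proof -
  have "goe_var A = (A + transpose A) \<bullet> (A + transpose A) / 2"
    using inner_transpose[of A A] by (simp add: goe_var_def inner_add_left inner_add_right inner_commute)
  then show ?thesis using inner_ge_zero[of "A + transpose A"] by linarith
qed

lemma quadratic_form_symmetric_part:
  fixes A :: "real^'n^'n"
  defines "B \<equiv> (1/2) *\<^sub>R (A + transpose A)"
  shows "transpose B = B" "x \<bullet> (A *v x) = x \<bullet> (B *v x)" "A \<bullet> mat 1 = B \<bullet> mat 1" "goe_var A = 2 * (B \<bullet> B)"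
proof -
  have t: "x \<bullet> (x v* A) = x \<bullet> (A *v x)" for x
    using dot_lmul_matrix[of x A x] by (simp add: inner_commute)
  show "transpose B = B" by (simp add: B_def transpose_scaleR transpose_add add.commute)
  show "x \<bullet> (A *v x) = x \<bullet> (B *v x)"
    by (simp add: B_def scaleR_matrix_vector_assoc[symmetric] matrix_vector_mult_add_rdistrib inner_add_right t)
  have "transpose A \<bullet> mat 1 = A \<bullet> mat 1" using inner_transpose[of A "mat 1"] by simp
  then show "A \<bullet> mat 1 = B \<bullet> mat 1" by (simp add: B_def inner_add_left)
  show "goe_var A = 2 * (B \<bullet> B)"
    using inner_transpose[of A A] by (simp add: goe_var_def B_def inner_add_left inner_add_right inner_commute)
qed

text \<open>In an eigenbasis of \<open>A\<close> the quadratic form is \<open>\<Sum>i. \<mu> i (u i \<bullet> X)\<^sup>2\<close>, and the squares have product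
  moments \<open>1\<close>, or \<open>3\<close> on the diagonal.\<close>

lemma quadratic_form_moments_symmetric:
  fixes X :: "'a \<Rightarrow> real^'n"
  assumes "prob_space M" and X: "std_gaussian M X" and sym: "transpose A = A"
  defines "\<zeta> \<equiv> \<lambda>\<omega>. X \<omega> \<bullet> (A *v X \<omega>) - A \<bullet> mat 1"
  shows "integrable M \<zeta>" "(\<integral>\<omega>. \<zeta> \<omega> \<partial>M) = 0" "integrable M (\<lambda>\<omega>. (\<zeta> \<omega>)\<^sup>2)"
    "(\<integral>\<omega>. (\<zeta> \<omega>)\<^sup>2 \<partial>M) = 2 * (A \<bullet> A)"
proof -
  interpret prob_space M by fact
  obtain u \<mu> where u: "\<And>i j. u i \<bullet> u j = (if i = j then 1 else (0::real))"
    and ev: "\<And>i::'n. A *v u i = \<mu> i *\<^sub>R u i"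
    using symmetric_orthonormal_eigenbasis[OF sym] by metis
  have A: "A = (\<Sum>i\<in>UNIV. \<mu> i *\<^sub>R outer_prod (u i) (u i))"
  proof (rule matrix_eq_vecI)
    fix x
    have uA: "u i \<bullet> (A *v x) = \<mu> i * (u i \<bullet> x)" for i
      using symmetric_inner[OF sym, of "u i" x] ev[of i] by simp
    have "A *v x = (\<Sum>i\<in>UNIV. (\<mu> i * (u i \<bullet> x)) *\<^sub>R u i)"
      using onb_expansion(1)[OF u, of "A *v x"] by (simp only: uA)
    also have "\<dots> = (\<Sum>i\<in>UNIV. (\<mu> i *\<^sub>R outer_prod (u i) (u i)) *v x)"
      by (simp add: scaleR_matrix_vector_assoc[symmetric] outer_prod_vec)
    also have "\<dots> = (\<Sum>i\<in>UNIV. \<mu> i *\<^sub>R outer_prod (u i) (u i)) *v x"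
      by (induction rule: infinite_finite_induct) (simp_all add: matrix_vector_mult_add_rdistrib)
    finally show "A *v x = (\<Sum>i\<in>UNIV. \<mu> i *\<^sub>R outer_prod (u i) (u i)) *v x" .
  qed
  have AB: "A \<bullet> B = (\<Sum>i\<in>UNIV. \<mu> i * (u i \<bullet> (B *v u i)))" for B
    by (subst A) (simp add: inner_sum_left inner_outer_prod)
  have tr: "A \<bullet> mat 1 = (\<Sum>i\<in>UNIV. \<mu> i)" by (simp add: AB u)
  have AA: "A \<bullet> A = (\<Sum>i\<in>UNIV. (\<mu> i)\<^sup>2)" by (simp add: AB ev u power2_eq_square)
  have q: "x \<bullet> (A *v x) = (\<Sum>i\<in>UNIV. \<mu> i * (u i \<bullet> x)\<^sup>2)" for x
    using AB[of "outer_prod x x"] inner_outer_prod[of x x A]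
    by (simp add: inner_commute outer_prod_vec power2_eq_square mult_ac)
  note i2 = std_gaussian_moments(1)[OF X, of _ 2] and m2 = std_gaussian_moments(2)[OF X]
  note i4 = std_gaussian_product_moment(1)[OF X] and m4 = std_gaussian_product_moment(2)[OF X]
  have iq: "integrable M (\<lambda>\<omega>. X \<omega> \<bullet> (A *v X \<omega>))" unfolding q using i2 by auto
  have mq: "(\<integral>\<omega>. X \<omega> \<bullet> (A *v X \<omega>) \<partial>M) = A \<bullet> mat 1"
    unfolding q using i2 m2 by (simp add: tr u)
  have qq: "(x \<bullet> (A *v x))\<^sup>2 = (\<Sum>i\<in>UNIV. \<Sum>j\<in>UNIV. \<mu> i * \<mu> j * ((u i \<bullet> x)\<^sup>2 * (u j \<bullet> x)\<^sup>2))" for x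
    unfolding q power2_eq_square[of "sum _ _"] sum_product by (simp add: mult_ac)
  have iqq: "integrable M (\<lambda>\<omega>. (X \<omega> \<bullet> (A *v X \<omega>))\<^sup>2)" unfolding qq using i4 by auto
  have mqq: "(\<integral>\<omega>. (X \<omega> \<bullet> (A *v X \<omega>))\<^sup>2 \<partial>M) = (A \<bullet> mat 1)\<^sup>2 + 2 * (A \<bullet> A)"
  proof -
    have "(\<integral>\<omega>. (X \<omega> \<bullet> (A *v X \<omega>))\<^sup>2 \<partial>M) = (\<Sum>i\<in>UNIV. \<Sum>j\<in>UNIV. \<mu> i * \<mu> j * (1 + 2 * (u i \<bullet> u j)\<^sup>2))"
      unfolding qq using i4 by (simp add: m4 u(1))
    also have "\<dots> = (\<Sum>i\<in>UNIV. \<Sum>j\<in>UNIV. \<mu> i * \<mu> j) + (\<Sum>i\<in>UNIV. \<Sum>j\<in>UNIV. \<mu> i * \<mu> j * (2 * (u i \<bullet> u j)\<^sup>2))"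
      by (simp add: distrib_left sum.distrib)
    also have "(\<Sum>i\<in>UNIV. \<Sum>j\<in>UNIV. \<mu> i * \<mu> j) = (A \<bullet> mat 1)\<^sup>2"
      by (simp add: tr power2_eq_square sum_product)
    also have "(\<Sum>i\<in>UNIV. \<Sum>j\<in>UNIV. \<mu> i * \<mu> j * (2 * (u i \<bullet> u j)\<^sup>2)) = 2 * (A \<bullet> A)"
      unfolding u by (simp add: AA power2_eq_square sum_distrib_left mult_ac
          if_distrib[of "\<lambda>a. _ * a"] cong: if_cong)
    finally show ?thesis .
  qed
  show "integrable M \<zeta>" unfolding \<zeta>_def using iq by simp
  show "(\<integral>\<omega>. \<zeta> \<omega> \<partial>M) = 0" unfolding \<zeta>_def using iq mq by (simp add: prob_space)
  have e: "(\<lambda>\<omega>. (\<zeta> \<omega>)\<^sup>2) = (\<lambda>\<omega>. (X \<omega> \<bullet> (A *v X \<omega>))\<^sup>2 - 2 * (A \<bullet> mat 1) * (X \<omega> \<bullet> (A *v X \<omega>)) + (A \<bullet> mat 1)\<^sup>2)"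
    by (simp add: \<zeta>_def power2_eq_square algebra_simps)
  show "integrable M (\<lambda>\<omega>. (\<zeta> \<omega>)\<^sup>2)" unfolding e using iq iqq by simp
  show "(\<integral>\<omega>. (\<zeta> \<omega>)\<^sup>2 \<partial>M) = 2 * (A \<bullet> A)"
    unfolding e using iq iqq by (simp add: mq mqq prob_space) (simp add: power2_eq_square)
qed

lemma quadratic_form_moments:
  fixes X :: "'a \<Rightarrow> real^'n" and A :: "real^'n^'n"
  assumes "prob_space M" and X: "std_gaussian M X"
  defines "\<zeta> \<equiv> \<lambda>\<omega>. X \<omega> \<bullet> (A *v X \<omega>) - A \<bullet> mat 1"
  shows "integrable M \<zeta>" "(\<integral>\<omega>. \<zeta> \<omega> \<partial>M) = 0" "integrable M (\<lambda>\<omega>. (\<zeta> \<omega>)\<^sup>2)"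
    "(\<integral>\<omega>. (\<zeta> \<omega>)\<^sup>2 \<partial>M) = goe_var A"
  using quadratic_form_moments_symmetric[OF assms(1,2) quadratic_form_symmetric_part(1)[of A]]
  unfolding \<zeta>_def quadratic_form_symmetric_part(2)[of _ A] quadratic_form_symmetric_part(3)[of A]
    quadratic_form_symmetric_part(4)[of A] by blast+

text \<open>The central limit theorem reduced to one characteristic function: the rows of the triangular
  array live on different probability spaces and share only the law of a single summand.\<close>

lemma char_power_limit:
  assumes "real_distribution \<nu>" and i1: "integrable \<nu> (\<lambda>x. x)" and m1: "(\<integral>x. x \<partial>\<nu>) = 0"
    and i2: "integrable \<nu> (\<lambda>x. x\<^sup>2)" and m2: "(\<integral>x. x\<^sup>2 \<partial>\<nu>) = s2" and s2: "0 \<le> s2"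
  shows "(\<lambda>n. char \<nu> (1 / sqrt (real n)) ^ n) \<longlonglongrightarrow> complex_of_real (exp (- s2 / 2))"
proof -
  interpret real_distribution \<nu> by fact
  let ?t = "\<lambda>n. 1 / sqrt (real n)"
  let ?E = "\<lambda>n. \<integral>x. min (6 * x\<^sup>2) (\<bar>?t n\<bar> * \<bar>x\<bar> ^ 3) \<partial>\<nu>"
  have t0: "?t \<longlonglongrightarrow> 0"
    by (intro tendsto_divide_0[OF tendsto_const] filterlim_at_top_imp_at_infinity
         filterlim_compose[OF sqrt_at_top] filterlim_real_sequentially)
  have "?E \<longlonglongrightarrow> (\<integral>x. 0 \<partial>\<nu>)"
  proof (rule integral_dominated_convergence[where w = "\<lambda>x. 6 * x\<^sup>2"])
    show "AE x in \<nu>. (\<lambda>n. min (6 * x\<^sup>2) (\<bar>?t n\<bar> * \<bar>x\<bar> ^ 3)) \<longlonglongrightarrow> 0"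
    proof (rule AE_I2)
      fix x :: real
      have "(\<lambda>n. min (6 * x\<^sup>2) (\<bar>?t n\<bar> * \<bar>x\<bar> ^ 3)) \<longlonglongrightarrow> min (6 * x\<^sup>2) (\<bar>0\<bar> * \<bar>x\<bar> ^ 3)"
        by (intro tendsto_min tendsto_intros t0)
      then show "(\<lambda>n. min (6 * x\<^sup>2) (\<bar>?t n\<bar> * \<bar>x\<bar> ^ 3)) \<longlonglongrightarrow> 0" by simp
    qed
  qed (use i2 in auto)
  then have E0: "(\<lambda>n. ?E n / 6) \<longlonglongrightarrow> 0" by (auto intro: tendsto_eq_intros)
  have main: "eventually (\<lambda>n. norm (char \<nu> (?t n) ^ n - complex_of_real ((1 + (- s2 / 2) / n) ^ n)) \<le> ?E n / 6) sequentially"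
  proof (rule eventually_sequentiallyI)
    fix n :: nat assume n: "n \<ge> Suc (nat \<lceil>s2\<rceil>)"
    then have n0: "0 < real n" "s2 \<le> real n" by linarith+
    have tn: "(?t n)\<^sup>2 = 1 / n" by (simp add: power_divide)
    have "variance (\<lambda>x. x) = s2" by (simp add: m1 m2)
    from char_approx3[OF i1 m1 i2 this, of "?t n"]
    have a: "norm (char \<nu> (?t n) - (1 + (- s2 / 2) / n)) \<le> (1 / n) / 6 * ?E n"
      unfolding tn by (simp add: field_simps)
    have "norm (char \<nu> (?t n) ^ n - (complex_of_real (1 + (- s2 / 2) / n)) ^ n)
       \<le> n * norm (char \<nu> (?t n) - complex_of_real (1 + (- s2 / 2) / n))"
    proof (rule norm_power_diff)
      show "norm (char \<nu> (?t n)) \<le> 1" by (rule cmod_char_le_1)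
      show "norm (complex_of_real (1 + - s2 / 2 / real n)) \<le> 1"
        unfolding norm_of_real using n0 s2 by (auto simp: abs_le_iff field_simps)
    qed
    also have "\<dots> \<le> n * ((1 / n) / 6 * ?E n)" using a by (intro mult_left_mono) auto
    also have "\<dots> = ?E n / 6" using n0 by simp
    finally show "norm (char \<nu> (?t n) ^ n - complex_of_real ((1 + (- s2 / 2) / n) ^ n)) \<le> ?E n / 6" by simp
  qed
  have "(\<lambda>n. complex_of_real ((1 + (- s2 / 2) / n) ^ n)) \<longlonglongrightarrow> complex_of_real (exp (- s2 / 2))"
    by (intro tendsto_of_real tendsto_exp_limit_sequentially)
  then show ?thesis by (rule Lim_transform) (rule Lim_null_comparison[OF main E0])
qed

section \<open>Sample covariance of a Gaussian sample\<close>

lemma borel_measurable_outer_prod [measurable]: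
  assumes "f \<in> borel_measurable M" "g \<in> borel_measurable M"
  shows "(\<lambda>\<omega>. outer_prod (f \<omega>) (g \<omega>) :: real^'n^'n) \<in> borel_measurable M"
proof (rule borel_measurable_continuous_Pair[OF assms])
  show "continuous_on UNIV (\<lambda>x. outer_prod (fst x) (snd x) :: real^'n^'n)"
    unfolding outer_prod_def by (intro continuous_intros)
qed

lemma borel_measurable_mat_vec [measurable]:
  assumes "f \<in> borel_measurable M"
  shows "(\<lambda>\<omega>. (A :: real^'n^'m) *v f \<omega>) \<in> borel_measurable M"
proof -
  have "continuous_on UNIV (\<lambda>x. A *v x)" by (intro linear_continuous_on) simp
  then show ?thesis using assms borel_measurable_continuous_onI measurable_compose by blast
qed

lemma borel_measurable_sample_mean [measurable]:
  assumes "\<And>i. i \<in> {1..n} \<Longrightarrow> f i \<in> borel_measurable M"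
  shows "(\<lambda>\<omega>. sample_mean n (\<lambda>i. f i \<omega>) :: real^'n) \<in> borel_measurable M"
  unfolding sample_mean_def using assms by (intro borel_measurable_scaleR borel_measurable_sum) auto

lemma borel_measurable_sample_cov:
  assumes "\<And>i. i \<in> {1..n} \<Longrightarrow> f i \<in> borel_measurable M"
  shows "(\<lambda>\<omega>. sample_cov n (\<lambda>i. f i \<omega>) :: real^'n^'n) \<in> borel_measurable M"
  unfolding sample_cov_def using assms
  by (intro borel_measurable_scaleR borel_measurable_sum borel_measurable_outer_prod
      borel_measurable_diff borel_measurable_sample_mean) auto

lemma transpose_sample_cov:
  fixes x :: "nat \<Rightarrow> real^'n"
  shows "transpose (sample_cov n x) = sample_cov n x"
proof -
  have "transpose (\<Sum>i\<in>I. outer_prod (y i) (y i)) = (\<Sum>i\<in>I. outer_prod (y i) (y i))"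
    for I :: "nat set" and y :: "nat \<Rightarrow> real^'n"
    by (induction I rule: infinite_finite_induct)
       (simp_all add: transpose_add transpose_outer_prod, simp_all add: transpose_def vec_eq_iff)
  then show ?thesis by (simp add: sample_cov_def transpose_scaleR)
qed

lemma inner_sample_cov:
  assumes n: "0 < n"
  shows "A \<bullet> sample_cov n x = (\<Sum>i=1..n. x i \<bullet> (A *v x i)) / n - sample_mean n x \<bullet> (A *v sample_mean n x)"
proof -
  let ?m = "sample_mean n x"
  have s: "(\<Sum>i=1..n. x i) = real n *\<^sub>R ?m" using n by (simp add: sample_mean_def)
  have s1: "(\<Sum>i=1..n. x i \<bullet> (A *v ?m)) = n * (?m \<bullet> (A *v ?m))"
    by (simp only: inner_sum_left[symmetric] s) simp
  have s2: "(\<Sum>i=1..n. ?m \<bullet> (A *v x i)) = n * (?m \<bullet> (A *v ?m))"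
    by (simp only: inner_sum_right[symmetric] vec.sum[symmetric] s) (simp add: matrix_vector_mult_scaleR)
  have o: "A \<bullet> outer_prod y y = y \<bullet> (A *v y)" for y using inner_outer_prod[of y y A] by (simp add: inner_commute)
  have "(\<Sum>i=1..n. A \<bullet> outer_prod (x i - ?m) (x i - ?m)) = (\<Sum>i=1..n. x i \<bullet> (A *v x i)
      - x i \<bullet> (A *v ?m) - ?m \<bullet> (A *v x i) + ?m \<bullet> (A *v ?m))"
    by (intro sum.cong refl) (simp add: o inner_diff_left inner_diff_right matrix_vector_mult_diff_distrib)
  also have "\<dots> = (\<Sum>i=1..n. x i \<bullet> (A *v x i)) - n * (?m \<bullet> (A *v ?m))"
    by (simp add: sum.distrib sum_subtractf s1 s2 del: One_nat_def)
  finally show ?thesis using n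
    by (simp add: sample_cov_def inner_sum_right field_simps)
qed

lemma std_gaussian_norm_square:
  fixes X :: "'a \<Rightarrow> real^'n"
  assumes X: "std_gaussian M X"
  shows "integrable M (\<lambda>\<omega>. (norm (X \<omega>))\<^sup>2)" "(\<integral>\<omega>. (norm (X \<omega>))\<^sup>2 \<partial>M) = CARD('n)"
proof -
  have e: "(norm (x :: real^'n))\<^sup>2 = (\<Sum>b\<in>Basis. (b \<bullet> x)\<^sup>2)" for x
    unfolding power2_norm_eq_inner by (subst euclidean_inner) (simp add: power2_eq_square inner_commute)
  show "integrable M (\<lambda>\<omega>. (norm (X \<omega>))\<^sup>2)" unfolding e using std_gaussian_moments(1)[OF X] by auto
  show "(\<integral>\<omega>. (norm (X \<omega>))\<^sup>2 \<partial>M) = CARD('n)" unfolding e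
    by (simp add: std_gaussian_moments[OF X])
qed

lemma std_gaussian_sample_mean:
  fixes Y :: "nat \<Rightarrow> 'a \<Rightarrow> real^'n"
  assumes P: "prob_space M" and indep: "prob_space.indep_vars M (\<lambda>_. borel) Y {1..n}"
    and Y: "\<And>i. i \<in> {1..n} \<Longrightarrow> std_gaussian M (Y i)" and n: "0 < n"
  shows "std_gaussian M (\<lambda>\<omega>. sqrt n *\<^sub>R sample_mean n (\<lambda>i. Y i \<omega>))"
proof -
  let ?m = "\<lambda>\<omega>. sqrt n *\<^sub>R sample_mean n (\<lambda>i. Y i \<omega>)"
  interpret prob_space M by fact
  have Ym [measurable]: "i \<in> {1..n} \<Longrightarrow> Y i \<in> borel_measurable M" for i by (rule std_gaussian_measurable[OF Y])
  have meas [measurable]: "?m \<in> borel_measurable M"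
    by (intro borel_measurable_scaleR borel_measurable_sample_mean) (auto intro: Ym)
  have "distr M borel (\<lambda>\<omega>. a \<bullet> ?m \<omega>) = normal_measure 0 (a \<bullet> a)" for a
  proof (rule Levy_uniqueness)
    show "real_distribution (distr M borel (\<lambda>\<omega>. a \<bullet> ?m \<omega>))"
      by (rule real_distribution_distr) measurable
    interpret N: prob_space "normal_measure 0 (a \<bullet> a)" by (rule prob_space_normal_measure) simp
    show "real_distribution (normal_measure 0 (a \<bullet> a))"
      by unfold_locales (auto simp: normal_measure_def)
    show "char (distr M borel (\<lambda>\<omega>. a \<bullet> ?m \<omega>)) = char (normal_measure 0 (a \<bullet> a))"
    proof
      fix u
      have e: "a \<bullet> ?m \<omega> = (\<Sum>i=1..n. ((1 / sqrt n) *\<^sub>R a) \<bullet> Y i \<omega>)" for \<omega>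
      proof -
        have "sqrt n * (1 / n) = 1 / sqrt n" using n by (simp add: field_simps)
        then show ?thesis by (simp add: sample_mean_def inner_sum_right sum_distrib_left[symmetric] mult.assoc[symmetric])
             (simp add: sum_divide_distrib)
      qed
      have ind: "indep_vars (\<lambda>_. borel) (\<lambda>i \<omega>. ((1 / sqrt n) *\<^sub>R a) \<bullet> Y i \<omega>) {1..n}"
        by (rule indep_vars_compose2[OF indep]) auto
      have "char (distr M borel (\<lambda>\<omega>. ((1 / sqrt n) *\<^sub>R a) \<bullet> Y i \<omega>)) u = complex_of_real (exp (- ((a \<bullet> a) * u\<^sup>2) / 2 / n))"
        if "i \<in> {1..n}" for i
      proof -
        have d: "distr M borel (\<lambda>\<omega>. ((1 / sqrt n) *\<^sub>R a) \<bullet> Y i \<omega>)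
            = normal_measure 0 (((1 / sqrt n) *\<^sub>R a) \<bullet> ((1 / sqrt n) *\<^sub>R a))"
          using Y[OF that] unfolding std_gaussian_def by blast
        show ?thesis unfolding d char_normal_measure[OF inner_ge_zero] using n by (simp add: mult.commute)
      qed
      then have "char (distr M borel (\<lambda>\<omega>. a \<bullet> ?m \<omega>)) u
         = complex_of_real (exp (- ((a \<bullet> a) * u\<^sup>2) / 2 / n)) ^ n"
        unfolding e char_distr_sum[OF ind] by simp
      also have "\<dots> = complex_of_real (exp (- ((a \<bullet> a) * u\<^sup>2) / 2))"
        using n by (simp only: of_real_power[symmetric] exp_of_nat_mult[symmetric]) simp
      finally show "char (distr M borel (\<lambda>\<omega>. a \<bullet> ?m \<omega>)) u = char (normal_measure 0 (a \<bullet> a)) u"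
        by (simp add: char_normal_measure)
    qed
  qed
  then show ?thesis using meas by (simp add: std_gaussian_def)
qed

lemma iexp_diff_le: "cmod (iexp (a - b) - iexp a) \<le> \<bar>b\<bar>"
proof -
  have "iexp (a - b) - iexp a = iexp a * (iexp (- b) - 1)"
    by (simp add: algebra_simps exp_add[symmetric])
  then have "cmod (iexp (a - b) - iexp a) = cmod (iexp (- b) - 1)" by (simp add: norm_mult)
  also have "\<dots> \<le> \<bar>b\<bar>" using iexp_approx1[of "- b" 0] by simp
  finally show ?thesis .
qed

text \<open>The inner product of the normalised matrix with \<open>A\<close> is a normalised sum of centred quadratic
  forms of the observations, minus the correction \<open>m' A m / \<surd>n\<close> for centring at the sample mean,
  where \<open>m\<close> is \<open>\<surd>n\<close> times that mean. As \<open>m\<close> is standard Gaussian, the correction is of order \<open>1 / \<surd>n\<close>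
  in mean. The quadratic forms are independent with a common law that is the same in all rows, with
  mean \<open>0\<close> and variance \<open>goe_var A\<close>.\<close>

theorem normalized_sample_cov_cf_limit:
  fixes Y :: "nat \<Rightarrow> nat \<Rightarrow> 'a \<Rightarrow> real^'n" and A :: "real^'n^'n"
  assumes P: "\<And>n. 1 \<le> n \<Longrightarrow> prob_space (M n)"
    and indep: "\<And>n. 1 \<le> n \<Longrightarrow> prob_space.indep_vars (M n) (\<lambda>_. borel) (Y n) {1..n}"
    and Y: "\<And>n i. i \<in> {1..n} \<Longrightarrow> std_gaussian (M n) (Y n i)"
  shows "(\<lambda>n. cf (M n) (\<lambda>\<omega>. sqrt n *\<^sub>R (sample_cov n (\<lambda>i. Y n i \<omega>) - mat 1)) A)
     \<longlonglongrightarrow> complex_of_real (exp (- goe_var A / 2))"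
proof -
  define q where "q y = y \<bullet> (A *v y) - A \<bullet> mat 1" for y
  have qm [measurable]: "q \<in> borel_measurable borel" unfolding q_def by measurable
  define \<nu> where "\<nu> = distr (M 1) borel (\<lambda>\<omega>. q (Y 1 1 \<omega>))"
  have Y11: "std_gaussian (M 1) (Y 1 1)" by (rule Y) simp
  note [measurable] = std_gaussian_measurable[OF Y11]
  interpret P1: prob_space "M 1" by (rule P) simp
  have law: "distr (M n) borel (\<lambda>\<omega>. q (Y n i \<omega>)) = \<nu>" if "i \<in> {1..n}" for n i
  proof -
    note [measurable] = std_gaussian_measurable[OF Y[OF that]]
    have "distr (M n) borel (Y n i) = distr (M 1) borel (Y 1 1)"
      using that by (intro cf_uniqueness P) (auto simp: std_gaussian_cf[OF Y[OF that]] std_gaussian_cf[OF Y11]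
          intro!: std_gaussian_measurable[OF Y11] simp del: One_nat_def)
    then have "distr (distr (M n) borel (Y n i)) borel q = distr (distr (M 1) borel (Y 1 1)) borel q" by simp
    then show ?thesis by (simp add: distr_distr comp_def \<nu>_def del: One_nat_def)
  qed
  have \<nu>: "real_distribution \<nu>" unfolding \<nu>_def by (rule P1.real_distribution_distr) measurable
  note mom = quadratic_form_moments[OF P1.prob_space_axioms Y11, of A, folded q_def]
  have lim: "(\<lambda>n. char \<nu> (1 / sqrt n) ^ n) \<longlonglongrightarrow> complex_of_real (exp (- goe_var A / 2))"
    by (rule char_power_limit[OF \<nu>]) (use mom goe_var_nonneg in \<open>auto simp: \<nu>_def integrable_distr_eq integral_distr\<close>)
  have bound: "cmod (cf (M n) (\<lambda>\<omega>. sqrt n *\<^sub>R (sample_cov n (\<lambda>i. Y n i \<omega>) - mat 1)) A - char \<nu> (1 / sqrt n) ^ n)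
      \<le> norm A * CARD('n) * (1 / sqrt n)" if n: "1 \<le> n" for n
  proof -
    interpret prob_space "M n" by (rule P[OF n])
    have Ym [measurable]: "i \<in> {1..n} \<Longrightarrow> Y n i \<in> borel_measurable (M n)" for i by (rule std_gaussian_measurable[OF Y])
    define s where "s \<omega> = (\<Sum>i=1..n. q (Y n i \<omega>) / sqrt n)" for \<omega>
    define m where "m \<omega> = sqrt n *\<^sub>R sample_mean n (\<lambda>i. Y n i \<omega>)" for \<omega>
    have mg: "std_gaussian (M n) m"
      unfolding m_def using n by (intro std_gaussian_sample_mean[OF P indep]) (auto intro: Y)
    have sm [measurable]: "s \<in> borel_measurable (M n)" unfolding s_def
      by (intro borel_measurable_sum borel_measurable_divide measurable_compose[OF Ym qm]) auto
    note mm [measurable] = std_gaussian_measurable[OF mg]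
    have decomp: "A \<bullet> (sqrt n *\<^sub>R (sample_cov n (\<lambda>i. Y n i \<omega>) - mat 1)) = s \<omega> - (m \<omega> \<bullet> (A *v m \<omega>)) / sqrt n" for \<omega>
    proof -
      have r: "sqrt n * sqrt n = n" "sqrt n / n = 1 / sqrt n" using n by (simp_all add: field_simps)
      have a: "s \<omega> = sqrt n * ((\<Sum>i=1..n. Y n i \<omega> \<bullet> (A *v Y n i \<omega>)) / n - A \<bullet> mat 1)"
      proof -
        have "s \<omega> = (\<Sum>i=1..n. Y n i \<omega> \<bullet> (A *v Y n i \<omega>)) / sqrt n - n * (A \<bullet> mat 1) / sqrt n"
          by (simp add: s_def q_def sum_divide_distrib[symmetric] sum_subtractf diff_divide_distrib)
        also have "n * (A \<bullet> mat 1) / sqrt n = sqrt n * (A \<bullet> mat 1)" using n by (simp add: field_simps)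
        finally show ?thesis using r(2) by (simp add: right_diff_distrib) (simp add: divide_inverse mult_ac)
      qed
      have b: "(m \<omega> \<bullet> (A *v m \<omega>)) / sqrt n = sqrt n * (sample_mean n (\<lambda>i. Y n i \<omega>) \<bullet> (A *v sample_mean n (\<lambda>i. Y n i \<omega>)))"
        using n by (simp add: m_def matrix_vector_mult_scaleR)
      show ?thesis unfolding b a using n by (simp add: inner_diff_right inner_sample_cov algebra_simps)
    qed
    have ms: "(CLINT \<omega>|M n. iexp (s \<omega>)) = char \<nu> (1 / sqrt n) ^ n"
    proof -
      have ind: "indep_vars (\<lambda>_. borel) (\<lambda>i \<omega>. q (Y n i \<omega>) / sqrt n) {1..n}"
        by (rule indep_vars_compose2[OF indep[OF n]]) auto
      have "char (distr (M n) borel (\<lambda>\<omega>. q (Y n i \<omega>) / sqrt n)) 1 = char \<nu> (1 / sqrt n)" if "i \<in> {1..n}" for i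
        using Ym[OF that] unfolding law[OF that, symmetric] by (simp add: char_def integral_distr)
      then have "char (distr (M n) borel s) 1 = char \<nu> (1 / sqrt n) ^ n"
        unfolding s_def char_distr_sum[OF ind] by simp
      then show ?thesis by (simp add: char_def integral_distr)
    qed
    have mq: "\<bar>(m \<omega> \<bullet> (A *v m \<omega>)) / sqrt n\<bar> \<le> norm A / sqrt n * (norm (m \<omega>))\<^sup>2" for \<omega>
      using rayleigh_bound[of "m \<omega>" A] by (simp add: abs_divide divide_right_mono)
    have im: "integrable (M n) (\<lambda>\<omega>. norm A / sqrt n * (norm (m \<omega>))\<^sup>2)"
      using std_gaussian_norm_square(1)[OF mg] by simp
    have i1: "integrable (M n) (\<lambda>\<omega>. iexp (s \<omega> - (m \<omega> \<bullet> (A *v m \<omega>)) / sqrt n))"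
      by (rule integrable_const_bound[of _ 1]) auto
    have i2: "integrable (M n) (\<lambda>\<omega>. iexp (s \<omega>))" by (rule integrable_const_bound[of _ 1]) auto
    have "cmod ((CLINT \<omega>|M n. iexp (s \<omega> - (m \<omega> \<bullet> (A *v m \<omega>)) / sqrt n)) - (CLINT \<omega>|M n. iexp (s \<omega>)))
       = cmod (CLINT \<omega>|M n. iexp (s \<omega> - (m \<omega> \<bullet> (A *v m \<omega>)) / sqrt n) - iexp (s \<omega>))"
      by (simp only: Bochner_Integration.integral_diff[OF i1 i2])
    also have "\<dots> \<le> (\<integral>\<omega>. norm A / sqrt n * (norm (m \<omega>))\<^sup>2 \<partial>M n)"
    proof (rule order_trans[OF integral_norm_bound], rule integral_mono[OF _ im])
      show "integrable (M n) (\<lambda>\<omega>. cmod (iexp (s \<omega> - (m \<omega> \<bullet> (A *v m \<omega>)) / sqrt n) - iexp (s \<omega>)))"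
        by (intro integrable_norm Bochner_Integration.integrable_diff i1 i2)
      fix \<omega>
      show "cmod (iexp (s \<omega> - (m \<omega> \<bullet> (A *v m \<omega>)) / sqrt n) - iexp (s \<omega>)) \<le> norm A / sqrt n * (norm (m \<omega>))\<^sup>2"
        using iexp_diff_le[of "s \<omega>" "(m \<omega> \<bullet> (A *v m \<omega>)) / sqrt n"] mq[of \<omega>] by (rule order_trans)
    qed
    also have "\<dots> = norm A * CARD('n) * (1 / sqrt n)" by (simp add: std_gaussian_norm_square[OF mg])
    finally show ?thesis unfolding cf_def decomp ms .
  qed
  have "(\<lambda>n. norm A * CARD('n) * (1 / sqrt (real n))) \<longlonglongrightarrow> norm A * CARD('n) * 0"
    by (intro tendsto_mult tendsto_const tendsto_divide_0[OF tendsto_const] filterlim_at_top_imp_at_infinity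
         filterlim_compose[OF sqrt_at_top] filterlim_real_sequentially)
  then have z: "(\<lambda>n. norm A * CARD('n) * (1 / sqrt (real n))) \<longlonglongrightarrow> 0" by simp
  show ?thesis
    by (rule Lim_transform[OF lim]) (rule Lim_null_comparison[OF eventually_sequentiallyI[OF bound] z])
qed

section \<open>Measurability of the statistic\<close>

lemma borel_measurable_det [measurable]: "(det :: real^'n^'n \<Rightarrow> real) \<in> borel_measurable borel"
  by (rule borel_measurable_continuous_onI) (auto simp: continuous_on_def intro!: tendsto_det)

lemma borel_measurable_rayleigh_max [measurable]: "(rayleigh_max :: real^'n^'n \<Rightarrow> real) \<in> borel_measurable borel"
  by (rule borel_measurable_continuous_onI) (rule continuous_rayleigh_max)

text \<open>Where \<open>S\<close> is singular, \<^const>\<open>matrix_inv\<close> is one fixed matrix; elsewhere Cramer's rule applies.\<close>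

lemma borel_measurable_inverse_form [measurable]:
  "(\<lambda>S :: real^'n^'n. \<theta> \<bullet> (matrix_inv S *v \<theta>)) \<in> borel_measurable borel"
proof -
  let ?c = "\<theta> \<bullet> ((SOME A' :: real^'n^'n. False) *v \<theta>)"
  let ?A = "\<lambda>k (S :: real^'n^'n). \<chi> i j. if j = k then \<theta> $ i else S $ i $ j"
  have "matrix_inv S = (SOME A'. False)" if "det S = 0" for S :: "real^'n^'n"
  proof -
    have "\<not> invertible S" using that by (simp add: invertible_det_nz)
    then have "(\<lambda>A'. S ** A' = mat 1 \<and> A' ** S = mat 1) = (\<lambda>A'. False)" by (auto simp: invertible_def)
    then show ?thesis by (simp only: matrix_inv_def)
  qed
  then have e: "(\<lambda>S. \<theta> \<bullet> (matrix_inv S *v \<theta>)) = (\<lambda>S. if det S = 0 then ?c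
     else (\<Sum>k\<in>UNIV. \<theta> $ k * (det (?A k S) / det S)))"
    by (auto simp: fun_eq_iff matrix_inv_cramer inner_vec_def)
  have [measurable]: "?A k \<in> borel_measurable borel" for k
  proof (rule borel_measurable_continuous_onI, intro continuous_on_vec_lambda)
    fix i j show "continuous_on UNIV (\<lambda>S. if j = k then \<theta> $ i else S $ i $ j)"
      by (cases "j = k") (auto intro!: continuous_intros)
  qed
  show ?thesis unfolding e by measurable
qed

lemma borel_measurable_anderson_stat:
  fixes f :: "nat \<Rightarrow> 'a \<Rightarrow> real^'n"
  assumes "\<And>i. i \<in> {1..n} \<Longrightarrow> f i \<in> borel_measurable M"
  shows "(\<lambda>\<omega>. anderson_stat n \<theta> (\<lambda>i. f i \<omega>)) \<in> borel_measurable M"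
proof -
  note [measurable] = borel_measurable_sample_cov[OF assms]
  have [measurable]: "(\<lambda>\<omega>. \<theta> \<bullet> (matrix_inv (sample_cov n (\<lambda>i. f i \<omega>)) *v \<theta>)) \<in> borel_measurable M"
    by (rule measurable_compose[OF borel_measurable_sample_cov[OF assms] borel_measurable_inverse_form])
  have [measurable]: "(\<lambda>\<omega>. \<theta> \<bullet> (sample_cov n (\<lambda>i. f i \<omega>) *v \<theta>)) \<in> borel_measurable M"
    unfolding inner_outer_prod[symmetric] by measurable
  show ?thesis
    unfolding anderson_stat_def Let_def eigval_1_eq_rayleigh_max[OF transpose_sample_cov] by measurable
qed

section \<open>The limiting random matrix\<close>

text \<open>The law of the limiting matrix, expressed by linear forms in the inner product of matrices
  rather than by the vectorisation; it is that of the Gaussian orthogonal ensemble.\<close>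

definition goe :: "'a measure \<Rightarrow> ('a \<Rightarrow> real^'n^'n) \<Rightarrow> bool" where
  "goe N Z \<longleftrightarrow> Z \<in> borel_measurable N \<and>
     (\<forall>A. distr N borel (\<lambda>\<omega>. A \<bullet> Z \<omega>) = normal_measure 0 (goe_var A))"

lemma goe_measurable [measurable_dest]: "goe N Z \<Longrightarrow> Z \<in> borel_measurable N" by (simp add: goe_def)

lemma goe_cf:
  assumes "goe N Z" shows "cf N Z A = complex_of_real (exp (- goe_var A / 2))"
  using char_distr_inner[OF goe_measurable[OF assms], of A 1] assms
  by (simp add: goe_def char_normal_measure goe_var_nonneg)

lemma vec_of_inner: "vec_of A \<bullet> vec_of B = A \<bullet> B"
proof -
  have "vec_of A \<bullet> vec_of B = (\<Sum>(i, j)\<in>UNIV \<times> UNIV. A $ j $ i * B $ j $ i)"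
    by (simp add: inner_vec_def vec_of_def case_prod_unfold)
  also have "\<dots> = (\<Sum>i\<in>UNIV. \<Sum>j\<in>UNIV. A $ j $ i * B $ j $ i)" by (rule sum.cartesian_product[symmetric])
  also have "\<dots> = A \<bullet> B" by (subst sum.swap) (simp add: inner_vec_def)
  finally show ?thesis .
qed

lemma goe_of_multivariate_normal:
  fixes Z :: "'a \<Rightarrow> real^'n^'n"
  assumes "multivariate_normal N (\<lambda>\<omega>. vec_of (Z \<omega>)) 0 (mat 1 + commutation_matrix)"
  shows "goe N Z"
proof -
  have m: "(\<lambda>\<omega>. vec_of (Z \<omega>)) \<in> borel_measurable N" using assms by (simp add: multivariate_normal_def)
  let ?u = "\<lambda>x. \<chi> i j. x $ (j, i)"
  have "continuous_on UNIV ?u" by (intro continuous_intros)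
  then have "(\<lambda>\<omega>. ?u (vec_of (Z \<omega>))) \<in> borel_measurable N"
    using m borel_measurable_continuous_onI measurable_compose by blast
  moreover have "?u (vec_of (Z \<omega>)) = Z \<omega>" for \<omega> by (simp add: vec_eq_iff vec_of_def)
  ultimately have Zm: "Z \<in> borel_measurable N" by (simp only:)
  have "distr N borel (\<lambda>\<omega>. A \<bullet> Z \<omega>) = normal_measure 0 (goe_var A)" for A
  proof -
    have "distr N borel (\<lambda>\<omega>. vec_of A \<bullet> vec_of (Z \<omega>))
       = normal_measure (vec_of A \<bullet> 0) (vec_of A \<bullet> ((mat 1 + commutation_matrix) *v vec_of A))"
      using assms by (simp add: multivariate_normal_def)
    then show ?thesis
      by (simp add: vec_of_inner matrix_vector_mult_add_rdistrib commutation_matrix_vec_of inner_add_right goe_var_def)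
  qed
  then show ?thesis using Zm by (simp add: goe_def)
qed

lemma conj_inner:
  fixes U :: "real^'n^'n"
  shows "A \<bullet> (U ** B ** transpose U) = (transpose U ** A ** U) \<bullet> B"
  by (simp only: inner_matrix_mult_right[of A "U ** B" "transpose U"] inner_matrix_mult_left[of "A ** U"]
      transpose_transpose matrix_mul_assoc)

text \<open>Conjugation by an orthogonal matrix preserves both terms of \<^const>\<open>goe_var\<close>.\<close>

lemma goe_conj:
  assumes Z: "goe N Z" and U: "orthogonal_matrix U"
  shows "goe N (\<lambda>\<omega>. U ** Z \<omega> ** transpose U)"
proof -
  have "continuous_on UNIV (\<lambda>B. U ** B ** transpose U)"
    unfolding continuous_on_def by (auto intro!: tendsto_intros)
  then have m: "(\<lambda>\<omega>. U ** Z \<omega> ** transpose U) \<in> borel_measurable N"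
    using goe_measurable[OF Z] borel_measurable_continuous_onI measurable_compose by blast
  have UU: "U ** transpose U = mat 1" "transpose U ** U = mat 1" using U by (auto simp: orthogonal_matrix_def)
  have "goe_var (transpose U ** A ** U) = goe_var A" for A
  proof -
    let ?B = "transpose U ** A ** U"
    have c: "U ** (transpose U ** C ** U) ** transpose U = C" for C
    proof -
      have "U ** (transpose U ** C ** U) ** transpose U = (U ** transpose U) ** C ** (U ** transpose U)"
        by (simp only: matrix_mul_assoc)
      then show ?thesis by (simp add: UU)
    qed
    have "?B \<bullet> (transpose U ** C ** U) = A \<bullet> C" for C
      using conj_inner[of A U "transpose U ** C ** U"] c[of C] by simp
    then show ?thesis by (simp add: goe_var_def matrix_transpose_mul matrix_mul_assoc[symmetric]) 
  qed
  then have "distr N borel (\<lambda>\<omega>. A \<bullet> (U ** Z \<omega> ** transpose U)) = normal_measure 0 (goe_var A)" for A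
    unfolding conj_inner using Z by (simp add: goe_def)
  then show ?thesis using m by (simp add: goe_def)
qed

text \<open>Linear forms given by antisymmetric matrices have variance zero.\<close>

lemma goe_symmetric:
  fixes Z :: "'a \<Rightarrow> real^'n^'n"
  assumes Z: "goe N Z"
  shows "AE \<omega> in N. transpose (Z \<omega>) = Z \<omega>"
proof -
  have "AE \<omega> in N. Z \<omega> $ i $ j = Z \<omega> $ j $ i" for i j
  proof -
    define A where "A = outer_prod (axis i 1) (axis j 1) - outer_prod (axis j 1) (axis i (1::real))"
    have e: "outer_prod (axis a 1) (axis b 1) \<bullet> B = B $ a $ b" for a b and B :: "real^'n^'n"
      by (simp add: inner_outer_prod inner_axis' matrix_vector_mul_component inner_axis)
    have "goe_var A = 0"
    proof -
      have "transpose A = - A" by (simp add: A_def transpose_diff transpose_outer_prod)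
      then show ?thesis by (simp add: goe_var_def)
    qed
    then have d: "distr N borel (\<lambda>\<omega>. A \<bullet> Z \<omega>) = return borel 0"
      using Z by (simp add: goe_def normal_measure_def)
    have m: "(\<lambda>\<omega>. A \<bullet> Z \<omega>) \<in> borel_measurable N" using goe_measurable[OF Z] by simp
    have "AE x in distr N borel (\<lambda>\<omega>. A \<bullet> Z \<omega>). x = 0" unfolding d by (simp add: AE_return)
    then have "AE \<omega> in N. A \<bullet> Z \<omega> = 0" by (rule AE_distrD[OF m])
    then show ?thesis by (simp add: A_def inner_diff_left e)
  qed
  then have "AE \<omega> in N. \<forall>i\<in>UNIV. \<forall>j\<in>UNIV. Z \<omega> $ i $ j = Z \<omega> $ j $ i"
    by (intro AE_finite_allI finite)
  then show ?thesis by (rule AE_mp) (auto simp: transpose_def vec_eq_iff)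
qed

lemma continuous_det_krylov: "continuous_on UNIV (\<lambda>A :: real^'n^'n. det (krylov (A + C)))"
proof -
  have "continuous_on UNIV (\<lambda>A :: real^'n^'n. ((*v) (A + C) ^^ k) 1)" for k
  proof (induction k)
    case (Suc k)
    then show ?case unfolding continuous_on_def by (auto intro!: tendsto_intros)
  qed simp
  then have "continuous_on UNIV (\<lambda>A :: real^'n^'n. krylov (A + C))"
    unfolding krylov_def by (intro continuous_on_vec_lambda continuous_on_component)
  then show ?thesis unfolding continuous_on_def by (auto intro!: tendsto_det)
qed

text \<open>Let \<open>D\<close> be the diagonal matrix with distinct entries. The coefficient of \<open>Z\<close> along \<open>D\<close> is normal
  and independent of the remainder \<open>Z1\<close>, so \<open>Z\<close> has the same law as \<open>Z1 + t D\<close> with a new independent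
  normal variable \<open>t\<close>; this is checked by characteristic functions. For every value of \<open>Z1\<close>, only
  finitely many \<open>t\<close> make the determinant vanish, and Fubini's theorem concludes.\<close>

theorem goe_simple_spectrum:
  fixes Z :: "'a \<Rightarrow> real^'n^'n"
  assumes N: "prob_space N" and Z: "goe N Z" and card: "CARD('n) \<ge> 2"
  shows "AE \<omega> in N. det (krylov (Z \<omega> + C)) \<noteq> 0"
proof -
  interpret N: prob_space N by fact
  interpret P: real_distribution std_normal_distribution by (rule real_dist_normal_dist)
  interpret NP: pair_prob_space N std_normal_distribution ..
  note Zm [measurable] = goe_measurable[OF Z]
  let ?D = "idx_diag :: real^'n^'n"
  define d where "d = ?D \<bullet> ?D"
  have Dt: "transpose ?D = ?D" by (auto simp: idx_diag_def transpose_def vec_eq_iff)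
  have "d \<noteq> 0"
  proof
    assume "d = 0"
    then have "?D = 0" by (simp add: d_def)
    then have "?D $ i $ i = 0" for i :: 'n by simp
    then have "(idx :: 'n \<Rightarrow> nat) i = 0" for i by (simp add: idx_diag_def)
    then have "\<forall>i j :: 'n. i = j" using idx_eq_iff by metis
    then have "CARD('n) \<le> 1" by (simp add: card_le_Suc0_iff_eq)
    then show False using card by simp
  qed
  then have d: "0 < d" by (simp add: d_def)
  \<comment> \<open>The variance of \<open>D \<bullet> Z / d\<close> is \<open>2 d / d\<^sup>2\<close>.\<close>
  define c where "c = sqrt (2 / d)"
  have c: "c \<noteq> 0" "c\<^sup>2 = 2 / d" using d by (auto simp: c_def)
  define Z1 where "Z1 \<omega> = Z \<omega> - ((?D \<bullet> Z \<omega>) / d) *\<^sub>R ?D" for \<omega>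
  have Z1m [measurable]: "Z1 \<in> borel_measurable N" unfolding Z1_def by measurable
  define U where "U z = Z1 (fst z) + (c * snd z) *\<^sub>R ?D" for z :: "'a \<times> real"
  have Um [measurable]: "U \<in> borel_measurable (N \<Otimes>\<^sub>M std_normal_distribution)" unfolding U_def by measurable
  have cfU: "cf (N \<Otimes>\<^sub>M std_normal_distribution) U A = cf N Z A" for A
  proof -
    define a where "a = A \<bullet> ?D"
    define B where "B = A - (a / d) *\<^sub>R ?D"
    have BU: "A \<bullet> U z = B \<bullet> Z (fst z) + (c * a) * snd z" for z
      by (simp add: U_def Z1_def B_def inner_diff_left inner_diff_right inner_add_right a_def[symmetric])
    have dd: "?D \<bullet> ?D = d" by (simp add: d_def)
    have AD: "A \<bullet> ?D = a" "?D \<bullet> A = a" by (simp_all add: a_def inner_commute)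
    have TD: "transpose A \<bullet> ?D = a" "?D \<bullet> transpose A = a"
      using inner_transpose[of A ?D] by (simp_all add: Dt a_def inner_commute)
    have "B \<bullet> B = A \<bullet> A - 2 * (a / d) * a + (a / d)\<^sup>2 * d"
      unfolding B_def by (simp add: inner_diff_left inner_diff_right AD dd power2_eq_square)
    moreover have "B \<bullet> transpose B = A \<bullet> transpose A - 2 * (a / d) * a + (a / d)\<^sup>2 * d"
      unfolding B_def transpose_diff transpose_scaleR Dt
      by (simp add: inner_diff_left inner_diff_right AD TD dd power2_eq_square)
    moreover have "(a / d)\<^sup>2 * d = a\<^sup>2 / d" "2 * (a / d) * a = 2 * (a\<^sup>2 / d)"
      using d by (simp_all add: power2_eq_square)
    ultimately have vB: "goe_var B = goe_var A - 2 * a\<^sup>2 / d"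
      by (simp add: goe_var_def power2_eq_square)
    have i: "integrable (N \<Otimes>\<^sub>M std_normal_distribution) (\<lambda>z. iexp (A \<bullet> U z))"
      by (rule NP.integrable_const_bound[of _ 1]) auto
    have "cf (N \<Otimes>\<^sub>M std_normal_distribution) U A
       = (CLINT \<omega>|N. CLINT x|std_normal_distribution. iexp (A \<bullet> U (\<omega>, x)))"
      unfolding cf_def by (rule NP.integral_fst'[OF i, symmetric])
    also have "\<dots> = (CLINT \<omega>|N. iexp (B \<bullet> Z \<omega>) * char std_normal_distribution (c * a))"
      by (simp add: BU distrib_left exp_add char_def)
    also have "\<dots> = cf N Z B * char std_normal_distribution (c * a)" by (simp add: cf_def)
    also have "\<dots> = complex_of_real (exp (- goe_var B / 2) * exp (- ((c * a)\<^sup>2) / 2))"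
      by (simp add: goe_cf[OF Z] char_std_normal_distribution)
    also have "exp (- goe_var B / 2) * exp (- ((c * a)\<^sup>2) / 2) = exp (- goe_var A / 2)"
      by (simp add: exp_add[symmetric] vB power_mult_distrib c(2) diff_divide_distrib)
    finally show ?thesis by (simp add: goe_cf[OF Z])
  qed
  have law: "distr (N \<Otimes>\<^sub>M std_normal_distribution) borel U = distr N borel Z"
    by (rule cf_uniqueness[OF NP.prob_space_axioms N Um Zm cfU])
  have [measurable]: "(\<lambda>A. det (krylov (A + C))) \<in> borel_measurable borel"
    by (rule borel_measurable_continuous_onI[OF continuous_det_krylov])
  have "AE z in N \<Otimes>\<^sub>M std_normal_distribution. det (krylov (U z + C)) \<noteq> 0"
  proof (rule NP.AE_pair_measure)
    show "{z \<in> space (N \<Otimes>\<^sub>M std_normal_distribution). det (krylov (U z + C)) \<noteq> 0}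
        \<in> sets (N \<Otimes>\<^sub>M std_normal_distribution)" by measurable
    show "AE \<omega> in N. AE x in std_normal_distribution. det (krylov (U (\<omega>, x) + C)) \<noteq> 0"
    proof (rule AE_I2)
      fix \<omega>
      let ?F = "{t. det (krylov ((Z1 \<omega> + C) + t *\<^sub>R ?D)) = 0}"
      have "finite ((\<lambda>x. c * x) -` ?F)"
        using c by (intro finite_vimageI finite_non_cyclic_line) (auto simp: inj_def)
      then have "AE x in lborel. x \<notin> (\<lambda>x. c * x) -` ?F"
        by (intro AE_not_in finite_imp_null_set_lborel)
      then show "AE x in std_normal_distribution. det (krylov (U (\<omega>, x) + C)) \<noteq> 0"
        by (subst AE_density) (auto simp: U_def algebra_simps elim!: AE_mp)
    qed
  qed
  then have "AE A in distr (N \<Otimes>\<^sub>M std_normal_distribution) borel U. det (krylov (A + C)) \<noteq> 0"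
    by (subst AE_distr_iff) auto
  then show ?thesis unfolding law by (subst (asm) AE_distr_iff) auto
qed

section \<open>The chi-square law\<close>

lemma perp_comp_inner: "t \<bullet> perp_comp e x = perp_comp e t \<bullet> x"
  by (simp add: perp_comp_def inner_diff_left inner_diff_right inner_commute)

text \<open>The column of \<open>Z\<close> with index \<open>k\<close> has independent standard normal entries off the diagonal: the vector of
  these entries has the characteristic function of a standard Gaussian vector in \<open>n - 1\<close>
  dimensions.\<close>

theorem goe_chi_square:
  fixes Z :: "'a \<Rightarrow> real^'n^'n" and k :: 'n
  assumes N: "prob_space N" and Z: "goe N Z"
  defines "e \<equiv> axis k 1"
  shows "distr N borel (\<lambda>\<omega>. (norm (perp_comp e (Z \<omega> *v e)))\<^sup>2) = chi_square (CARD('n) - 1)"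
proof -
  let ?l = "CARD('n) - 1"
  interpret P: real_distribution std_normal_distribution by (rule real_dist_normal_dist)
  interpret L: product_prob_space "\<lambda>_::nat. std_normal_distribution" "{..<?l}" ..
  define L where "L = Pi\<^sub>M {..<?l} (\<lambda>_::nat. std_normal_distribution)"
  have "card (UNIV - {k}) = card {..<?l}" by simp
  then obtain \<kappa> where \<kappa>: "bij_betw \<kappa> {..<?l} (UNIV - {k})"
    using finite_same_card_bij[of "{..<?l}" "UNIV - {k}"] by auto
  then have inj: "inj_on \<kappa> {..<?l}" by (simp add: bij_betw_def)
  \<comment> \<open>A Gaussian vector with vanishing \<open>k\<close>-th coordinate, built on the product space of the chi-square definition.\<close>
  define \<eta> where "\<eta> x = (\<Sum>j<?l. x j *\<^sub>R axis (\<kappa> j) (1::real))" for x :: "nat \<Rightarrow> real"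
  have \<eta>m [measurable]: "\<eta> \<in> borel_measurable L" unfolding \<eta>_def L_def by measurable
  have t\<eta>: "t \<bullet> \<eta> x = (\<Sum>j<?l. t $ \<kappa> j * x j)" for t x
    by (simp add: \<eta>_def inner_sum_right inner_axis mult.commute)
  have comp: "\<eta> x $ \<kappa> j = x j" if "j < ?l" for x j
  proof -
    have "\<eta> x $ \<kappa> j = (\<Sum>i<?l. if i = j then x i else 0)"
      unfolding \<eta>_def sum_component using inj that
      by (intro sum.cong refl) (auto simp: axis_def inj_on_eq_iff)
    then show ?thesis using that by simp
  qed
  have \<eta>2: "(norm (\<eta> x))\<^sup>2 = (\<Sum>j<?l. (x j)\<^sup>2)" for x
    unfolding power2_norm_eq_inner t\<eta> by (simp add: comp power2_eq_square)
  have cf\<eta>: "cf L \<eta> t = complex_of_real (exp (- (\<Sum>j<?l. (t $ \<kappa> j)\<^sup>2) / 2))" for t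
  proof -
    have "cf L \<eta> t = (CLINT x|L. (\<Prod>j<?l. iexp (t $ \<kappa> j * x j)))"
      by (simp add: cf_def t\<eta> sum_distrib_left exp_sum)
    also have "\<dots> = (\<Prod>j<?l. CLINT x|std_normal_distribution. iexp (t $ \<kappa> j * x))"
      unfolding L_def by (rule L.product_integral_prod) (auto intro!: P.integrable_const_bound[of _ 1])
    also have "\<dots> = (\<Prod>j<?l. char std_normal_distribution (t $ \<kappa> j))" by (simp add: char_def)
    also have "\<dots> = complex_of_real (exp (- (\<Sum>j<?l. (t $ \<kappa> j)\<^sup>2) / 2))"
      by (simp add: char_std_normal_distribution of_real_prod[symmetric] exp_sum[symmetric]
          sum_negf sum_divide_distrib del: of_real_prod of_real_exp)
    finally show ?thesis .
  qed
  define \<xi> where "\<xi> \<omega> = perp_comp e (Z \<omega> *v e)" for \<omega>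
  have pc: "continuous_on UNIV (\<lambda>A. perp_comp e (A *v e))"
    unfolding continuous_on_def perp_comp_def by (auto intro!: tendsto_intros)
  have \<xi>m [measurable]: "\<xi> \<in> borel_measurable N" unfolding \<xi>_def
    by (rule measurable_compose[OF goe_measurable[OF Z] borel_measurable_continuous_onI[OF pc]])
  have cf\<xi>: "cf N \<xi> t = complex_of_real (exp (- (\<Sum>j<?l. (t $ \<kappa> j)\<^sup>2) / 2))" for t
  proof -
    let ?A = "outer_prod (perp_comp e t) e"
    have ee: "e \<bullet> e = 1" by (simp add: e_def inner_axis_axis)
    have pe: "perp_comp e t \<bullet> e = 0" unfolding perp_comp_def by (simp add: inner_diff_left ee inner_commute[of t e])
    have "goe_var ?A = perp_comp e t \<bullet> perp_comp e t"
      by (simp add: goe_var_def transpose_outer_prod inner_outer_prod outer_prod_vec ee pe pe[unfolded inner_commute[of _ e]])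
    also have "\<dots> = t \<bullet> t - (t $ k)\<^sup>2"
      by (simp add: perp_comp_def inner_diff_left inner_diff_right ee)
         (simp add: e_def inner_axis inner_axis' power2_eq_square)
    also have "t \<bullet> t = (\<Sum>i\<in>UNIV. (t $ i)\<^sup>2)" by (simp add: inner_vec_def power2_eq_square)
    also have "(\<Sum>i\<in>UNIV. (t $ i)\<^sup>2) - (t $ k)\<^sup>2 = (\<Sum>i\<in>UNIV - {k}. (t $ i)\<^sup>2)"
      by (simp add: sum_diff1)
    also have "\<dots> = (\<Sum>j<?l. (t $ \<kappa> j)\<^sup>2)" by (rule sum.reindex_bij_betw[OF \<kappa>, symmetric])
    finally have "goe_var ?A = (\<Sum>j<?l. (t $ \<kappa> j)\<^sup>2)" .
    moreover have "t \<bullet> \<xi> \<omega> = ?A \<bullet> Z \<omega>" for \<omega>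
      by (simp add: \<xi>_def perp_comp_inner inner_outer_prod)
    ultimately show ?thesis using goe_cf[OF Z, of ?A] by (simp add: cf_def)
  qed
  have "prob_space L" unfolding L_def by (rule L.prob_space_axioms)
  have "distr N borel \<xi> = distr L borel \<eta>"
    by (rule cf_uniqueness) (simp_all add: N \<open>prob_space L\<close> cf\<xi> cf\<eta>)
  then have "distr (distr N borel \<xi>) borel (\<lambda>x. (norm x)\<^sup>2) = distr (distr L borel \<eta>) borel (\<lambda>x. (norm x)\<^sup>2)" by simp
  then have "distr N borel (\<lambda>\<omega>. (norm (\<xi> \<omega>))\<^sup>2) = distr L borel (\<lambda>x. (norm (\<eta> x))\<^sup>2)"
    by (simp add: distr_distr comp_def)
  then show ?thesis by (simp add: \<xi>_def \<eta>2 chi_square_def L_def)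
qed

lemma real_distribution_chi_square: "real_distribution (chi_square l)"
proof -
  interpret P: real_distribution std_normal_distribution by (rule real_dist_normal_dist)
  interpret L: product_prob_space "\<lambda>_::nat. std_normal_distribution" "{..<l}" ..
  show ?thesis unfolding chi_square_def by (rule L.real_distribution_distr) measurable
qed

text \<open>Given all other coordinates, at most two values of the last coordinate yield the sum \<open>c\<close>.\<close>

lemma chi_square_no_atom:
  assumes "0 < l" shows "measure (chi_square l) {c} = 0"
proof -
  obtain m where l: "l = Suc m" using assms gr0_conv_Suc by auto
  interpret P: real_distribution std_normal_distribution by (rule real_dist_normal_dist)
  interpret L: product_prob_space "\<lambda>_::nat. std_normal_distribution" UNIV ..
  let ?P = "\<lambda>_::nat. std_normal_distribution"
  have ins: "{..<l} = insert m {..<m}" by (auto simp: l)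
  have "emeasure (chi_square l) {c} = (\<integral>\<^sup>+x. indicator {c} x \<partial>chi_square l)"
    by (simp add: chi_square_def)
  also have "\<dots> = (\<integral>\<^sup>+x. indicator {c} (\<Sum>i<l. (x i)\<^sup>2) \<partial>Pi\<^sub>M (insert m {..<m}) ?P)"
    unfolding chi_square_def by (subst nn_integral_distr) (auto simp: ins)
  also have "\<dots> = (\<integral>\<^sup>+x. \<integral>\<^sup>+y. indicator {c} (\<Sum>i<l. ((x(m := y)) i)\<^sup>2) \<partial>std_normal_distribution \<partial>Pi\<^sub>M {..<m} ?P)"
    by (subst L.product_nn_integral_insert) (auto simp: ins)
  also have "\<dots> = (\<integral>\<^sup>+x. 0 \<partial>Pi\<^sub>M {..<m} ?P)"
  proof (rule nn_integral_cong)
    fix x :: "nat \<Rightarrow> real"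
    let ?s = "\<Sum>i<m. (x i)\<^sup>2"
    have s: "(\<Sum>i<l. ((x(m := y)) i)\<^sup>2) = ?s + y\<^sup>2" for y by (simp add: l)
    have "{y. ?s + y\<^sup>2 = c} \<subseteq> {sqrt (c - ?s), - sqrt (c - ?s)}"
    proof
      fix y assume "y \<in> {y. ?s + y\<^sup>2 = c}"
      then have "sqrt (c - ?s) = \<bar>y\<bar>" by (auto simp: real_sqrt_abs[symmetric] simp del: real_sqrt_abs)
      then show "y \<in> {sqrt (c - ?s), - sqrt (c - ?s)}" by (auto simp: abs_if split: if_splits)
    qed
    then have "finite {y. ?s + y\<^sup>2 = c}" by (rule finite_subset) simp
    then have "AE y in lborel. y \<notin> {y. ?s + y\<^sup>2 = c}" by (intro AE_not_in finite_imp_null_set_lborel)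
    then have "AE y in std_normal_distribution. indicator {c} (\<Sum>i<l. ((x(m := y)) i)\<^sup>2) = (0::ennreal)"
      unfolding s by (subst AE_density) (auto elim!: AE_mp)
    then show "(\<integral>\<^sup>+y. indicator {c} (\<Sum>i<l. ((x(m := y)) i)\<^sup>2) \<partial>std_normal_distribution) = 0"
      by (subst nn_integral_cong_AE[where v = "\<lambda>_. 0"]) auto
  qed
  finally show ?thesis by (simp add: measure_def)
qed

lemma (in real_distribution) cdf_quantile:
  assumes atomless: "\<And>x. measure M {x} = 0" and \<alpha>: "0 < \<alpha>" "\<alpha> < 1"
  shows "cdf M (Inf {x. cdf M x \<ge> 1 - \<alpha>}) = 1 - \<alpha>"
proof -
  let ?S = "{x. cdf M x \<ge> 1 - \<alpha>}" and ?q = "Inf {x. cdf M x \<ge> 1 - \<alpha>}"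
  have cont: "isCont (cdf M) x" for x using atomless by (simp add: isCont_cdf)
  then have conton: "continuous_on UNIV (cdf M)" by (simp add: continuous_at_imp_continuous_on)
  have "eventually (\<lambda>x. 1 - \<alpha> < cdf M x) at_top"
    using cdf_lim_at_top_prob \<alpha> by (intro order_tendstoD(1)) auto
  then have ne: "?S \<noteq> {}" by (auto simp: eventually_at_top_linorder intro: less_imp_le)
  have "eventually (\<lambda>x. cdf M x < 1 - \<alpha>) at_bot"
    using cdf_lim_at_bot \<alpha> by (intro order_tendstoD(2)) auto
  then obtain b where b: "cdf M b < 1 - \<alpha>" by (auto simp: eventually_at_bot_linorder)
  have bdd: "bdd_below ?S"
  proof (rule bdd_belowI)
    fix x assume "x \<in> ?S"
    then show "b \<le> x" using b cdf_nondecreasing[of x b] by (cases "b \<le> x") auto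
  qed
  have "closed ?S" using conton by (intro closed_Collect_le) auto
  then have "?q \<in> ?S" using ne bdd by (intro closed_contains_Inf)
  moreover have "cdf M ?q \<le> 1 - \<alpha>"
  proof (rule tendsto_upperbound)
    show "(cdf M \<longlongrightarrow> cdf M ?q) (at_left ?q)" using cont[of ?q] by (simp add: isCont_def filterlim_at_split)
    show "eventually (\<lambda>x. cdf M x \<le> 1 - \<alpha>) (at_left ?q)"
      unfolding eventually_at_filter
    proof (rule always_eventually, intro allI impI)
      fix x assume "x \<in> {..<?q}"
      then have "x \<notin> ?S" using cInf_lower[OF _ bdd, of x] by auto
      then show "cdf M x \<le> 1 - \<alpha>" by simp
    qed
  qed simp
  ultimately show ?thesis by simp
qed

section \<open>Weak limits of the statistic\<close>

lemma spike_whitening: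
  assumes "norm \<theta> = 1" "0 \<le> \<rho>"
  defines "W \<equiv> spike \<theta> (1 / sqrt (1 + \<rho>) - 1)"
  shows "W ** spike \<theta> \<rho> ** W = mat 1" "spike \<theta> (sqrt (1 + \<rho>) - 1) ** W = mat 1"
proof -
  define s where "s = sqrt (1 + \<rho>)"
  have s: "s \<noteq> 0" "\<rho> = s * s - 1" using assms(2) by (auto simp: s_def)
  have z: "spike \<theta> 0 = mat 1" by (simp add: spike_def)
  have a: "1 / s - 1 + \<rho> + (1 / s - 1) * \<rho> = s - 1" unfolding s(2) using s(1) by (simp add: field_simps)
  have b: "s - 1 + (1 / s - 1) + (s - 1) * (1 / s - 1) = 0" using s(1) by (simp add: field_simps)
  show "spike \<theta> (sqrt (1 + \<rho>) - 1) ** W = mat 1"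
    unfolding W_def s_def[symmetric] spike_mult[OF assms(1)] b z ..
  then show "W ** spike \<theta> \<rho> ** W = mat 1"
    unfolding W_def s_def[symmetric] spike_mult[OF assms(1)] a .
qed

text \<open>The factor is the inverse of the symmetric square root of the covariance matrix.\<close>

lemma multivariate_normal_whitening:
  assumes \<theta>: "norm \<theta> = 1" and \<rho>: "0 \<le> \<rho>"
    and X: "multivariate_normal M X 0 (mat 1 + \<rho> *\<^sub>R outer_prod \<theta> \<theta>)"
  shows "std_gaussian M (\<lambda>\<omega>. spike \<theta> (1 / sqrt (1 + \<rho>) - 1) *v X \<omega>)"
proof -
  let ?W = "spike \<theta> (1 / sqrt (1 + \<rho>) - 1)"
  have Xm [measurable]: "X \<in> borel_measurable M" using X by (simp add: multivariate_normal_def)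
  have "distr M borel (\<lambda>\<omega>. a \<bullet> (?W *v X \<omega>)) = normal_measure 0 (a \<bullet> a)" for a
  proof -
    have "a \<bullet> (?W *v X \<omega>) = (?W *v a) \<bullet> X \<omega>" for \<omega> by (rule symmetric_inner[OF transpose_spike])
    moreover have "distr M borel (\<lambda>\<omega>. (?W *v a) \<bullet> X \<omega>)
        = normal_measure ((?W *v a) \<bullet> 0) ((?W *v a) \<bullet> (spike \<theta> \<rho> *v (?W *v a)))"
      using X by (simp add: multivariate_normal_def spike_def)
    moreover have "(?W *v a) \<bullet> (spike \<theta> \<rho> *v (?W *v a)) = a \<bullet> (?W *v (spike \<theta> \<rho> *v (?W *v a)))"
      by (rule symmetric_inner[OF transpose_spike, symmetric])
    moreover have "?W *v (spike \<theta> \<rho> *v (?W *v a)) = a"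
      using spike_whitening(1)[OF \<theta> \<rho>] by (simp add: matrix_vector_mul_assoc matrix_mul_assoc)
    ultimately show ?thesis by simp
  qed
  then show ?thesis by (simp add: std_gaussian_def)
qed

lemma sample_cov_linear:
  fixes T :: "real^'n^'n"
  assumes n: "0 < n"
  shows "sample_cov n (\<lambda>i. T *v y i) = T ** sample_cov n y ** transpose T"
proof (rule iffD1[OF vector_eq_rdot], rule allI)
  fix A :: "real^'n^'n"
  have m: "sample_mean n (\<lambda>i. T *v y i) = T *v sample_mean n y"
    by (simp add: sample_mean_def matrix_vector_mult_scaleR vec.sum)
  have q: "(T *v x) \<bullet> (A *v (T *v x)) = x \<bullet> ((transpose T ** A ** T) *v x)" for x
    by (simp add: matrix_vector_mul_assoc[symmetric])
      (metis dot_lmul_matrix inner_commute transpose_matrix_vector)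
  have "A \<bullet> sample_cov n (\<lambda>i. T *v y i) = (transpose T ** A ** T) \<bullet> sample_cov n y"
    unfolding inner_sample_cov[OF n] m q ..
  then show "sample_cov n (\<lambda>i. T *v y i) \<bullet> A = (T ** sample_cov n y ** transpose T) \<bullet> A"
    by (simp add: conj_inner inner_commute[of _ A])
qed

lemma anderson_stat_eq: "anderson_stat n \<theta> x = anderson_of (real n) \<theta> (sample_cov n x)"
  by (simp add: anderson_stat_def anderson_of_def Let_def)

text \<open>The model starts with sample size \<open>1\<close>, so limit theorems for sequences of probability spaces are
  applied to the shifted sequence.\<close>

lemma weak_conv_m_Suc: "weak_conv_m (\<lambda>n. D (Suc n)) D' \<Longrightarrow> weak_conv_m D D'"
  unfolding weak_conv_m_def weak_conv_def by (simp add: filterlim_sequentially_Suc[of "\<lambda>n. cdf (D n) x" for x])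

text \<open>Whitening makes the statistic a function of the normalised sample covariance matrix \<open>G n\<close> of
  standard Gaussian vectors. Since \<open>G n\<close> converges in law to \<open>Z\<close> whatever the sequence \<open>r\<close>, only the
  deterministic limit of these functions distinguishes the regimes.\<close>

theorem anderson_weak_limit:
  fixes X :: "nat \<Rightarrow> nat \<Rightarrow> 'a \<Rightarrow> real^'n" and Z :: "'b \<Rightarrow> real^'n^'n"
  assumes \<theta>: "norm \<theta> = 1" and v: "0 < v" and r: "\<forall>n\<ge>1. 0 < r n"
    and model: "spiked_model M X \<theta> r v" and N: "prob_space N" and Z: "goe N Z"
    and H: "continuous_on UNIV H"
    and lim: "\<And>\<sigma> g g'. strict_mono \<sigma> \<Longrightarrow> (\<And>k. transpose (g k) = g k) \<Longrightarrow> g \<longlonglongrightarrow> g' \<Longrightarrow>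
      (\<lambda>k. rescaled_stat \<theta> (r (Suc (\<sigma> k)) * v) (sqrt (real (Suc (\<sigma> k)))) (g k)) \<longlonglongrightarrow> H g'"
  shows "weak_conv_m (\<lambda>n. distr (M n) borel (\<lambda>\<omega>. anderson_stat n \<theta> (\<lambda>i. X n i \<omega>)))
      (distr N borel (\<lambda>\<omega>. H (Z \<omega>)))"
proof -
  have P: "prob_space (M n)" and indep: "prob_space.indep_vars (M n) (\<lambda>_. borel) (X n) {1..n}"
    and Xn: "\<And>i. i \<in> {1..n} \<Longrightarrow> multivariate_normal (M n) (X n i) 0 (mat 1 + (r n * v) *\<^sub>R outer_prod \<theta> \<theta>)"
    if "1 \<le> n" for n
    using model that unfolding spiked_model_def by blast+
  have Xm: "X n i \<in> borel_measurable (M n)" if "i \<in> {1..n}" for n i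
    using Xn[of n i] that by (simp add: multivariate_normal_def)
  have \<rho>: "0 \<le> r n * v" if "1 \<le> n" for n using r v that by (simp add: less_imp_le)
  define Y where "Y n i \<omega> = spike \<theta> (1 / sqrt (1 + r n * v) - 1) *v X n i \<omega>" for n i \<omega>
  have Y: "std_gaussian (M n) (Y n i)" if "i \<in> {1..n}" for n i
    unfolding Y_def using that by (intro multivariate_normal_whitening[OF \<theta> \<rho> Xn]) auto
  have Yind: "prob_space.indep_vars (M n) (\<lambda>_. borel) (Y n) {1..n}" if "1 \<le> n" for n
  proof -
    interpret prob_space "M n" by (rule P[OF that])
    show ?thesis unfolding Y_def by (rule indep_vars_compose2[OF indep[OF that]]) auto
  qed
  define G where "G n \<omega> = sqrt (real n) *\<^sub>R (sample_cov n (\<lambda>i. Y n i \<omega>) - mat 1)" for n \<omega>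
  have Gcf: "(\<lambda>n. cf (M n) (G n) A) \<longlonglongrightarrow> cf N Z A" for A
    unfolding G_def goe_cf[OF Z] by (rule normalized_sample_cov_cf_limit) (use P Yind Y in auto)
  have Gm: "G n \<in> borel_measurable (M n)" for n
    unfolding G_def using borel_measurable_sample_cov[of n "Y n" "M n"] std_gaussian_measurable[OF Y]
    by (intro borel_measurable_scaleR borel_measurable_diff) auto
  interpret cf_limit "\<lambda>n. M (Suc n)" "\<lambda>n. G (Suc n)" N Z
    using P N Gm goe_measurable[OF Z] LIMSEQ_Suc[OF Gcf] by (intro cf_limit.intro) auto
  have stat: "anderson_stat n \<theta> (\<lambda>i. X n i \<omega>) = rescaled_stat \<theta> (r n * v) (sqrt (real n)) (G n \<omega>)" if n: "1 \<le> n" for n \<omega>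
  proof -
    let ?T = "spike \<theta> (sqrt (1 + r n * v) - 1)"
    have "?T *v Y n i \<omega> = X n i \<omega>" for i
      using spike_whitening(2)[OF \<theta> \<rho>[OF n]] by (simp add: Y_def matrix_vector_mul_assoc)
    then have "sample_cov n (\<lambda>i. X n i \<omega>) = ?T ** sample_cov n (\<lambda>i. Y n i \<omega>) ** ?T"
      using sample_cov_linear[of n ?T "\<lambda>i. Y n i \<omega>"] n by (simp add: transpose_spike)
    moreover have "mat 1 + (1 / sqrt (real n)) *\<^sub>R G n \<omega> = sample_cov n (\<lambda>i. Y n i \<omega>)"
      using n by (simp add: G_def)
    ultimately show ?thesis by (simp add: anderson_stat_eq rescaled_stat_def spiked_cov_def)
  qed
  have "weak_conv_m (\<lambda>n. distr (M (Suc n)) borel (\<lambda>\<omega>. anderson_stat (Suc n) \<theta> (\<lambda>i. X (Suc n) i \<omega>)))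
      (distr N borel (\<lambda>\<omega>. H (Z \<omega>)))"
  proof (rule continuous_mapping[OF H, where C = "{A. transpose A = A}"
        and h = "\<lambda>n. rescaled_stat \<theta> (r (Suc n) * v) (sqrt (real (Suc n)))"])
    show "(\<lambda>\<omega>. anderson_stat (Suc n) \<theta> (\<lambda>i. X (Suc n) i \<omega>)) \<in> borel_measurable (M (Suc n))" for n
      by (rule borel_measurable_anderson_stat) (rule Xm)
    show "G (Suc n) \<omega> \<in> {A. transpose A = A}" for n \<omega>
      by (simp add: G_def transpose_scaleR transpose_diff transpose_sample_cov)
  qed (use stat lim in auto)
  then show ?thesis by (rule weak_conv_m_Suc)
qed

lemma filterlim_Suc_subseq: "strict_mono \<sigma> \<Longrightarrow> filterlim (\<lambda>k. Suc (\<sigma> k)) sequentially sequentially"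
  by (rule filterlim_subseq) (auto simp: strict_mono_def)

corollary anderson_weak_limit_weak_spike:
  fixes X :: "nat \<Rightarrow> nat \<Rightarrow> 'a \<Rightarrow> real^'n" and Z :: "'b \<Rightarrow> real^'n^'n"
  assumes \<theta>: "norm \<theta> = 1" and v: "0 < v" and r: "\<forall>n\<ge>1. 0 < r n"
    and model: "spiked_model M X \<theta> r v" and N: "prob_space N" and Z: "goe N Z"
    and c: "(\<lambda>n. sqrt (real n) * (r n * v)) \<longlonglongrightarrow> c"
  defines "H \<equiv> \<lambda>W. (norm (W *v \<theta> - rayleigh_max W *\<^sub>R \<theta>))\<^sup>2"
  shows "weak_conv_m (\<lambda>n. distr (M n) borel (\<lambda>\<omega>. anderson_stat n \<theta> (\<lambda>i. X n i \<omega>)))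
      (distr N borel (\<lambda>\<omega>. H (Z \<omega> + c *\<^sub>R outer_prod \<theta> \<theta>)))"
proof (rule anderson_weak_limit[OF \<theta> v r model N Z])
  show "continuous_on UNIV (\<lambda>A. H (A + c *\<^sub>R outer_prod \<theta> \<theta>))"
    unfolding H_def continuous_on_def by (auto intro!: tendsto_intros tendsto_rayleigh_max)
  fix \<sigma> :: "nat \<Rightarrow> nat" and g :: "nat \<Rightarrow> real^'n^'n" and g'
  assume \<sigma>: "strict_mono \<sigma>" and g: "\<And>k. transpose (g k) = g k" "g \<longlonglongrightarrow> g'"
  note s = filterlim_Suc_subseq[OF \<sigma>]
  show "(\<lambda>k. rescaled_stat \<theta> (r (Suc (\<sigma> k)) * v) (sqrt (real (Suc (\<sigma> k)))) (g k)) \<longlonglongrightarrow> H (g' + c *\<^sub>R outer_prod \<theta> \<theta>)"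
    unfolding H_def
  proof (rule anderson_limit_weak_spike[OF \<theta> _ _ _ _ g])
    show "filterlim (\<lambda>k. sqrt (real (Suc (\<sigma> k)))) at_top sequentially"
      by (rule filterlim_compose[OF filterlim_compose[OF sqrt_at_top filterlim_real_sequentially] s])
    show "(\<lambda>k. sqrt (real (Suc (\<sigma> k))) * (r (Suc (\<sigma> k)) * v)) \<longlonglongrightarrow> c"
      by (rule filterlim_compose[OF c s])
  qed (use r v in \<open>auto simp: less_imp_le\<close>)
qed

corollary anderson_weak_limit_strong_spike:
  fixes X :: "nat \<Rightarrow> nat \<Rightarrow> 'a \<Rightarrow> real^'n" and Z :: "'b \<Rightarrow> real^'n^'n"
  assumes \<theta>: "norm \<theta> = 1" and v: "0 < v" and r: "\<forall>n\<ge>1. 0 < r n"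
    and model: "spiked_model M X \<theta> r v" and N: "prob_space N" and Z: "goe N Z"
    and r': "r \<longlonglongrightarrow> r'" and c: "filterlim (\<lambda>n. sqrt (real n) * r n) at_top sequentially"
  shows "weak_conv_m (\<lambda>n. distr (M n) borel (\<lambda>\<omega>. anderson_stat n \<theta> (\<lambda>i. X n i \<omega>)))
      (distr N borel (\<lambda>\<omega>. (norm (perp_comp \<theta> (Z \<omega> *v \<theta>)))\<^sup>2))"
proof (rule anderson_weak_limit[OF \<theta> v r model N Z])
  show "continuous_on UNIV (\<lambda>A. (norm (perp_comp \<theta> (A *v \<theta>)))\<^sup>2)"
    unfolding perp_comp_def continuous_on_def by (auto intro!: tendsto_intros)
  fix \<sigma> :: "nat \<Rightarrow> nat" and g :: "nat \<Rightarrow> real^'n^'n" and g'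
  assume \<sigma>: "strict_mono \<sigma>" and g: "\<And>k. transpose (g k) = g k" "g \<longlonglongrightarrow> g'"
  note s = filterlim_Suc_subseq[OF \<sigma>]
  show "(\<lambda>k. rescaled_stat \<theta> (r (Suc (\<sigma> k)) * v) (sqrt (real (Suc (\<sigma> k)))) (g k)) \<longlonglongrightarrow> (norm (perp_comp \<theta> (g' *v \<theta>)))\<^sup>2"
  proof (rule anderson_limit_strong_spike[OF \<theta> _ _ _ _ _ g])
    show "filterlim (\<lambda>k. sqrt (real (Suc (\<sigma> k)))) at_top sequentially"
      by (rule filterlim_compose[OF filterlim_compose[OF sqrt_at_top filterlim_real_sequentially] s])
    show "(\<lambda>k. r (Suc (\<sigma> k)) * v) \<longlonglongrightarrow> r' * v"
      by (intro tendsto_mult tendsto_const filterlim_compose[OF r' s])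
    have "filterlim (\<lambda>n. sqrt (real n) * r n * v) at_top sequentially"
      using filterlim_tendsto_pos_mult_at_top[OF tendsto_const v c] by (simp add: mult.commute)
    from filterlim_compose[OF this s]
    show "filterlim (\<lambda>k. sqrt (real (Suc (\<sigma> k))) * (r (Suc (\<sigma> k)) * v)) at_top sequentially"
      by (simp only: mult.assoc)
  qed (use r v in \<open>auto simp: less_imp_le\<close>)
qed

lemma norm_orthogonal_matrix:
  fixes U :: "real^'n^'n"
  assumes "orthogonal_matrix U"
  shows "norm (U *v x) = norm x"
proof -
  have "(U *v x) \<bullet> (U *v x) = (transpose U *v (U *v x)) \<bullet> x"
    using dot_lmul_matrix[of "U *v x" U x] by simp
  also have "transpose U *v (U *v x) = x"
    using assms by (simp only: orthogonal_matrix_def matrix_vector_mul_assoc) simp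
  finally show ?thesis by (simp add: norm_eq_sqrt_inner)
qed

lemma rayleigh_max_conj:
  fixes U :: "real^'n^'n"
  assumes U: "orthogonal_matrix U"
  shows "rayleigh_max (U ** A ** transpose U) = rayleigh_max A"
proof -
  have le: "rayleigh_max (V ** B ** transpose V) \<le> rayleigh_max B" if V: "orthogonal_matrix V" for V B :: "real^'n^'n"
  proof (rule rayleigh_max_least)
    fix x :: "real^'n" assume x: "norm x = 1"
    have "orthogonal_matrix (transpose V)" using V by (simp add: orthogonal_matrix_def)
    then have "norm (transpose V *v x) = 1"
      using x by (simp only: norm_orthogonal_matrix)
    moreover have "x \<bullet> ((V ** B ** transpose V) *v x) = (transpose V *v x) \<bullet> (B *v (transpose V *v x))"
      by (simp add: matrix_vector_mul_assoc[symmetric] dot_lmul_matrix[symmetric] vector_transpose_matrix)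
    ultimately show "x \<bullet> ((V ** B ** transpose V) *v x) \<le> rayleigh_max B"
      using rayleigh_le by metis
  qed
  have U': "orthogonal_matrix (transpose U)" using U by (simp add: orthogonal_matrix_def)
  have "transpose U ** (U ** A ** transpose U) ** transpose (transpose U)
     = (transpose U ** U) ** A ** (transpose U ** U)" by (simp add: matrix_mul_assoc)
  then have "transpose U ** (U ** A ** transpose U) ** transpose (transpose U) = A"
    using U by (simp add: orthogonal_matrix_def)
  then show ?thesis using le[OF U, of A] le[OF U', of "U ** A ** transpose U"] by simp
qed

text \<open>A rotation that takes the first axis to \<open>\<theta>\<close> turns the limit for the direction \<open>\<theta>\<close> into the one
  for the first axis; the law of \<open>Z\<close> does not change under it.\<close>

lemma gap_form_conj:
  fixes U :: "real^'n^'n"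
  assumes U: "orthogonal_matrix U" and Ue: "U *v e = \<theta>"
  shows "norm ((U ** A ** transpose U + c *\<^sub>R outer_prod \<theta> \<theta>) *v \<theta>
      - rayleigh_max (U ** A ** transpose U + c *\<^sub>R outer_prod \<theta> \<theta>) *\<^sub>R \<theta>)
    = norm ((A + c *\<^sub>R outer_prod e e) *v e - rayleigh_max (A + c *\<^sub>R outer_prod e e) *\<^sub>R e)"
proof -
  let ?B = "A + c *\<^sub>R outer_prod e e"
  have "outer_prod \<theta> \<theta> = U ** outer_prod e e ** transpose U"
  proof (rule matrix_eq_vecI)
    fix x
    have "\<theta> \<bullet> x = e \<bullet> (transpose U *v x)"
      by (simp add: Ue[symmetric]) (metis dot_lmul_matrix inner_commute transpose_matrix_vector)
    then show "outer_prod \<theta> \<theta> *v x = (U ** outer_prod e e ** transpose U) *v x"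
      by (simp add: matrix_vector_mul_assoc[symmetric] outer_prod_vec matrix_vector_mult_scaleR Ue
         del: transpose_matrix_vector)
  qed
  then have B: "U ** A ** transpose U + c *\<^sub>R outer_prod \<theta> \<theta> = U ** ?B ** transpose U"
    by (intro matrix_eq_vecI) (simp add: matrix_vector_mul_assoc[symmetric] matrix_vector_mult_add_rdistrib
       scaleR_matrix_vector_assoc[symmetric] matrix_vector_right_distrib matrix_vector_mult_scaleR)
  have "transpose U ** U = mat 1" using U by (simp add: orthogonal_matrix_def)
  then have "transpose U *v \<theta> = e" by (simp add: Ue[symmetric] matrix_vector_mul_assoc del: transpose_matrix_vector)
  then have "(U ** ?B ** transpose U) *v \<theta> - rayleigh_max (U ** ?B ** transpose U) *\<^sub>R \<theta>
      = U *v (?B *v e - rayleigh_max ?B *\<^sub>R e)"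
    by (simp add: rayleigh_max_conj[OF U] matrix_vector_mul_assoc[symmetric] matrix_vector_mult_diff_distrib
       matrix_vector_mult_scaleR Ue del: transpose_matrix_vector)
  moreover have "norm (U *v x) = norm x" for x
    by (rule norm_orthogonal_matrix[OF U])
  ultimately show ?thesis unfolding B by simp
qed

lemma outer_prod_first: "c *\<^sub>R outer_prod (axis first_index 1) (axis first_index 1) = diag_first c"
  by (auto simp: vec_eq_iff outer_prod_def diag_first_def axis_def)

theorem goe_eigen_sum:
  fixes Z :: "'b \<Rightarrow> (real^'p::{finite,linorder})^'p::{finite,linorder}"
  assumes N: "prob_space N" and Z: "goe N Z" and card: "CARD('p) \<ge> 2"
    and w: "AE \<omega> in N. \<forall>j\<in>{1..CARD('p)}.
         unit_eigenvector (Z \<omega> + diag_first c) (eigval (Z \<omega> + diag_first c) j) (w j \<omega>)"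
  shows "AE \<omega> in N. (\<Sum>j=2..CARD('p). (eigval (Z \<omega> + diag_first c) 1 - eigval (Z \<omega> + diag_first c) j)\<^sup>2 *
                 (w j \<omega> $ first_index)\<^sup>2)
       = (norm ((Z \<omega> + diag_first c) *v axis first_index 1
            - rayleigh_max (Z \<omega> + diag_first c) *\<^sub>R axis first_index 1))\<^sup>2"
      (is "AE \<omega> in N. ?sum \<omega> = _")
    and "AE \<omega> in N. \<forall>j\<in>{1..CARD('p)}. \<forall>u.
             unit_eigenvector (Z \<omega> + diag_first c) (eigval (Z \<omega> + diag_first c) j) u \<longrightarrow>
             u = w j \<omega> \<or> u = - w j \<omega>"
proof -
  let ?A = "\<lambda>\<omega>. Z \<omega> + diag_first c"
  let ?e = "axis (first_index::'p) (1::real)"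
  have sym: "transpose (?A \<omega>) = ?A \<omega>" if "transpose (Z \<omega>) = Z \<omega>" for \<omega>
    using that by (simp add: transpose_add) (auto simp: vec_eq_iff transpose_def diag_first_def)
  note ae = goe_symmetric[OF Z] goe_simple_spectrum[OF N Z card, of "diag_first c"] w
  show "AE \<omega> in N. ?sum \<omega> = (norm (?A \<omega> *v ?e - rayleigh_max (?A \<omega>) *\<^sub>R ?e))\<^sup>2"
    using ae
  proof eventually_elim
    case (elim \<omega>)
    have "w j \<omega> $ first_index = w j \<omega> \<bullet> ?e" for j by (simp add: inner_axis)
    then show ?case using sum_eigenvectors_eq[OF sym[OF elim(1)] elim(2,3), of ?e] by (simp only:)
  qed
  show "AE \<omega> in N. \<forall>j\<in>{1..CARD('p)}. \<forall>u. unit_eigenvector (?A \<omega>) (eigval (?A \<omega>) j) u \<longrightarrow>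
      u = w j \<omega> \<or> u = - w j \<omega>"
    using ae
  proof eventually_elim
    case (elim \<omega>)
    then show ?case using simple_unit_eigenvector[OF sym[OF elim(1)] elim(2)] by blast
  qed
qed

text \<open>Eigenvectors are an arbitrary choice, so \<open>T\<close> is only known to agree almost surely with a
  measurable function. The completion makes it measurable.\<close>

lemma converges_in_distribution_AE:
  assumes [measurable]: "R \<in> borel_measurable N" and ae: "AE \<omega> in N. T \<omega> = R \<omega>"
    and conv: "weak_conv_m (\<lambda>n. distr (M n) borel (Q n)) (distr N borel R)"
  shows "converges_in_distribution M Q N T"
proof -
  have Rc: "R \<in> borel_measurable (completion N)" by (rule measurable_completion) measurable
  have aec: "AE \<omega> in completion N. T \<omega> = R \<omega>" using ae by (rule AE_completion)
  have Tc: "T \<in> borel_measurable (completion N)"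
  proof (rule measurableI)
    fix B :: "real set" assume B: "B \<in> sets borel"
    have R: "R -` B \<inter> space (completion N) \<in> sets (completion N)" using measurable_sets[OF Rc B] .
    have "AE \<omega> in completion N. \<omega> \<in> R -` B \<inter> space (completion N) \<longleftrightarrow> \<omega> \<in> T -` B \<inter> space (completion N)"
      using aec by eventually_elim auto
    then show "T -` B \<inter> space (completion N) \<in> sets (completion N)"
      by (rule completion.in_sets_AE[OF _ R]) auto
  qed simp
  have "distr (completion N) borel T = distr (completion N) borel R"
    by (intro distr_cong_AE aec Tc Rc refl)
  also have "\<dots> = distr N borel R" by (rule distr_completion) measurable
  finally show ?thesis using Tc conv by (simp add: converges_in_distribution_def)
qed

theorem anderson_nongaussian_limit:
  fixes X :: "nat \<Rightarrow> nat \<Rightarrow> 'a \<Rightarrow> real^'p::{finite,linorder}" and Z :: "'b \<Rightarrow> (real^'p::{finite,linorder})^'p::{finite,linorder}"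
  assumes \<theta>: "norm \<theta> = 1" and v: "0 < v" and r: "\<forall>n\<ge>1. 0 < r n" and card: "CARD('p) \<ge> 2"
    and model: "spiked_model M X \<theta> r v" and N: "prob_space N" and Z: "goe N Z"
    and c: "(\<lambda>n. sqrt (real n) * (r n * v)) \<longlonglongrightarrow> c"
    and w: "AE \<omega> in N. \<forall>j\<in>{1..CARD('p)}.
         unit_eigenvector (Z \<omega> + diag_first c) (eigval (Z \<omega> + diag_first c) j) (w j \<omega>)"
  shows "converges_in_distribution M (\<lambda>n \<omega>. anderson_stat n \<theta> (\<lambda>i. X n i \<omega>)) N
     (\<lambda>\<omega>. \<Sum>j=2..CARD('p). (eigval (Z \<omega> + diag_first c) 1 - eigval (Z \<omega> + diag_first c) j)\<^sup>2 *
                 (w j \<omega> $ first_index)\<^sup>2)"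
proof (rule converges_in_distribution_AE[OF _ goe_eigen_sum(1)[OF N Z card w]])
  let ?e = "axis (first_index::'p) (1::real)"
  let ?H = "\<lambda>A. (norm ((A + diag_first c) *v ?e - rayleigh_max (A + diag_first c) *\<^sub>R ?e))\<^sup>2"
  have "continuous_on UNIV ?H"
    unfolding continuous_on_def by (auto intro!: tendsto_intros tendsto_rayleigh_max)
  then show "(\<lambda>\<omega>. ?H (Z \<omega>)) \<in> borel_measurable N"
    using goe_measurable[OF Z] borel_measurable_continuous_onI measurable_compose by blast
  obtain U where U: "orthogonal_matrix U" "U *v ?e = \<theta>" using orthogonal_matrix_exists_basis[OF \<theta>] by blast
  show "weak_conv_m (\<lambda>n. distr (M n) borel (\<lambda>\<omega>. anderson_stat n \<theta> (\<lambda>i. X n i \<omega>))) (distr N borel (\<lambda>\<omega>. ?H (Z \<omega>)))"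
    using anderson_weak_limit_weak_spike[OF \<theta> v r model N goe_conj[OF Z U(1)] c]
    unfolding gap_form_conj[OF U] outer_prod_first .
qed

theorem anderson_chi_square_limit:
  fixes X :: "nat \<Rightarrow> nat \<Rightarrow> 'a \<Rightarrow> real^'n" and Z :: "'b \<Rightarrow> real^'n^'n"
  assumes \<theta>: "norm \<theta> = 1" and v: "0 < v" and r: "\<forall>n\<ge>1. 0 < r n"
    and model: "spiked_model M X \<theta> r v" and N: "prob_space N" and Z: "goe N Z"
    and r': "r \<longlonglongrightarrow> r'" and c: "filterlim (\<lambda>n. sqrt (real n) * r n) at_top sequentially"
  shows "weak_conv_m (\<lambda>n. distr (M n) borel (\<lambda>\<omega>. anderson_stat n \<theta> (\<lambda>i. X n i \<omega>))) (chi_square (CARD('n) - 1))"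
proof -
  obtain k :: 'n where True by simp
  let ?e = "axis k (1::real)"
  obtain U where U: "orthogonal_matrix U" "U *v ?e = \<theta>" using orthogonal_matrix_exists_basis[OF \<theta>] by blast
  have UU: "transpose U ** U = mat 1" using U by (simp add: orthogonal_matrix_def)
  then have Ut: "transpose U *v \<theta> = ?e" by (simp add: U(2)[symmetric] matrix_vector_mul_assoc del: transpose_matrix_vector)
  have nU: "norm (U *v x) = norm x" for x
    by (rule norm_orthogonal_matrix[OF U(1)])
  have "perp_comp \<theta> ((U ** A ** transpose U) *v \<theta>) = U *v perp_comp ?e (A *v ?e)" for A
  proof -
    have "\<theta> \<bullet> (U *v x) = ?e \<bullet> x" for x
    proof -
      have "\<theta> \<bullet> (U *v x) = (transpose U *v \<theta>) \<bullet> x" by (simp add: dot_lmul_matrix)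
      then show ?thesis by (simp only: Ut)
    qed
    then show ?thesis
      by (simp add: perp_comp_def matrix_vector_mul_assoc[symmetric] Ut matrix_vector_mult_diff_distrib
          matrix_vector_mult_scaleR U(2) del: transpose_matrix_vector)
  qed
  then have "norm (perp_comp \<theta> ((U ** Z \<omega> ** transpose U) *v \<theta>)) = norm (perp_comp ?e (Z \<omega> *v ?e))" for \<omega>
    by (simp only: nU)
  then show ?thesis
    using anderson_weak_limit_strong_spike[OF \<theta> v r model N goe_conj[OF Z U(1)] r' c]
    by (simp only: goe_chi_square[OF N Z])
qed

text \<open>The chi-square law has no atoms, so its distribution function is continuous at the quantile
  and takes the value \<open>1 - \<alpha>\<close> there.\<close>

theorem anderson_rejection_limit:
  fixes X :: "nat \<Rightarrow> nat \<Rightarrow> 'a \<Rightarrow> real^'p"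
  assumes model: "spiked_model M X \<theta> r v" and card: "CARD('p) \<ge> 2" and \<alpha>: "\<alpha> \<in> {0<..<1}"
    and conv: "weak_conv_m (\<lambda>n. distr (M n) borel (\<lambda>\<omega>. anderson_stat n \<theta> (\<lambda>i. X n i \<omega>))) (chi_square (CARD('p) - 1))"
  shows "(\<lambda>n. measure (M n) {\<omega> \<in> space (M n). anderson_rejects \<alpha> n \<theta> (\<lambda>i. X n i \<omega>)}) \<longlonglongrightarrow> \<alpha>"
proof -
  let ?D = "\<lambda>n. distr (M n) borel (\<lambda>\<omega>. anderson_stat n \<theta> (\<lambda>i. X n i \<omega>))"
  let ?q = "chi_square_upper_quantile (CARD('p) - 1) \<alpha>"
  interpret C: real_distribution "chi_square (CARD('p) - 1)" by (rule real_distribution_chi_square)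
  have atom: "measure (chi_square (CARD('p) - 1)) {x} = 0" for x using card by (intro chi_square_no_atom) simp
  have q: "cdf (chi_square (CARD('p) - 1)) ?q = 1 - \<alpha>"
    unfolding chi_square_upper_quantile_def using C.cdf_quantile[OF atom] \<alpha> by simp
  have "isCont (cdf (chi_square (CARD('p) - 1))) ?q" by (simp only: C.isCont_cdf atom)
  then have "(\<lambda>n. cdf (?D n) ?q) \<longlonglongrightarrow> 1 - \<alpha>"
    using conv unfolding q[symmetric] weak_conv_m_def weak_conv_def by blast
  then have "(\<lambda>n. 1 - cdf (?D n) ?q) \<longlonglongrightarrow> 1 - (1 - \<alpha>)" by (intro tendsto_intros)
  moreover have "1 - cdf (?D n) ?q = measure (M n) {\<omega> \<in> space (M n). anderson_rejects \<alpha> n \<theta> (\<lambda>i. X n i \<omega>)}"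
    if n: "1 \<le> n" for n
  proof -
    interpret prob_space "M n" using model n by (simp add: spiked_model_def)
    have [measurable]: "(\<lambda>\<omega>. anderson_stat n \<theta> (\<lambda>i. X n i \<omega>)) \<in> borel_measurable (M n)"
      using model n by (intro borel_measurable_anderson_stat) (auto simp: spiked_model_def multivariate_normal_def)
    have "cdf (?D n) ?q = prob {\<omega> \<in> space (M n). anderson_stat n \<theta> (\<lambda>i. X n i \<omega>) \<le> ?q}"
      by (simp add: cdf_def measure_distr vimage_def Int_def conj_commute)
    moreover have "prob {\<omega> \<in> space (M n). \<not> anderson_stat n \<theta> (\<lambda>i. X n i \<omega>) \<le> ?q}
       = 1 - prob {\<omega> \<in> space (M n). anderson_stat n \<theta> (\<lambda>i. X n i \<omega>) \<le> ?q}"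
      by (rule prob_neg) measurable
    ultimately show ?thesis by (simp add: anderson_rejects_def not_le)
  qed
  then have "eventually (\<lambda>n. 1 - cdf (?D n) ?q
      = measure (M n) {\<omega> \<in> space (M n). anderson_rejects \<alpha> n \<theta> (\<lambda>i. X n i \<omega>)}) sequentially"
    by (rule eventually_sequentiallyI)
  ultimately show ?thesis using Lim_transform_eventually by fastforce
qed

theorem theorem3p2:
  fixes \<theta>\<^sub>0 :: "real^'p::{finite,linorder}"
    and v :: real
    and r :: "nat \<Rightarrow> real"
    and M :: "nat \<Rightarrow> 'a measure"
    and X :: "nat \<Rightarrow> nat \<Rightarrow> 'a \<Rightarrow> real^'p::{finite,linorder}"
    and N :: "'b measure"
    and Z :: "'b \<Rightarrow> (real^'p::{finite,linorder})^'p::{finite,linorder}"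
  assumes "CARD('p) \<ge> 2"
    and "norm \<theta>\<^sub>0 = 1"
    and "v > 0"
    and "\<forall>n\<ge>1. r n > 0"
    and "Bseq r"
    and "prob_space N"
    and "multivariate_normal N (\<lambda>\<omega>. vec_of (Z \<omega>)) 0 (mat 1 + commutation_matrix)"
    and "spiked_model M X \<theta>\<^sub>0 r v"
  shows
    "((\<forall>n\<ge>1. r n = 1) \<or>
      (r \<in> o(\<lambda>_. 1) \<and> filterlim (\<lambda>n. sqrt (real n) * r n) at_top sequentially) \<longrightarrow>
        weak_conv_m (\<lambda>n. distr (M n) borel (\<lambda>\<omega>. anderson_stat n \<theta>\<^sub>0 (\<lambda>i. X n i \<omega>)))
          (chi_square (CARD('p) - 1)) \<and>
        (\<forall>\<alpha>\<in>{0<..<1}.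
          (\<lambda>n. measure (M n) {\<omega> \<in> space (M n). anderson_rejects \<alpha> n \<theta>\<^sub>0 (\<lambda>i. X n i \<omega>)})
            \<longlonglongrightarrow> \<alpha>))
     \<and>
     ((\<forall>n\<ge>1. r n = 1 / sqrt (real n)) \<longrightarrow>
        (\<forall>w :: nat \<Rightarrow> 'b \<Rightarrow> real^'p::{finite,linorder}.
          (AE \<omega> in N. \<forall>j\<in>{1..CARD('p)}.
             unit_eigenvector (Z \<omega> + diag_first v) (eigval (Z \<omega> + diag_first v) j) (w j \<omega>)) \<longrightarrow>
          converges_in_distribution
            M (\<lambda>n \<omega>. anderson_stat n \<theta>\<^sub>0 (\<lambda>i. X n i \<omega>))
            N (\<lambda>\<omega>. \<Sum>j=2..CARD('p).
                 (eigval (Z \<omega> + diag_first v) 1 - eigval (Z \<omega> + diag_first v) j)\<^sup>2 *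
                 (w j \<omega> $ first_index)\<^sup>2) \<and>
          (AE \<omega> in N. \<forall>j\<in>{1..CARD('p)}. \<forall>u.
             unit_eigenvector (Z \<omega> + diag_first v) (eigval (Z \<omega> + diag_first v) j) u \<longrightarrow>
             u = w j \<omega> \<or> u = - w j \<omega>)))
     \<and>
     (r \<in> o(\<lambda>n. 1 / sqrt (real n)) \<longrightarrow>
        (\<forall>w :: nat \<Rightarrow> 'b \<Rightarrow> real^'p::{finite,linorder}.
          (AE \<omega> in N. \<forall>j\<in>{1..CARD('p)}.
             unit_eigenvector (Z \<omega>) (eigval (Z \<omega>) j) (w j \<omega>)) \<longrightarrow>
          converges_in_distribution
            M (\<lambda>n \<omega>. anderson_stat n \<theta>\<^sub>0 (\<lambda>i. X n i \<omega>))
            N (\<lambda>\<omega>. \<Sum>j=2..CARD('p).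
                 (eigval (Z \<omega>) 1 - eigval (Z \<omega>) j)\<^sup>2 * (w j \<omega> $ first_index)\<^sup>2)))"
proof -
  note \<theta> = assms(2) and v = assms(3) and r = assms(4) and N = assms(6) and model = assms(8)
  have Z: "goe N Z" by (rule goe_of_multivariate_normal[OF assms(7)])
  have chi: "weak_conv_m (\<lambda>n. distr (M n) borel (\<lambda>\<omega>. anderson_stat n \<theta>\<^sub>0 (\<lambda>i. X n i \<omega>)))
      (chi_square (CARD('p) - 1))"
    if regime: "(\<forall>n\<ge>1. r n = 1) \<or>
      (r \<in> o(\<lambda>_. 1) \<and> filterlim (\<lambda>n. sqrt (real n) * r n) at_top sequentially)"
  proof -
    have "\<exists>r'. r \<longlonglongrightarrow> r' \<and> filterlim (\<lambda>n. sqrt (real n) * r n) at_top sequentially"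
      using regime
    proof
      assume one: "\<forall>n\<ge>1. r n = 1"
      then have ev: "eventually (\<lambda>n. 1 = r n) sequentially" by (auto simp: eventually_sequentially)
      then have ev': "eventually (\<lambda>n. sqrt (real n) = sqrt (real n) * r n) sequentially" by eventually_elim simp
      have "r \<longlonglongrightarrow> 1" by (rule Lim_transform_eventually[OF tendsto_const ev])
      moreover have "filterlim (\<lambda>n. sqrt (real n) * r n) at_top sequentially"
        using filterlim_compose[OF sqrt_at_top filterlim_real_sequentially]
        by (rule filterlim_cong[OF refl refl ev', THEN iffD1])
      ultimately show ?thesis by blast
    next
      assume "r \<in> o(\<lambda>_. 1) \<and> filterlim (\<lambda>n. sqrt (real n) * r n) at_top sequentially"
      then show ?thesis using smalloD_tendsto[of r sequentially "\<lambda>_. 1"] by auto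
    qed
    then show ?thesis using anderson_chi_square_limit[OF \<theta> v r model N Z] by blast
  qed
  have critical: "(\<lambda>n. sqrt (real n) * (r n * v)) \<longlonglongrightarrow> v" if "\<forall>n\<ge>1. r n = 1 / sqrt (real n)"
  proof (rule Lim_transform_eventually[OF tendsto_const])
    show "eventually (\<lambda>n. v = sqrt (real n) * (r n * v)) sequentially"
      using that by (intro eventually_sequentiallyI[of 1]) auto
  qed
  have subcritical: "(\<lambda>n. sqrt (real n) * (r n * v)) \<longlonglongrightarrow> 0" if "r \<in> o(\<lambda>n. 1 / sqrt (real n))"
  proof -
    have "(\<lambda>n. r n / (1 / sqrt (real n)) * v) \<longlonglongrightarrow> 0 * v"
      using that by (intro tendsto_mult tendsto_const smalloD_tendsto)
    then show ?thesis by (simp add: mult_ac)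
  qed
  have diag0: "diag_first 0 = (0 :: (real^'p::{finite,linorder})^'p::{finite,linorder})"
    by (simp add: diag_first_def vec_eq_iff)
  show ?thesis
  proof (intro conjI impI allI ballI, goal_cases)
    case 1
    then show ?case by (rule chi)
  next
    case (2 \<alpha>)
    then show ?case using anderson_rejection_limit[OF model assms(1) _ chi] by blast
  next
    case (3 w)
    show ?case by (rule anderson_nongaussian_limit[OF \<theta> v r assms(1) model N Z critical[OF 3(1)] 3(2)])
  next
    case (4 w)
    show ?case by (rule goe_eigen_sum(2)[OF N Z assms(1) 4(2)])
  next
    case (5 w)
    then show ?case
      using anderson_nongaussian_limit[OF \<theta> v r assms(1) model N Z subcritical] by (simp add: diag0)
  qed
qed

end
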